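(* Consider the uncertain linear time-delay system $$\dot x(t)=\sum_{j=0}^{m}A_jx(t-h_j)+B\big(u(t)+\delta(t,\bar x)\big),\ t\ge 0,\qquad x(t)=\varphi(t),\ t\in[-h_m,0],$$ with the control law $u(t)=v_{nom}(t)+v(t)$, where $v_{nom}(t)=\sum_{j=0}^m K_jx(t-h_j)$, $G_j=A_j+BK_j$, $$v(t)=-(2B^TPB)^{-1}\Big(2B^TP\sum_{j=0}^{m}G_jx(t-h_j)-u_{sta}(t)\Big),$$ $$u_{sta}(t)=-k_1(t,\bar x,\bar{\bar x})\,\xi_1(w)+\rho(t),\qquad \dot\rho(t)=-k_2(t,\bar x,\bar{\bar x})\,\xi_2(w),\qquad w(t)=2B^TPx(t),$$ with gains $$k_1=\delta_0+\frac1\beta\Big(\frac1{4\epsilon}(4\epsilon\rho_1+\rho_2)^2+2\epsilon\rho_2+\epsilon+(2\epsilon+\rho_1)(\beta+4\epsilon^2)\Big),\qquad k_2=\beta+4\epsilon^2+2\epsilon k_1,$$ where $\delta_0,\beta,\epsilon\in\mathbb R_+$ and $k_3$ (entering $\xi_1,\xi_2$) is any positive real number. All objects are as defined in the context. Suppose that Assumptions (A1), (A2), (A3) and (A4) listed in the context are satisfied. Then the trajectories of the closed-loop system reach the sliding manifold $\mathcal S=\{x\in\mathbb R^n: 2B^TPx=0\}$ in finite time $$T=\frac{2}{\eta_2}\ln\Big(1+\frac{\eta_2}{\eta_1}\sqrt{V_{st}(w_0,z_0)}\Big),\qquad\text{with}\quad \eta_1=\frac{\epsilon\sqrt{\lambda_{\min}(P_{st})}}{\lambda_{\max}(P_{st})},\quad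 \eta_2=\frac{2\epsilon k_3}{\lambda_{\max}(P_{st})},$$ and after that they asymptotically converge to the origin.
   Context: **System data.** $x(t)\in\mathbb R^n$, $A_j\in\mathbb R^{n\times n}$ ($j=0,\dots,m$), $B\in\mathbb R^{n\times k}$, $K_j\in\mathbb R^{k\times n}$; the delays $0=h_0<h_1<\dots<h_m$ are known; the initial function $\varphi:[-h_m,0]\to\mathbb R^n$ is continuous. $\bar x(t)=(x^T(t),x^T(t-h_1),\dots,x^T(t-h_m))^T\in\mathbb R^{(m+1)n}$. $x_t(\theta)=x(t+\theta)$, $\theta\in[-h_m,0]$. $\|\cdot\|$ is the Euclidean norm, $\|\varphi\|_{\mathcal H}=\sup_{\theta\in[-h_m,0]}\|\varphi(\theta)\|$, and $\mathbb R_+$ is the set of positive real numbers. The uncertainty $\delta(t,\bar x)\in\mathbb R^k$ is continuous in $\bar x$ for all $t$ and Lebesgue measurable in $t$ for all $\bar x$. It is assumed that it can be divided into vanishing and non-vanishing terms (see (A3)); the non-vanishing terms are continuously differentiable in time, and their derivative and the vanishing terms are bounded by time-dependent Lebesgue integrable functions. **Nominal closed loop.** The gains $K_j$ are such that the trivial solution of $$\dot x(t)=\sum_{j=0}^mG_jx(t-h_j),\qquad G_j=A_j+BK_j,\qquad (N)$$ is asymptotically stable. **(A1)** There is a Lyapunov-Krasovskii functional of the form $$V(\varphi)=\varphi^T(0)P\varphi(0)+\sum_{j=1}^m\int_{-h_j}^0F_j\big(\vec h,\theta,\varphi(\theta)\big)\,d\theta,$$ with $P\in\mathbb R^{n\times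 n}$ positive definite, $\vec h=(h_1,\dots,h_m)$ and $F_j$ continuous, such that for some $\alpha_1,\alpha_2,\alpha_3\in\mathbb R_+$: $\alpha_1\|\varphi(0)\|^2\le V(\varphi)\le\alpha_2\|\varphi\|_{\mathcal H}^2$, and the time derivative of $V$ along solutions of (N) satisfies $\dot V(x_t)\le-\alpha_3\|x(t)\|^2$. The matrix $P$ in the control law is this $P$. **(A2)** $\operatorname{rank}B=k$. **(A3)** The uncertainty can be divided as $2B^TPB\,\delta(t,\bar x)=d_1(t,x)+\delta_z(t,\bar x)$, where $d_1(t,x)=0$ if $x\in\mathcal S$, and $\frac{\partial\delta_z}{\partial x(t-h_j)}B=0$ for $j=0,\dots,m$. **(A4)** There are known functions $\rho_1(t,x)$ and $\rho_2(t,\bar x,\bar{\bar x})$ with values in $\mathbb R_+$ such that $$\|d_1(t,x)\|\le\rho_1(t,x)\|\xi_1(w)\|,\qquad \|d_2(t,\bar x,\bar{\bar x})\|\le\rho_2(t,\bar x,\bar{\bar x})\|\xi_2(w)\|,$$ where $d_2(t,\bar x,\bar{\bar x}):=\dot\delta_z(t,\bar x)=\frac{\partial\delta_z}{\partial t}+\bar{\bar x}(t)$ and $\bar{\bar x}(t):=\frac{\partial\delta_z}{\partial\bar x}\dot{\bar x}(t)$ (so $\bar{\bar x}$ depends on terms $x(t-h_\kappa)$ with $h_\kappa$ a sum of two delays $h_i+h_j$, $i,j\in\{0,\dots,m\}$). **Functions $\xi_1,\xi_2$.** $$\xi_1(w)=\frac{w}{\|w\|^{1/2}}+k_3w,\qquad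 \xi_2(w)=\frac{w}{2\|w\|}+\frac{3k_3}{2}\frac{w}{\|w\|^{1/2}}+k_3^2w,\qquad w\in\mathbb R^k.$$ **Function $V_{st}$.** $z(t):=\rho(t)+\delta_z(t,\bar x)$; $w_0,z_0$ are the initial values of $w,z$; and $$V_{st}(w,z)=\gamma^TP_{st}\gamma,\quad \gamma=\begin{pmatrix}\xi_1(w)\\ z\end{pmatrix},\quad P_{st}=\begin{pmatrix}(\beta+4\epsilon^2)I&-2\epsilon I\\-2\epsilon I&I\end{pmatrix},$$ with $I$ the $k\times k$ identity; $\lambda_{\min},\lambda_{\max}$ denote smallest and largest eigenvalues. *)

theory Defs
  imports "HOL-Analysis.Analysis"
begin

text \<open>
  Delays are indexed by a finite linear order \<open>'d\<close> with \<open>m + 1\<close> elements; its least element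
  \<open>Min UNIV\<close> plays the role of the index \<open>0\<close> and its greatest element \<open>Max UNIV\<close> that of \<open>m\<close>.
  The stacked state in $R^{(m+1)n}$ has type \<open>real^'n^'d\<close>, its \<open>j\<close>-th block being \<open>X $ j\<close>.
  History segments on $[-h_m, 0]$ are functions on \<open>real\<close> of which only the values on
  that interval are used.
\<close>

definition stacked :: "('d::{finite,linorder} \<Rightarrow> real) \<Rightarrow> (real \<Rightarrow> real^'n) \<Rightarrow> real \<Rightarrow> real^'n^'d::{finite,linorder}"
  where "stacked h x t = (\<chi> j. x (t - h j))"

definition max_delay :: "('d::{finite,linorder} \<Rightarrow> real) \<Rightarrow> real"
  where "max_delay h = h (Max UNIV)"

definition segment :: "(real \<Rightarrow> 'a) \<Rightarrow> real \<Rightarrow> real \<Rightarrow> 'a"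
  where "segment x t = (\<lambda>\<theta>. x (t + \<theta>))"

definition hist_norm :: "('d::{finite,linorder} \<Rightarrow> real) \<Rightarrow> (real \<Rightarrow> real^'n) \<Rightarrow> real"
  where "hist_norm h \<phi> = (SUP \<theta>\<in>{- max_delay h..0}. norm (\<phi> \<theta>))"

definition nominal_solution ::
    "('d::{finite,linorder} \<Rightarrow> real) \<Rightarrow> ('d \<Rightarrow> real^'n^'n) \<Rightarrow> (real \<Rightarrow> real^'n) \<Rightarrow> bool"
  where "nominal_solution h G x \<longleftrightarrow>
    continuous_on {- max_delay h..} x \<and>
    (\<forall>t\<ge>0. (x has_vector_derivative (\<Sum>j\<in>UNIV. G j *v x (t - h j))) (at t within {0..}))"

definition nominal_asymptotically_stable ::
    "('d::{finite,linorder} \<Rightarrow> real) \<Rightarrow> ('d \<Rightarrow> real^'n^'n) \<Rightarrow> bool"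
  where "nominal_asymptotically_stable h G \<longleftrightarrow>
    (\<forall>e>0. \<exists>d>0. \<forall>x. nominal_solution h G x \<and> hist_norm h x < d \<longrightarrow> (\<forall>t\<ge>0. norm (x t) < e)) \<and>
    (\<exists>d>0. \<forall>x. nominal_solution h G x \<and> hist_norm h x < d \<longrightarrow> (x \<longlongrightarrow> 0) at_top)"

definition positive_definite :: "real^'n^'n \<Rightarrow> bool"
  where "positive_definite P \<longleftrightarrow> transpose P = P \<and> (\<forall>x. x \<noteq> 0 \<longrightarrow> 0 < x \<bullet> (P *v x))"

text \<open>The delays are fixed, so they are not listed as an argument of \<open>F j\<close>.\<close>

definition LK_functional ::
    "('d::{finite,linorder} \<Rightarrow> real) \<Rightarrow> real^'n^'n \<Rightarrow> ('d \<Rightarrow> real \<Rightarrow> real^'n \<Rightarrow> real) \<Rightarrow>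
     (real \<Rightarrow> real^'n) \<Rightarrow> real"
  where "LK_functional h P F \<phi> =
    \<phi> 0 \<bullet> (P *v \<phi> 0) + (\<Sum>j\<in>UNIV - {Min UNIV}. integral {- h j..0} (\<lambda>\<theta>. F j \<theta> (\<phi> \<theta>)))"

text \<open>
  As \<open>F j\<close> is only continuous, the functional need not be differentiable along solutions.
  Its time derivative is therefore read as the upper right-hand derivative usual in
  Lyapunov-Krasovskii theory, which is the ordinary derivative whenever that exists.
\<close>

definition derivative_along ::
    "((real \<Rightarrow> real^'n) \<Rightarrow> real) \<Rightarrow> (real \<Rightarrow> real^'n) \<Rightarrow> real \<Rightarrow> ereal"
  where "derivative_along V x t =
    Limsup (at_right 0) (\<lambda>s. ereal ((V (segment x (t + s)) - V (segment x t)) / s))"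

definition LK_assumption ::
    "('d::{finite,linorder} \<Rightarrow> real) \<Rightarrow> ('d \<Rightarrow> real^'n^'n) \<Rightarrow> real^'n^'n \<Rightarrow>
     ('d \<Rightarrow> real \<Rightarrow> real^'n \<Rightarrow> real) \<Rightarrow> bool"
  where "LK_assumption h G P F \<longleftrightarrow>
    positive_definite P \<and>
    (\<forall>j\<in>UNIV - {Min UNIV}. continuous_on ({- h j..0} \<times> UNIV) (\<lambda>(\<theta>, y). F j \<theta> y)) \<and>
    (\<exists>\<alpha>1>0. \<exists>\<alpha>2>0. \<exists>\<alpha>3>0.
      (\<forall>\<phi>. continuous_on {- max_delay h..0} \<phi> \<longrightarrow>
        \<alpha>1 * (norm (\<phi> 0))\<^sup>2 \<le> LK_functional h P F \<phi> \<and>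
        LK_functional h P F \<phi> \<le> \<alpha>2 * (hist_norm h \<phi>)\<^sup>2) \<and>
      (\<forall>x. nominal_solution h G x \<longrightarrow>
        (\<forall>t\<ge>0. derivative_along (LK_functional h P F) x t \<le> ereal (- \<alpha>3 * (norm (x t))\<^sup>2))))"

definition switching :: "real^'k^'n \<Rightarrow> real^'n^'n \<Rightarrow> real^'n \<Rightarrow> real^'k"
  where "switching B P x = (2 *\<^sub>R (transpose B ** P)) *v x"

definition sliding_manifold :: "real^'k^'n \<Rightarrow> real^'n^'n \<Rightarrow> (real^'n) set"
  where "sliding_manifold B P = {x. switching B P x = 0}"

definition input_matrix :: "real^'k^'n \<Rightarrow> real^'n^'n \<Rightarrow> real^'k^'k"
  where "input_matrix B P = 2 *\<^sub>R (transpose B ** P ** B)"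

text \<open>
  Division by zero yields \<open>xi1 k3 0 = 0\<close>, the continuous extension.  The value \<open>xi2 k3 0 = 0\<close>
  has no meaning and is never used: \<open>Xi2\<close> is the Filippov set-valued map of \<open>xi2\<close>, whose value
  at the discontinuity is the closed convex hull of the limits of \<open>w / (2 \<parallel>w\<parallel>)\<close>.
\<close>

definition xi1 :: "real \<Rightarrow> real^'k \<Rightarrow> real^'k"
  where "xi1 k3 w = (1 / sqrt (norm w)) *\<^sub>R w + k3 *\<^sub>R w"

definition xi2 :: "real \<Rightarrow> real^'k \<Rightarrow> real^'k"
  where "xi2 k3 w =
    (1 / (2 * norm w)) *\<^sub>R w + (3 * k3 / 2) *\<^sub>R ((1 / sqrt (norm w)) *\<^sub>R w) + k3\<^sup>2 *\<^sub>R w"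

definition Xi2 :: "real \<Rightarrow> real^'k \<Rightarrow> (real^'k) set"
  where "Xi2 k3 w = (if w = 0 then cball 0 (1 / 2) else {xi2 k3 w})"

definition gain1 :: "real \<Rightarrow> real \<Rightarrow> real \<Rightarrow> real \<Rightarrow> real \<Rightarrow> real"
  where "gain1 \<delta>0 \<beta> \<epsilon> r1 r2 =
    \<delta>0 + (1 / \<beta>) * ((1 / (4 * \<epsilon>)) * (4 * \<epsilon> * r1 + r2)\<^sup>2 + 2 * \<epsilon> * r2 + \<epsilon>
      + (2 * \<epsilon> + r1) * (\<beta> + 4 * \<epsilon>\<^sup>2))"

definition gain2 :: "real \<Rightarrow> real \<Rightarrow> real \<Rightarrow> real"
  where "gain2 \<beta> \<epsilon> g1 = \<beta> + 4 * \<epsilon>\<^sup>2 + 2 * \<epsilon> * g1"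

definition P_st :: "real \<Rightarrow> real \<Rightarrow> real^('k::finite + 'k)^('k + 'k)"
  where "P_st \<beta> \<epsilon> = (\<chi> i j. case (i, j) of
      (Inl a, Inl b) \<Rightarrow> (if a = b then \<beta> + 4 * \<epsilon>\<^sup>2 else 0)
    | (Inl a, Inr b) \<Rightarrow> (if a = b then - 2 * \<epsilon> else 0)
    | (Inr a, Inl b) \<Rightarrow> (if a = b then - 2 * \<epsilon> else 0)
    | (Inr a, Inr b) \<Rightarrow> (if a = b then 1 else 0))"

definition gamma_st :: "real \<Rightarrow> real^'k \<Rightarrow> real^'k \<Rightarrow> real^('k::finite + 'k)"
  where "gamma_st k3 w z = (\<chi> i. case i of Inl a \<Rightarrow> xi1 k3 w $ a | Inr a \<Rightarrow> z $ a)"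

definition V_st :: "real \<Rightarrow> real \<Rightarrow> real \<Rightarrow> real^'k \<Rightarrow> real^'k \<Rightarrow> real"
  where "V_st \<beta> \<epsilon> k3 w z = gamma_st k3 w z \<bullet> (P_st \<beta> \<epsilon> *v gamma_st k3 w z)"

definition eigenvalues :: "real^'n^'n \<Rightarrow> real set"
  where "eigenvalues M = {l. \<exists>v. v \<noteq> 0 \<and> M *v v = l *\<^sub>R v}"

definition lambda_min :: "real^'n^'n \<Rightarrow> real"
  where "lambda_min M = Min (eigenvalues M)"

definition lambda_max :: "real^'n^'n \<Rightarrow> real"
  where "lambda_max M = Max (eigenvalues M)"

definition time_partial :: "(real \<Rightarrow> 'a \<Rightarrow> real^'k) \<Rightarrow> real \<Rightarrow> 'a \<Rightarrow> real^'k"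
  where "time_partial f t X = vector_derivative (\<lambda>s. f s X) (at t within {0..})"

text \<open>The matrix of partial derivatives with respect to the block \<open>X $ j\<close>.\<close>

definition block_jacobian ::
    "(real^'n^'d \<Rightarrow> real^'k) \<Rightarrow> real^'n^'d \<Rightarrow> 'd \<Rightarrow> real^'n^'k"
  where "block_jacobian f X j = matrix (\<lambda>y. frechet_derivative f (at X) (axis j y))"

text \<open>
  \<open>f\<close> is locally absolutely continuous on $[0, \infty)$ with derivative \<open>g\<close> almost everywhere,
  expressed through the Lebesgue integral.
\<close>

definition has_ac_derivative ::
    "(real \<Rightarrow> 'a::euclidean_space) \<Rightarrow> (real \<Rightarrow> 'a) \<Rightarrow> bool"
  where "has_ac_derivative f g \<longleftrightarrow>
    (\<forall>t\<ge>0. g absolutely_integrable_on {0..t} \<and> f t = f 0 + integral {0..t} g)"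

end

theory Submission
  imports Defs
begin

text \<open>
  With \<open>w = 2 B\<^sup>T P x\<close> the closed loop reads \<open>w' = - k1 \<xi>1(w) + z + d1\<close>, \<open>z' = - k2 \<xi>2(w) + d2\<close>.
  Where \<open>w \<noteq> 0\<close> the choice of the gains gives \<open>V' \<le> - \<eta>1 sqrt V - \<eta>2 V\<close> for \<open>V = V_st\<close>, so the
  settling time \<open>L = 2 / \<eta>2 ln (1 + \<eta>2 / \<eta>1 sqrt V)\<close> decreases at least at unit rate.  As \<open>\<xi>1\<close> is not
  Lipschitz at \<open>0\<close>, \<open>L\<close> need not be absolutely continuous across zeros of \<open>w\<close>.  However,
  while \<open>V > 0\<close> the zeros of \<open>w\<close> form a closed null set, because \<open>w' = z \<noteq> 0\<close> there, and on that set
  \<open>L\<close> is a Lipschitz function of \<open>z\<close>, which is absolutely continuous; hence the null set does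
  not contribute to the variation of \<open>L\<close>.

  After the reaching time \<open>w = z = 0\<close>, and \<open>x' = q + B p\<close> with \<open>q\<close> the nominal right-hand side.
  Since \<open>x\<^sup>T P B = 0\<close> on the manifold, the functional of (A1) has the same upper derivative along \<open>x\<close> as
  along the nominal solution through the same history, and Barbalat's argument yields \<open>x \<rightarrow> 0\<close>.
\<close>

section \<open>Absolutely continuous functions\<close>

text \<open>The constants come from one identity. With
  \<open>la = 1 / (2 * sqrt (norm w)) + k3\<close>, the vector \<open>xi2 k3 w\<close> is
  \<open>la\<close> times \<open>xi1 k3 w\<close>, and it is also the derivative of
  \<open>xi1\<close> applied to \<open>xi1\<close> itself. Hence every term of V' carries the factor
  \<open>la\<close>, and dividing by it leaves a quadratic form in the norms of \<open>xi1\<close>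
  and z, which k1 and k2 are built to dominate. For k > 1 the derivative of \<open>xi1\<close> is
  not a scalar: its eigenvalues are \<open>la\<close> along w and 1 / sqrt |w| + k3 across it. The
  latter is at most \<open>2 * la\<close>, which accounts for the coefficient 4\<epsilon> of \<rho>1
  in k1. Trajectories are only absolutely continuous, and (A1) bounds only an upper right
  derivative. Both obstacles are met by the same device: a continuous function that does not
  increase immediately to the right of any point is compared at the end points, with an error that
  is sent to 0 afterwards. (A1) speaks of nominal solutions, and the sliding motion is not one.
  Hence a nominal solution with a prescribed history has to be constructed.\<close>

lemma continuous_le_of_locally_le:
  fixes H :: "real \<Rightarrow> real"
  assumes "a \<le> b" and cont: "continuous_on {a..b} H"
    and step: "\<And>t. a \<le> t \<Longrightarrow> t < b \<Longrightarrow> \<exists>r>0. \<forall>s. t \<le> s \<and> s < t + r \<and> s \<le> b \<longrightarrow> H s \<le> H t"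
  shows "H b \<le> H a"
proof -
  \<comment> \<open>Real induction: \<open>A\<close> is closed and contains \<open>a\<close>, so it
    contains its supremum, and \<open>step\<close> would carry it past that supremum if it were
    below \<open>b\<close>.\<close>
  define A where "A = {s \<in> {a..b}. H s \<le> H a}"
  have "closed A"
    unfolding A_def using cont by (intro continuous_on_closed_Collect_le) auto
  moreover have "A \<subseteq> {a..b}" "a \<in> A" using \<open>a \<le> b\<close> by (auto simp: A_def)
  moreover have bdd: "bdd_above A" using \<open>A \<subseteq> {a..b}\<close> by (meson bdd_above_Icc bdd_above_mono)
  ultimately have c: "Sup A \<in> A" by (intro closed_contains_Sup) auto
  have "Sup A = b"
  proof (rule ccontr)
    assume "Sup A \<noteq> b"
    with c have "a \<le> Sup A" "Sup A < b" by (auto simp: A_def)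
    from step[OF this] obtain r where r: "r > 0"
      "\<And>s. Sup A \<le> s \<Longrightarrow> s < Sup A + r \<Longrightarrow> s \<le> b \<Longrightarrow> H s \<le> H (Sup A)" by auto
    define s where "s = min (Sup A + r / 2) b"
    have "s \<in> A" using r(1) r(2)[of s] c \<open>Sup A < b\<close> by (auto simp: s_def A_def min_def)
    then have "s \<le> Sup A" using bdd by (rule cSup_upper)
    then show False using r(1) \<open>Sup A < b\<close> by (auto simp: s_def min_def split: if_splits)
  qed
  with c show ?thesis by (simp add: A_def)
qed

text \<open>Strict differentiability of a C^1 function: subtracting the linear map
  \<open>grad x0\<close> leaves a function whose derivative is at most \<open>e\<close> near
  \<open>x0\<close>, and the mean value inequality on the convex ball makes it
  \<open>e\<close>-Lipschitz there. The point is that \<open>y\<close> and \<open>z\<close> vary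
  independently, so one radius serves all increments of a curve close to \<open>x0\<close>.\<close>

lemma gradient_chain_estimate:
  fixes \<Phi> :: "'a::euclidean_space \<Rightarrow> real"
  assumes "open U" "x0 \<in> U" "e > 0"
    and der: "\<And>y. y \<in> U \<Longrightarrow> (\<Phi> has_derivative (\<lambda>v. grad y \<bullet> v)) (at y)"
    and cont: "continuous_on U grad"
  obtains r where "r > 0" "ball x0 r \<subseteq> U"
    "\<And>y. y \<in> ball x0 r \<Longrightarrow> norm (grad y - grad x0) \<le> e"
    "\<And>y z. y \<in> ball x0 r \<Longrightarrow> z \<in> ball x0 r \<Longrightarrow>
       \<bar>\<Phi> z - \<Phi> y - grad x0 \<bullet> (z - y)\<bar> \<le> e * norm (z - y)"
proof -
  from cont \<open>open U\<close> \<open>x0 \<in> U\<close> have "isCont grad x0" by (simp add: continuous_on_eq_continuous_at)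
  then obtain r1 where r1: "r1 > 0" "\<And>y. dist y x0 < r1 \<Longrightarrow> dist (grad y) (grad x0) < e"
    using \<open>e > 0\<close> unfolding continuous_at_eps_delta by blast
  obtain r2 where r2: "r2 > 0" "ball x0 r2 \<subseteq> U" using assms(1,2) openE by blast
  define r where "r = min r1 r2"
  have near: "norm (grad y - grad x0) \<le> e" if "y \<in> ball x0 r" for y
    using r1(2)[of y] that by (auto simp: r_def dist_norm norm_minus_commute)
  show ?thesis
  proof
    show "r > 0" using r1 r2 by (simp add: r_def)
    show sub: "ball x0 r \<subseteq> U" using r2 by (auto simp: r_def)
    show "norm (grad y - grad x0) \<le> e" if "y \<in> ball x0 r" for y using near that by simp
    show "\<bar>\<Phi> z - \<Phi> y - grad x0 \<bullet> (z - y)\<bar> \<le> e * norm (z - y)"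
      if "y \<in> ball x0 r" "z \<in> ball x0 r" for y z
    proof -
      have "norm ((\<Phi> z - grad x0 \<bullet> z) - (\<Phi> y - grad x0 \<bullet> y)) \<le> e * norm (z - y)"
      proof (rule differentiable_bound[OF convex_ball[of x0 r]])
        show "((\<lambda>y. \<Phi> y - grad x0 \<bullet> y) has_derivative (\<lambda>v. grad y \<bullet> v - grad x0 \<bullet> v))
            (at y within ball x0 r)" if "y \<in> ball x0 r" for y
          using sub that
          by (intro has_derivative_diff has_derivative_at_withinI[OF der]
              bounded_linear_imp_has_derivative[OF bounded_linear_inner_right]) auto
        show "onorm (\<lambda>v. grad y \<bullet> v - grad x0 \<bullet> v) \<le> e" if "y \<in> ball x0 r" for y
        proof (rule onorm_le)
          fix v
          have "norm (grad y \<bullet> v - grad x0 \<bullet> v) \<le> norm (grad y - grad x0) * norm v"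
            using Cauchy_Schwarz_ineq2[of "grad y - grad x0" v] by (simp add: inner_diff_left)
          also have "\<dots> \<le> e * norm v" using near[OF that] by (intro mult_right_mono) auto
          finally show "norm (grad y \<bullet> v - grad x0 \<bullet> v) \<le> e * norm v" .
        qed
      qed (use that in auto)
      then show ?thesis by (simp add: inner_diff_right algebra_simps)
    qed
  qed
qed

lemma absolutely_integrable_continuous_inner:
  fixes f g :: "real \<Rightarrow> 'a::euclidean_space"
  assumes "continuous_on {a..b} f" "g absolutely_integrable_on {a..b}"
  shows "(\<lambda>s. f s \<bullet> g s) absolutely_integrable_on {a..b}"
proof (rule absolutely_integrable_bounded_measurable_product[where h="(\<bullet>)" and f=f, OF _ _ _ _ assms(2)])
  show "bilinear ((\<bullet>) :: 'a \<Rightarrow> 'a \<Rightarrow> real)"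
    by (simp add: bilinear_def linear_iff inner_add_left inner_add_right)
  show "f \<in> borel_measurable (lebesgue_on {a..b})"
    using assms(1) by (simp add: continuous_imp_measurable_on_sets_lebesgue)
  show "bounded (f ` {a..b})"
    using assms(1) by (simp add: compact_continuous_image compact_imp_bounded)
qed auto

lemma ac_increment:
  fixes f g :: "real \<Rightarrow> 'a::euclidean_space"
  assumes "g absolutely_integrable_on {a..b}"
    and "\<And>t. a \<le> t \<Longrightarrow> t \<le> b \<Longrightarrow> f t = f a + integral {a..t} g"
    and "a \<le> s" "s \<le> t" "t \<le> b"
  shows "f t - f s = integral {s..t} g"
proof -
  have "g integrable_on {a..t}"
    using assms by (intro integrable_on_subinterval[OF set_lebesgue_integral_eq_integral(1)[OF assms(1)]]) auto
  then have "integral {a..s} g + integral {s..t} g = integral {a..t} g"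
    using assms by (intro Henstock_Kurzweil_Integration.integral_combine) auto
  with assms(2)[of t] assms(2)[of s] assms(3-) show ?thesis by (simp add: algebra_simps)
qed

lemma ac_continuous_on:
  fixes f g :: "real \<Rightarrow> 'a::euclidean_space"
  assumes "g absolutely_integrable_on {a..b}"
    and "\<And>t. a \<le> t \<Longrightarrow> t \<le> b \<Longrightarrow> f t = f a + integral {a..t} g"
  shows "continuous_on {a..b} f"
proof -
  have "continuous_on {a..b} (\<lambda>t. f a + integral {a..t} g)"
    using assms(1) set_lebesgue_integral_eq_integral(1)
    by (intro continuous_intros indefinite_integral_continuous_1) auto
  then show ?thesis by (rule continuous_on_eq) (simp add: assms(2)[symmetric])
qed

text \<open>An absolutely continuous curve has a derivative only almost everywhere, so the increment
  of \<Phi> along \<open>f\<close> is compared with the integral on short intervals to the right of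
  each \<open>t\<close>. The error is proportional to the integral of \<open>norm (g s)\<close>,
  hence additive over intervals, and real induction sums it up. The one-sided statement is enough,
  since it also applies to the negative of \<Phi>.\<close>

lemma ac_chain_rule_le:
  fixes f g :: "real \<Rightarrow> 'a::euclidean_space" and \<Phi> :: "'a \<Rightarrow> real"
  assumes "a \<le> b" and g: "g absolutely_integrable_on {a..b}"
    and f: "\<And>t. a \<le> t \<Longrightarrow> t \<le> b \<Longrightarrow> f t = f a + integral {a..t} g"
    and U: "open U" "\<And>t. a \<le> t \<Longrightarrow> t \<le> b \<Longrightarrow> f t \<in> U"
    and der: "\<And>y. y \<in> U \<Longrightarrow> (\<Phi> has_derivative (\<lambda>v. grad y \<bullet> v)) (at y)"
    and cont: "continuous_on U grad"
  shows "\<Phi> (f b) - \<Phi> (f a) \<le> integral {a..b} (\<lambda>s. grad (f s) \<bullet> g s)"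
proof -
  have contf: "continuous_on {a..b} f" using ac_continuous_on[OF g f] .
  have contgf: "continuous_on {a..b} (\<lambda>s. grad (f s))"
    by (rule continuous_on_compose2[OF cont contf]) (use U in auto)
  have int: "(\<lambda>s. grad (f s) \<bullet> g s) integrable_on {a..b}" "g integrable_on {a..b}"
    "(\<lambda>s. norm (g s)) integrable_on {a..b}"
    using absolutely_integrable_continuous_inner[OF contgf g] g
    by (auto simp: absolutely_integrable_on_def)
  define N where "N = integral {a..b} (\<lambda>s. norm (g s))"
  have main: "\<Phi> (f b) - \<Phi> (f a) \<le> integral {a..b} (\<lambda>s. grad (f s) \<bullet> g s) + 2 * e * N"
    if "e > 0" for e
  proof -
    \<comment> \<open>The penalty is doubled because two errors of size \<open>e\<close> occur:
      linearising \<Phi> at \<open>f t\<close>, and replacing \<open>grad (f t)\<close> by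
      \<open>grad (f q)\<close> under the integral.\<close>
    define H where "H t = \<Phi> (f t) - integral {a..t} (\<lambda>s. grad (f s) \<bullet> g s)
       - 2 * e * integral {a..t} (\<lambda>s. norm (g s))" for t
    have cont\<Phi>: "continuous_on U \<Phi>"
      by (rule has_derivative_continuous_on[OF has_derivative_at_withinI[OF der]])
    have "H b \<le> H a"
    proof (rule continuous_le_of_locally_le[OF \<open>a \<le> b\<close>])
      have "continuous_on {a..b} (\<lambda>t. \<Phi> (f t))"
        by (rule continuous_on_compose2[OF cont\<Phi> contf]) (use U in auto)
      then show "continuous_on {a..b} H"
        unfolding H_def
        by (intro continuous_intros indefinite_integral_continuous_1 int)
      fix t assume t: "a \<le> t" "t < b"
      obtain r where r: "r > 0" "ball (f t) r \<subseteq> U"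
        "\<And>y. y \<in> ball (f t) r \<Longrightarrow> norm (grad y - grad (f t)) \<le> e"
        "\<And>y z. y \<in> ball (f t) r \<Longrightarrow> z \<in> ball (f t) r \<Longrightarrow>
           \<bar>\<Phi> z - \<Phi> y - grad (f t) \<bullet> (z - y)\<bar> \<le> e * norm (z - y)"
        using gradient_chain_estimate[OF U(1) U(2)[of t] \<open>e > 0\<close> der cont] t by (metis less_imp_le)
      obtain d where d: "d > 0" "\<And>s. s \<in> {a..b} \<Longrightarrow> dist s t < d \<Longrightarrow> dist (f s) (f t) < r"
        using contf t r(1) unfolding continuous_on_iff by (metis atLeastAtMost_iff less_imp_le)
      show "\<exists>r>0. \<forall>s. t \<le> s \<and> s < t + r \<and> s \<le> b \<longrightarrow> H s \<le> H t"
      proof (intro exI[of _ d] conjI allI impI)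
        fix s assume s: "t \<le> s \<and> s < t + d \<and> s \<le> b"
        have near: "f q \<in> ball (f t) r" if "q \<in> {t..s}" for q
          using d(2)[of q] that s t by (auto simp: dist_commute dist_real_def)
        have ints: "(\<lambda>s. grad (f s) \<bullet> g s) integrable_on {t..s}" "g integrable_on {t..s}"
           "(\<lambda>s. norm (g s)) integrable_on {t..s}"
          using int s t by (auto intro: integrable_on_subinterval)
        have inc: "f s - f t = integral {t..s} g"
          by (rule ac_increment[OF g f]) (use s t in auto)
        have comb: "integral {a..s} k = integral {a..t} k + integral {t..s} k"
          if "k integrable_on {a..b}" for k :: "real \<Rightarrow> real"
          using Henstock_Kurzweil_Integration.integral_combine[of a t s k] s t
            integrable_on_subinterval[OF that, of a s] by auto
        have n: "norm (f s - f t) \<le> integral {t..s} (\<lambda>s. norm (g s))"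
          unfolding inc using ints by (intro integral_norm_bound_integral) auto
        have gi: "(\<lambda>q. grad (f t) \<bullet> g q) integrable_on {t..s}"
          using integrable_linear[OF ints(2) bounded_linear_inner_right] by (simp add: o_def)
        have ei: "(\<lambda>q. e * norm (g q)) integrable_on {t..s}"
          using ints(3) by (rule integrable_on_mult_right)
        have "\<Phi> (f s) - \<Phi> (f t) \<le> grad (f t) \<bullet> (f s - f t) + e * norm (f s - f t)"
          using r(4)[of "f t" "f s"] near[of s] s r(1) by auto
        also have "grad (f t) \<bullet> (f s - f t) = integral {t..s} (\<lambda>q. grad (f t) \<bullet> g q)"
          unfolding inc using ints(2)
          by (simp add: integral_linear[OF _ bounded_linear_inner_right, unfolded o_def])
        also have "\<dots> \<le> integral {t..s} (\<lambda>q. grad (f q) \<bullet> g q + e * norm (g q))"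
        proof (rule integral_le[OF gi])
          fix q assume "q \<in> {t..s}"
          then have "norm (grad (f q) - grad (f t)) \<le> e" using near r(3) by blast
          then have "norm (grad (f t) - grad (f q)) * norm (g q) \<le> e * norm (g q)"
            by (intro mult_right_mono) (auto simp: norm_minus_commute)
          moreover have "(grad (f t) - grad (f q)) \<bullet> g q \<le> norm (grad (f t) - grad (f q)) * norm (g q)"
            by (rule norm_cauchy_schwarz)
          ultimately show "grad (f t) \<bullet> g q \<le> grad (f q) \<bullet> g q + e * norm (g q)"
            by (simp add: inner_diff_left)
        qed (use ints ei in \<open>auto intro!: integrable_add\<close>)
        also have "\<dots> = integral {t..s} (\<lambda>q. grad (f q) \<bullet> g q) + e * integral {t..s} (\<lambda>q. norm (g q))"
          using ints ei by (subst Henstock_Kurzweil_Integration.integral_add) auto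
        finally have "\<Phi> (f s) - \<Phi> (f t) \<le> integral {t..s} (\<lambda>q. grad (f q) \<bullet> g q)
           + 2 * e * integral {t..s} (\<lambda>q. norm (g q))"
          using mult_left_mono[OF n less_imp_le[OF \<open>e > 0\<close>]] by linarith
        then show "H s \<le> H t"
          unfolding H_def using comb[OF int(1)] comb[OF int(3)] by (simp add: algebra_simps)
      qed (use d in auto)
    qed
    then show ?thesis by (simp add: H_def N_def)
  qed
  have "N \<ge> 0" unfolding N_def by (intro Henstock_Kurzweil_Integration.integral_nonneg int) auto
  show ?thesis
  proof (rule field_le_epsilon)
    fix e :: real assume "e > 0"
    have "2 * (e / (2 * (N + 1))) * N \<le> e" using \<open>N \<ge> 0\<close> \<open>e > 0\<close> by (auto simp: field_simps)
    with main[of "e / (2 * (N + 1))"] \<open>N \<ge> 0\<close> \<open>e > 0\<close>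
    show "\<Phi> (f b) - \<Phi> (f a) \<le> integral {a..b} (\<lambda>s. grad (f s) \<bullet> g s) + e" by auto
  qed
qed

lemma ac_chain_rule:
  fixes f g :: "real \<Rightarrow> 'a::euclidean_space" and \<Phi> :: "'a \<Rightarrow> real"
  assumes "a \<le> b" and g: "g absolutely_integrable_on {a..b}"
    and f: "\<And>t. a \<le> t \<Longrightarrow> t \<le> b \<Longrightarrow> f t = f a + integral {a..t} g"
    and U: "open U" "\<And>t. a \<le> t \<Longrightarrow> t \<le> b \<Longrightarrow> f t \<in> U"
    and der: "\<And>y. y \<in> U \<Longrightarrow> (\<Phi> has_derivative (\<lambda>v. grad y \<bullet> v)) (at y)"
    and cont: "continuous_on U grad"
  shows "(\<lambda>s. grad (f s) \<bullet> g s) absolutely_integrable_on {a..b}"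
    and "\<Phi> (f b) - \<Phi> (f a) = integral {a..b} (\<lambda>s. grad (f s) \<bullet> g s)"
proof -
  have "continuous_on {a..b} (\<lambda>s. grad (f s))"
    by (rule continuous_on_compose2[OF cont ac_continuous_on[OF g f]]) (use U in auto)
  then show "(\<lambda>s. grad (f s) \<bullet> g s) absolutely_integrable_on {a..b}"
    using g by (rule absolutely_integrable_continuous_inner)
  have "- \<Phi> (f b) - - \<Phi> (f a) \<le> integral {a..b} (\<lambda>s. - grad (f s) \<bullet> g s)"
    using has_derivative_minus[OF der] cont
    by (intro ac_chain_rule_le[where U=U, OF assms(1) g f U(1,2)] continuous_intros) auto
  then show "\<Phi> (f b) - \<Phi> (f a) = integral {a..b} (\<lambda>s. grad (f s) \<bullet> g s)"
    using ac_chain_rule_le[OF assms] by (intro antisym) auto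
qed

section \<open>Negligible sets of exceptional times\<close>

text \<open>The exceptional set is surrounded by open neighbourhoods \<open>O' n\<close> that shrink
  to it because it is closed. Inside \<open>O' n\<close> the function \<open>L t + t\<close> may
  grow, but at most like the integral of \<open>b + 1\<close>: \<open>b\<close> bounds the growth of
  \<open>L\<close> between points of \<open>E\<close>, and 1 is the rate of \<open>t\<close>.
  Outside it cannot grow. Dominated convergence sends the penalty to its integral over
  \<open>E\<close>, which is 0 as \<open>E\<close> is null.\<close>

lemma null_set_decrease:
  fixes L b :: "real \<Rightarrow> real"
  assumes "s \<le> t" and contL: "continuous_on {s..t} L" and "closed E" "negligible E"
    and b: "b absolutely_integrable_on {s..t}" "\<And>q. b q \<ge> 0"
    and inE: "\<And>u v. s \<le> u \<Longrightarrow> u \<le> v \<Longrightarrow> v \<le> t \<Longrightarrow> u \<in> E \<Longrightarrow> v \<in> E \<Longrightarrow> L v - L u \<le> integral {u..v} b"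
    and outE: "\<And>u v. s \<le> u \<Longrightarrow> u < v \<Longrightarrow> v \<le> t \<Longrightarrow> {u..v} \<inter> E = {} \<Longrightarrow> L v - L u \<le> - (v - u)"
  shows "L t - L s \<le> - (t - s)"
proof -
  define O' where "O' n = (\<Union>y\<in>E. ball y (1 / real (Suc n)))" for n
  define f where "f n q = (if q \<in> O' n then b q + 1 else 0)" for n q
  have opO: "open (O' n)" for n by (auto simp: O'_def)
  have b1: "(\<lambda>q. b q + 1) absolutely_integrable_on {s..t}"
    using b(1) by (intro set_integral_add absolutely_integrable_on_const) auto
  have fint: "f n absolutely_integrable_on {s..t}" for n
  proof -
    have "(\<lambda>q. b q + 1) absolutely_integrable_on ({s..t} \<inter> O' n)"
      by (rule set_integrable_subset[OF b1]) (use opO in auto)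
    moreover have "indicat_real ({s..t} \<inter> O' n) q *\<^sub>R (b q + 1) = indicat_real {s..t} q *\<^sub>R f n q" for q
      by (simp add: f_def indicator_def)
    ultimately show ?thesis by (simp add: set_integrable_def)
  qed
  have fint': "f n integrable_on {s..t}" for n
    using fint set_lebesgue_integral_eq_integral(1) by blast
  have f0: "f n q \<ge> 0" for n q using b(2)[of q] by (simp add: f_def)
  \<comment> \<open>Continuity of \<open>L\<close> carries the estimate to the left end point, so
    \<open>u\<close> itself may lie in \<open>E\<close>.\<close>
  have gap: "L v - L u \<le> - (v - u)" if "s \<le> u" "u < v" "v \<le> t" "{u<..v} \<inter> E = {}" for u v
  proof -
    have cl: "closure {u<..v} = {u..v}" using that by simp
    have "u \<in> closure {u<..v}" unfolding cl using that by simp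
    moreover have "continuous_on (closure {u<..v}) (\<lambda>q. L q + q)"
      unfolding cl using that by (intro continuous_intros continuous_on_subset[OF contL]) auto
    moreover have "L v + v \<le> L q + q" if "q \<in> {u<..v}" for q
    proof (cases "q = v")
      case False
      have "{q..v} \<subseteq> {u<..v}" using that by auto
      then have "{q..v} \<inter> E = {}" using \<open>{u<..v} \<inter> E = {}\<close> by blast
      with outE[of q v] that False \<open>s \<le> u\<close> \<open>v \<le> t\<close> show ?thesis by simp
    qed simp
    ultimately have "L v + v \<le> L u + u" by (meson continuous_ge_on_closure)
    then show ?thesis by simp
  qed
  have main: "L t + t \<le> L s + s + integral {s..t} (f n)" for n
  proof -
    define H where "H u = L u + u - integral {s..u} (f n)" for u
    have "H t \<le> H s"
    proof (rule continuous_le_of_locally_le[OF \<open>s \<le> t\<close>])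
      show "continuous_on {s..t} H" unfolding H_def
        by (intro continuous_intros indefinite_integral_continuous_1 fint' contL)
      fix u assume u: "s \<le> u" "u < t"
      have Hdiff: "H v - H u = L v - L u + (v - u) - integral {u..v} (f n)" if "u \<le> v" "v \<le> t" for v
      proof -
        have "integral {s..u} (f n) + integral {u..v} (f n) = integral {s..v} (f n)"
          using u that integrable_on_subinterval[OF fint', of s v]
          by (intro Henstock_Kurzweil_Integration.integral_combine) auto
        then show ?thesis by (simp add: H_def)
      qed
      have sub: "k integrable_on {p..v}" if "k absolutely_integrable_on {s..t}" "s \<le> p" "v \<le> t"
        for k :: "real \<Rightarrow> real" and p v
        using that integrable_on_subinterval set_lebesgue_integral_eq_integral(1)[OF that(1)]
        by (metis atLeastatMost_subset_iff)
      show "\<exists>r>0. \<forall>v. u \<le> v \<and> v < u + r \<and> v \<le> t \<longrightarrow> H v \<le> H u"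
      proof (cases "u \<in> E")
        case False
        with \<open>closed E\<close> obtain r where r: "r > 0" "ball u r \<subseteq> - E"
          by (metis ComplI openE open_Compl)
        have "H v \<le> H u" if "u \<le> v" "v < u + r" "v \<le> t" for v
        proof (cases "u = v")
          case False
          have "{u<..v} \<subseteq> ball u r" using that by (auto simp: dist_real_def)
          then have "L v - L u \<le> - (v - u)" using gap[of u v] r that False u by fastforce
          moreover have "integral {u..v} (f n) \<ge> 0"
            using f0 sub[OF fint] u that by (intro Henstock_Kurzweil_Integration.integral_nonneg) auto
          ultimately show ?thesis using Hdiff that by force
        qed simp
        with r(1) show ?thesis by blast
      next
        case True
        \<comment> \<open>This radius keeps \<open>{u..v}\<close> inside the neighbourhood
          \<open>O' n\<close> of \<open>u\<close>, where the full penalty \<open>b + 1\<close> is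
          available.\<close>
        define r where "r = 1 / real (Suc n)"
        have "H v \<le> H u" if v: "u \<le> v" "v < u + r" "v \<le> t" for v
        proof -
          have inO: "{u..v} \<subseteq> O' n"
            using True v by (force simp: O'_def r_def dist_real_def)
          \<comment> \<open>The last point of \<open>E\<close> splits the interval:
            \<open>inE\<close> governs the part from \<open>u\<close> to \<open>p\<close>, both in
            \<open>E\<close>, and \<open>gap\<close> the part after \<open>p\<close>, which is free
            of \<open>E\<close>.\<close>
          define p where "p = Sup (E \<inter> {u..v})"
          have "p \<in> E \<inter> {u..v}" unfolding p_def
            using True v \<open>closed E\<close> by (intro closed_contains_Sup) (auto intro!: bdd_aboveI[of _ v])
          then have p: "p \<in> E" "u \<le> p" "p \<le> v" by auto
          have "q \<le> p" if "q \<in> E \<inter> {u..v}" for q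
            unfolding p_def using that by (intro cSup_upper) (auto intro!: bdd_aboveI[of _ v])
          then have "{p<..v} \<inter> E = {}" using p by force
          then have 1: "L v - L p \<le> - (v - p)" using gap[of p v] p u v by (cases "p = v") auto
          have 2: "L p - L u \<le> integral {u..p} b" using inE[of u p] True p u v by auto
          have "integral {u..v} (f n) = integral {u..v} (\<lambda>q. b q + 1)"
            by (rule Henstock_Kurzweil_Integration.integral_cong) (use inO in \<open>auto simp: f_def\<close>)
          also have "\<dots> = integral {u..v} b + (v - u)"
            using sub[OF b(1)] u v by (subst Henstock_Kurzweil_Integration.integral_add) auto
          finally have 3: "integral {u..v} (f n) = integral {u..v} b + (v - u)" .
          have 4: "integral {u..p} b \<le> integral {u..v} b"
            using sub[OF b(1)] u v p b(2) by (intro integral_subset_le) auto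
          show "H v \<le> H u" using Hdiff[OF v(1,3)] 1 2 3 4 p by linarith
        qed
        moreover have "r > 0" by (simp add: r_def)
        ultimately show ?thesis by blast
      qed
    qed
    then show ?thesis by (simp add: H_def)
  qed
  have "(\<lambda>n. integral {s..t} (f n)) \<longlonglongrightarrow> integral {s..t} (\<lambda>q. if q \<in> E then b q + 1 else 0)"
  proof (rule dominated_convergence(2)[OF fint'])
    show "(\<lambda>q. b q + 1) integrable_on {s..t}" using b1 set_lebesgue_integral_eq_integral(1) by blast
    show "norm (f n q) \<le> b q + 1" for n q using b(2)[of q] by (simp add: f_def)
    show "(\<lambda>n. f n q) \<longlonglongrightarrow> (if q \<in> E then b q + 1 else 0)" for q
    proof (cases "q \<in> E")
      case True
      then have "q \<in> O' n" for n by (auto simp: O'_def intro!: bexI[of _ q])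
      with True show ?thesis by (simp add: f_def)
    next
      case False
      with \<open>closed E\<close> obtain r where r: "r > 0" "ball q r \<subseteq> - E"
        by (metis ComplI openE open_Compl)
      obtain N where N: "1 / real (Suc N) < r" using r(1) nat_approx_posE by blast
      have "f n q = 0" if "n \<ge> N" for n
      proof -
        have "1 / real (Suc n) \<le> 1 / real (Suc N)" using that by (simp add: field_simps)
        with N r(2) have "q \<notin> O' n" by (force simp: O'_def dist_commute)
        then show ?thesis by (simp add: f_def)
      qed
      then show ?thesis using False by (auto intro!: tendsto_eventually eventually_sequentiallyI[of N])
    qed
  qed
  moreover have "integral {s..t} (\<lambda>q. if q \<in> E then b q + 1 else 0) = 0"
    by (rule integral_unique, rule has_integral_negligible[OF \<open>negligible E\<close>]) auto
  ultimately have "(\<lambda>n. L s + s + integral {s..t} (f n)) \<longlonglongrightarrow> L s + s + 0"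
    by (intro tendsto_intros) simp
  then have "L t + t \<le> L s + s + 0"
    by (rule tendsto_lowerbound) (auto simp: main)
  then show ?thesis by simp
qed

lemma ac_Pair:
  fixes f1 g1 :: "real \<Rightarrow> 'a::euclidean_space" and f2 g2 :: "real \<Rightarrow> 'b::euclidean_space"
  assumes g: "g1 absolutely_integrable_on {a..b}" "g2 absolutely_integrable_on {a..b}"
    and f1: "\<And>t. a \<le> t \<Longrightarrow> t \<le> b \<Longrightarrow> f1 t = f1 a + integral {a..t} g1"
    and f2: "\<And>t. a \<le> t \<Longrightarrow> t \<le> b \<Longrightarrow> f2 t = f2 a + integral {a..t} g2"
  shows "(\<lambda>t. (g1 t, g2 t)) absolutely_integrable_on {a..b}"
    and "\<And>t. a \<le> t \<Longrightarrow> t \<le> b \<Longrightarrow> (f1 t, f2 t) = (f1 a, f2 a) + integral {a..t} (\<lambda>t. (g1 t, g2 t))"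
proof -
  have L1: "bounded_linear (\<lambda>x::'a. (x, 0::'b))" and L2: "bounded_linear (\<lambda>x::'b. (0::'a, x))"
    by (auto intro!: bounded_linear_Pair bounded_linear_ident bounded_linear_zero)
  have "(\<lambda>t. (g1 t, 0::'b) + (0::'a, g2 t)) absolutely_integrable_on {a..b}"
    using absolutely_integrable_linear[OF g(1) L1] absolutely_integrable_linear[OF g(2) L2]
    by (intro set_integral_add(1)) (auto simp: o_def)
  then show "(\<lambda>t. (g1 t, g2 t)) absolutely_integrable_on {a..b}" by simp
  fix t assume t: "a \<le> t" "t \<le> b"
  have i: "g1 integrable_on {a..t}" "g2 integrable_on {a..t}"
    using t g integrable_on_subinterval set_lebesgue_integral_eq_integral(1)
    by (metis atLeastatMost_subset_iff order_refl)+
  have "((\<lambda>t. (g1 t, 0::'b) + (0::'a, g2 t)) has_integral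
      (integral {a..t} g1, 0) + (0, integral {a..t} g2)) {a..t}"
    using has_integral_linear[OF integrable_integral[OF i(1)] L1]
      has_integral_linear[OF integrable_integral[OF i(2)] L2]
    by (intro has_integral_add) (auto simp: o_def)
  then have "integral {a..t} (\<lambda>t. (g1 t, g2 t)) = (integral {a..t} g1, integral {a..t} g2)"
    by (simp add: integral_unique)
  then show "(f1 t, f2 t) = (f1 a, f2 a) + integral {a..t} (\<lambda>t. (g1 t, g2 t))"
    using f1[OF t] f2[OF t] by simp
qed

lemma negligible_integral_zero:
  fixes h :: "real \<Rightarrow> real"
  assumes "h absolutely_integrable_on {a..b}" "\<And>t. h t \<ge> 0" "integral {a..b} h = 0"
  shows "negligible {t \<in> {a..b}. h t \<noteq> 0}"
proof -
  have "(LINT t:{a..b}|lebesgue. h t) = 0"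
    using assms set_lebesgue_integral_eq_integral(2)[OF assms(1)] by simp
  then have "AE t in lebesgue. indicator {a..b} t *\<^sub>R h t = 0"
    using assms(1,2) unfolding set_lebesgue_integral_def set_integrable_def
    by (subst integral_nonneg_eq_0_iff_AE[symmetric]) auto
  then obtain N where N: "N \<in> null_sets lebesgue"
    "{t \<in> space lebesgue. \<not> indicator {a..b} t *\<^sub>R h t = 0} \<subseteq> N"
    unfolding eventually_ae_filter by blast
  have "{t \<in> {a..b}. h t \<noteq> 0} \<subseteq> N" using N(2) by (auto simp: indicator_def)
  with N(1) show ?thesis by (meson negligible_iff_null_sets negligible_subset)
qed

text \<open>
  On a set of positive measure where \<open>w\<close> vanishes its derivative vanishes almost everywhere; the
  test functions \<open>(w \<bullet> z) / (1 + n\<^sup>2 \<parallel>w\<parallel>\<^sup>2)\<close> yield this without differentiating \<open>w\<close> pointwise.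
\<close>

lemma negligible_zero_set:
  fixes w z g1 g2 :: "real \<Rightarrow> 'a::euclidean_space"
  assumes "a \<le> b"
    and g: "g1 absolutely_integrable_on {a..b}" "g2 absolutely_integrable_on {a..b}"
    and w: "\<And>t. a \<le> t \<Longrightarrow> t \<le> b \<Longrightarrow> w t = w a + integral {a..t} g1"
    and z: "\<And>t. a \<le> t \<Longrightarrow> t \<le> b \<Longrightarrow> z t = z a + integral {a..t} g2"
    and eq: "\<And>t. a \<le> t \<Longrightarrow> t \<le> b \<Longrightarrow> w t = 0 \<Longrightarrow> g1 t = z t"
  shows "negligible {t \<in> {a..b}. w t = 0 \<and> z t \<noteq> 0}"
proof -
  \<comment> \<open>The denominator is 1 on the zeros of w and tends to infinity elsewhere. Hence
    \<Phi> n tends to 0 everywhere, while its derivative along the curve tends to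
    \<open>(norm (z t))\<^sup>2\<close> on the zeros of w, where \<open>g1 t = z t\<close>, and to 0
    off them.\<close>
  define D where "D n y = 1 + (real n)\<^sup>2 * (y \<bullet> y)" for n and y :: 'a
  define \<Phi> where "\<Phi> n y = (fst y \<bullet> snd y) / D n (fst y)" for n and y :: "'a \<times> 'a"
  define grad where "grad n y = ((1 / D n (fst y)) *\<^sub>R snd y
      - (2 * (real n)\<^sup>2 * (fst y \<bullet> snd y) / (D n (fst y))\<^sup>2) *\<^sub>R fst y, (1 / D n (fst y)) *\<^sub>R fst y)"
    for n and y :: "'a \<times> 'a"
  have D1: "D n y \<ge> 1" for n y by (simp add: D_def)
  have D0: "D n y \<noteq> 0" for n y using D1[of n y] by linarith
  have der: "(\<Phi> n has_derivative (\<lambda>v. grad n y \<bullet> v)) (at y)" for n y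
  proof -
    have "((\<lambda>y. D n (fst y)) has_derivative (\<lambda>v. 2 * (real n)\<^sup>2 * (fst y \<bullet> fst v))) (at y)"
      unfolding D_def
      by (auto intro!: derivative_eq_intros simp: inner_commute algebra_simps fun_eq_iff)
    moreover have "((\<lambda>y. fst y \<bullet> snd y) has_derivative (\<lambda>v. fst y \<bullet> snd v + fst v \<bullet> snd y)) (at y)"
      by (auto intro!: derivative_eq_intros)
    ultimately have "(\<Phi> n has_derivative (\<lambda>v. ((fst y \<bullet> snd v + fst v \<bullet> snd y) * D n (fst y)
        - (fst y \<bullet> snd y) * (2 * (real n)\<^sup>2 * (fst y \<bullet> fst v))) / (D n (fst y) * D n (fst y)))) (at y)"
      unfolding \<Phi>_def using D0 by (intro has_derivative_divide') auto
    moreover have "((fst y \<bullet> snd v + fst v \<bullet> snd y) * D n (fst y)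
        - (fst y \<bullet> snd y) * (2 * (real n)\<^sup>2 * (fst y \<bullet> fst v))) / (D n (fst y) * D n (fst y)) = grad n y \<bullet> v" for v
    proof -
      have "grad n y \<bullet> v = (snd y \<bullet> fst v) / D n (fst y)
        - 2 * (real n)\<^sup>2 * (fst y \<bullet> snd y) / (D n (fst y))\<^sup>2 * (fst y \<bullet> fst v)
        + (fst y \<bullet> snd v) / D n (fst y)"
        by (cases v) (simp add: grad_def inner_diff_left)
      also have "\<dots> = ((fst y \<bullet> snd v + snd y \<bullet> fst v) * D n (fst y)
        - (fst y \<bullet> snd y) * (2 * (real n)\<^sup>2 * (fst y \<bullet> fst v))) / (D n (fst y) * D n (fst y))"
        using D0[of n "fst y"] by (simp add: field_simps power2_eq_square)
      finally show ?thesis by (simp add: inner_commute)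
    qed
    ultimately show ?thesis by simp
  qed
  have cont: "continuous_on UNIV (grad n)" for n
    unfolding grad_def D_def using D0[unfolded D_def] by (intro continuous_intros) auto
  note pair = ac_Pair[OF g w z]
  have cw: "continuous_on {a..b} w" "continuous_on {a..b} z"
    using ac_continuous_on[OF g(1) w] ac_continuous_on[OF g(2) z] by blast+
  define h where "h n t = grad n (w t, z t) \<bullet> (g1 t, g2 t)" for n t
  have h: "h n absolutely_integrable_on {a..b}"
    "\<Phi> n (w b, z b) - \<Phi> n (w a, z a) = integral {a..b} (h n)" for n
    using ac_chain_rule[OF assms(1) pair open_UNIV UNIV_I der cont] by (auto simp: h_def[abs_def])
  have Dlim: "(\<lambda>n. c / D n y) \<longlonglongrightarrow> 0" if "y \<noteq> 0" for c :: real and y :: 'a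
  proof -
    have "filterlim (\<lambda>n. 1 + (real n)\<^sup>2 * (y \<bullet> y)) at_top sequentially"
      by (rule filterlim_tendsto_add_at_top[OF tendsto_const])
         (use that in \<open>intro filterlim_at_top_mult_tendsto_pos[where c="y \<bullet> y"] filterlim_pow_at_top filterlim_real_sequentially tendsto_const; simp\<close>)
    then show ?thesis unfolding D_def
      by (intro tendsto_divide_0[OF tendsto_const] filterlim_at_top_imp_at_infinity)
  qed
  have \<Phi>lim: "(\<lambda>n. \<Phi> n y) \<longlonglongrightarrow> 0" for y
    using Dlim[of "fst y"] by (cases "fst y = 0") (simp_all add: \<Phi>_def)
  have bound: "\<bar>h n t\<bar> \<le> (3 * norm (z t) * norm (g1 t) + norm (w t) * norm (g2 t)) / D n (w t)" for n t
  proof -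
    let ?W = "w t" and ?Z = "z t" and ?D = "D n (w t)"
    have hnt: "h n t = (?Z \<bullet> g1 t - 2 * (real n)\<^sup>2 * (?W \<bullet> ?Z) * (?W \<bullet> g1 t) / ?D + ?W \<bullet> g2 t) / ?D"
      using D0[of n ?W] by (simp add: h_def grad_def inner_simps field_simps power2_eq_square)
    have "\<bar>?Z \<bullet> g1 t\<bar> \<le> norm ?Z * norm (g1 t)" "\<bar>?W \<bullet> g2 t\<bar> \<le> norm ?W * norm (g2 t)"
      by (rule Cauchy_Schwarz_ineq2)+
    \<comment> \<open>Cauchy-Schwarz produces n^2 |w|^2, which the denominator absorbs; the
      resulting bound is free of n and serves as a dominating function.\<close>
    moreover have "\<bar>2 * (real n)\<^sup>2 * (?W \<bullet> ?Z) * (?W \<bullet> g1 t) / ?D\<bar> \<le> 2 * norm ?Z * norm (g1 t)"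
    proof -
      have "\<bar>?W \<bullet> ?Z\<bar> * \<bar>?W \<bullet> g1 t\<bar> \<le> (norm ?W * norm ?Z) * (norm ?W * norm (g1 t))"
        by (intro mult_mono Cauchy_Schwarz_ineq2) auto
      also have "\<dots> = (?W \<bullet> ?W) * (norm ?Z * norm (g1 t))"
        by (simp add: power2_norm_eq_inner[symmetric] power2_eq_square)
      finally have "(real n)\<^sup>2 * (\<bar>?W \<bullet> ?Z\<bar> * \<bar>?W \<bullet> g1 t\<bar>) \<le> (real n)\<^sup>2 * ((?W \<bullet> ?W) * (norm ?Z * norm (g1 t)))"
        by (intro mult_left_mono) auto
      also have "\<dots> \<le> ?D * (norm ?Z * norm (g1 t))"
        by (simp add: D_def mult_right_mono algebra_simps)
      finally show ?thesis using D1[of n ?W] by (simp add: abs_mult field_simps)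
    qed
    ultimately have "\<bar>?Z \<bullet> g1 t - 2 * (real n)\<^sup>2 * (?W \<bullet> ?Z) * (?W \<bullet> g1 t) / ?D + ?W \<bullet> g2 t\<bar>
        \<le> 3 * norm ?Z * norm (g1 t) + norm ?W * norm (g2 t)" by linarith
    with hnt D1[of n ?W] show ?thesis
      by (simp only: abs_divide) (intro frac_le; linarith)
  qed
  obtain C where C: "\<And>t. t \<in> {a..b} \<Longrightarrow> norm (w t) \<le> C" "\<And>t. t \<in> {a..b} \<Longrightarrow> norm (z t) \<le> C" "C \<ge> 0"
  proof -
    have "bounded (w ` {a..b})" "bounded (z ` {a..b})"
      using cw by (auto intro!: compact_imp_bounded compact_continuous_image)
    then obtain C1 C2 where "\<And>t. t \<in> {a..b} \<Longrightarrow> norm (w t) \<le> C1" "\<And>t. t \<in> {a..b} \<Longrightarrow> norm (z t) \<le> C2"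
      unfolding bounded_iff by blast
    then show ?thesis by (intro that[of "max 0 (max C1 C2)"]) (auto simp: le_max_iff_disj)
  qed
  define k where "k t = (if w t = 0 then (norm (z t))\<^sup>2 else 0)" for t
  have k0: "k t \<ge> 0" for t by (simp add: k_def)
  have dom: "(\<lambda>t. 3 * C * norm (g1 t) + C * norm (g2 t)) integrable_on {a..b}"
    using g by (intro integrable_add integrable_on_mult_right) (auto simp: absolutely_integrable_on_def)
  have dom_le: "norm (h n t) \<le> 3 * C * norm (g1 t) + C * norm (g2 t)" if "t \<in> {a..b}" for n t
  proof -
    have "norm (h n t) \<le> (3 * norm (z t) * norm (g1 t) + norm (w t) * norm (g2 t)) / D n (w t)"
      using bound by simp
    also have "\<dots> \<le> (3 * norm (z t) * norm (g1 t) + norm (w t) * norm (g2 t)) / 1"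
      using D1 by (intro divide_left_mono) (auto intro!: add_nonneg_nonneg mult_pos_pos order_less_le_trans[OF zero_less_one])
    also have "\<dots> \<le> 3 * C * norm (g1 t) + C * norm (g2 t)"
      using C that by (auto intro!: add_mono mult_right_mono)
    finally show ?thesis .
  qed
  have hk: "(\<lambda>n. h n t) \<longlonglongrightarrow> k t" if "t \<in> {a..b}" for t
  proof (cases "w t = 0")
    case True
    with eq[of t] that show ?thesis
      by (simp add: h_def grad_def k_def D_def power2_norm_eq_inner)
  next
    case False
    have "(\<lambda>n. h n t) \<longlonglongrightarrow> 0"
      by (rule Lim_null_comparison[OF _ Dlim[OF False, of "3 * norm (z t) * norm (g1 t) + norm (w t) * norm (g2 t)"]])
         (simp add: bound)
    with False show ?thesis by (simp add: k_def)
  qed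
  have hint: "h n integrable_on {a..b}" for n using h(1) set_lebesgue_integral_eq_integral(1) by blast
  \<comment> \<open>The limit of these integrals is computed twice: dominated convergence gives the
    integral of \<open>k\<close>, while the chain rule gives differences of \<Phi> n at the end
    points, which tend to 0.\<close>
  have "(\<lambda>n. integral {a..b} (h n)) \<longlonglongrightarrow> integral {a..b} k"
    by (rule dominated_convergence(2)[OF hint dom dom_le hk])
  moreover have "(\<lambda>n. integral {a..b} (h n)) \<longlonglongrightarrow> 0 - 0"
    unfolding h(2)[symmetric] by (intro tendsto_diff \<Phi>lim)
  ultimately have "integral {a..b} k = 0" using LIMSEQ_unique by fastforce
  moreover have "k absolutely_integrable_on {a..b}"
    by (rule nonnegative_absolutely_integrable_1[OF dominated_convergence(1)[OF hint dom dom_le hk]])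
       (simp_all add: k_def)
  ultimately have "negligible {t \<in> {a..b}. k t \<noteq> 0}"
    by (intro negligible_integral_zero k0)
  then show ?thesis by (rule negligible_subset) (auto simp: k_def)
qed

section \<open>The quadratic form of the super-twisting algorithm\<close>

text \<open>\<open>P_st\<close> is a 2 x 2 matrix with each entry multiplied by the identity.
  Writing its form with two vectors of an arbitrary inner product space confines the index type
  \<open>'k + 'k\<close> to the evaluation of \<open>V_st\<close> and of the eigenvalues.\<close>

definition st_quad :: "real \<Rightarrow> real \<Rightarrow> 'a::real_inner \<Rightarrow> 'a \<Rightarrow> real"
  where "st_quad \<beta> \<epsilon> p q = (\<beta> + 4 * \<epsilon>\<^sup>2) * (p \<bullet> p) - 4 * \<epsilon> * (p \<bullet> q) + q \<bullet> q"

lemma sum_Plus_UNIV: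
  fixes f :: "'a::finite + 'b::finite \<Rightarrow> 'c::comm_monoid_add"
  shows "sum f UNIV = (\<Sum>a\<in>UNIV. f (Inl a)) + (\<Sum>b\<in>UNIV. f (Inr b))"
  by (simp add: UNIV_Plus_UNIV[symmetric] sum.Plus o_def del: UNIV_Plus_UNIV)

lemma P_st_mult_Inl:
  "(P_st \<beta> \<epsilon> *v g) $ Inl a = (\<beta> + 4 * \<epsilon>\<^sup>2) * g $ Inl a - 2 * \<epsilon> * g $ Inr a"
  by (simp add: matrix_vector_mult_def sum_Plus_UNIV P_st_def if_distrib[of "\<lambda>x. x * _"] cong: if_cong)

lemma P_st_mult_Inr:
  "(P_st \<beta> \<epsilon> *v g) $ Inr a = - 2 * \<epsilon> * g $ Inl a + g $ Inr a"
  by (simp add: matrix_vector_mult_def sum_Plus_UNIV P_st_def if_distrib[of "\<lambda>x. x * _"] cong: if_cong)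

lemma V_st_eq: "V_st \<beta> \<epsilon> k3 w z = st_quad \<beta> \<epsilon> (xi1 k3 w) z"
  unfolding V_st_def st_quad_def inner_vec_def[of "gamma_st k3 w z"] sum_Plus_UNIV
  by (simp add: P_st_mult_Inl P_st_mult_Inr gamma_st_def inner_vec_def sum_distrib_left
      sum_subtractf[symmetric] sum.distrib[symmetric])
     (simp add: algebra_simps)

text \<open>The square root of the discriminant of the characteristic polynomial of the 2 x 2 matrix
  with rows (a, -2\<epsilon>) and (-2\<epsilon>, 1), where a = \<beta> + 4\<epsilon>^2.\<close>

definition st_disc :: "real \<Rightarrow> real \<Rightarrow> real"
  where "st_disc \<beta> \<epsilon> = sqrt ((\<beta> + 4 * \<epsilon>\<^sup>2 - 1)\<^sup>2 + 16 * \<epsilon>\<^sup>2)"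

text \<open>The argument \<sigma> is the sign, 1 or -1, that selects a root of the
  quadratic.\<close>

definition st_eig :: "real \<Rightarrow> real \<Rightarrow> real \<Rightarrow> real"
  where "st_eig \<beta> \<epsilon> \<sigma> = (\<beta> + 4 * \<epsilon>\<^sup>2 + 1 + \<sigma> * st_disc \<beta> \<epsilon>) / 2"

lemma st_eig_char:
  "(l - (\<beta> + 4 * \<epsilon>\<^sup>2)) * (l - 1) = 4 * \<epsilon>\<^sup>2 \<longleftrightarrow> l \<in> {st_eig \<beta> \<epsilon> (- 1), st_eig \<beta> \<epsilon> 1}"
proof -
  have "(st_disc \<beta> \<epsilon>)\<^sup>2 = (\<beta> + 4 * \<epsilon>\<^sup>2 - 1)\<^sup>2 + 16 * \<epsilon>\<^sup>2" by (simp add: st_disc_def)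
  then have "4 * ((l - (\<beta> + 4 * \<epsilon>\<^sup>2)) * (l - 1) - 4 * \<epsilon>\<^sup>2)
      = (2 * l - (\<beta> + 4 * \<epsilon>\<^sup>2 + 1))\<^sup>2 - (st_disc \<beta> \<epsilon>)\<^sup>2"
    by (simp add: power2_eq_square algebra_simps)
  moreover have "p = c \<longleftrightarrow> q = r" if "4 * (p - c) = q - r" for p c q r :: real
    using that by auto
  ultimately have "(l - (\<beta> + 4 * \<epsilon>\<^sup>2)) * (l - 1) = 4 * \<epsilon>\<^sup>2 \<longleftrightarrow>
      (2 * l - (\<beta> + 4 * \<epsilon>\<^sup>2 + 1))\<^sup>2 = (st_disc \<beta> \<epsilon>)\<^sup>2" by blast
  then show ?thesis by (auto simp: power2_eq_iff st_eig_def)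
qed

lemma eigenvalues_P_st:
  assumes "\<epsilon> > 0"
  shows "eigenvalues (P_st \<beta> \<epsilon> :: real^('k::finite + 'k)^('k + 'k)) = {st_eig \<beta> \<epsilon> (- 1), st_eig \<beta> \<epsilon> 1}"
proof -
  have "l \<in> eigenvalues (P_st \<beta> \<epsilon> :: real^('k + 'k)^('k + 'k)) \<longleftrightarrow>
      (l - (\<beta> + 4 * \<epsilon>\<^sup>2)) * (l - 1) = 4 * \<epsilon>\<^sup>2" for l
  proof
    assume "l \<in> eigenvalues (P_st \<beta> \<epsilon> :: real^('k + 'k)^('k + 'k))"
    then obtain v :: "real^('k + 'k)" where v: "v \<noteq> 0" "P_st \<beta> \<epsilon> *v v = l *\<^sub>R v"
      by (auto simp: eigenvalues_def)
    have 1: "(\<beta> + 4 * \<epsilon>\<^sup>2) * v $ Inl a - 2 * \<epsilon> * v $ Inr a = l * v $ Inl a" for a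
      using arg_cong[OF v(2), of "\<lambda>x. x $ Inl a"] by (simp add: P_st_mult_Inl)
    have 2: "- 2 * \<epsilon> * v $ Inl a + v $ Inr a = l * v $ Inr a" for a
      using arg_cong[OF v(2), of "\<lambda>x. x $ Inr a"] by (simp add: P_st_mult_Inr)
    \<comment> \<open>The off-diagonal entry -2\<epsilon> is not 0, so by the second block row the
      vanishing of the lower half would force the upper half to vanish too.\<close>
    have "\<exists>a. v $ Inr a \<noteq> 0"
    proof (rule ccontr)
      assume "\<not> (\<exists>a. v $ Inr a \<noteq> 0)"
      moreover from this have "v $ Inl a = 0" for a using 2[of a] \<open>\<epsilon> > 0\<close> by simp
      ultimately have "v $ i = 0" for i by (cases i) auto
      then show False using v(1) by (simp add: vec_eq_iff)
    qed
    then obtain a where a: "v $ Inr a \<noteq> 0" by blast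
    have "((l - (\<beta> + 4 * \<epsilon>\<^sup>2)) * (l - 1) - 4 * \<epsilon>\<^sup>2) * v $ Inr a = 0"
      using 1[of a] 2[of a] by algebra
    with a show "(l - (\<beta> + 4 * \<epsilon>\<^sup>2)) * (l - 1) = 4 * \<epsilon>\<^sup>2" by simp
  next
    assume l: "(l - (\<beta> + 4 * \<epsilon>\<^sup>2)) * (l - 1) = 4 * \<epsilon>\<^sup>2"
    fix a0 :: 'k
    \<comment> \<open>The vector (1 - l, 2\<epsilon>), placed at the coordinate \<open>a0\<close>,
      solves the second row identically; the first row is then the characteristic equation.\<close>
    define v :: "real^('k + 'k)" where "v = (\<chi> i. case i of
        Inl a \<Rightarrow> if a = a0 then (1 - l) else 0 | Inr a \<Rightarrow> if a = a0 then 2 * \<epsilon> else 0)"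
    have "v $ Inr a0 \<noteq> 0" using \<open>\<epsilon> > 0\<close> by (simp add: v_def)
    then have "v \<noteq> 0" by auto
    moreover have "(P_st \<beta> \<epsilon> *v v) $ i = (l *\<^sub>R v) $ i" for i
    proof (cases i)
      case (Inl a)
      with l show ?thesis by (simp only: P_st_mult_Inl Inl) (simp add: v_def power2_eq_square algebra_simps)
    next
      case (Inr a)
      with l show ?thesis by (simp only: P_st_mult_Inr Inr) (simp add: v_def power2_eq_square algebra_simps)
    qed
    ultimately show "l \<in> eigenvalues (P_st \<beta> \<epsilon> :: real^('k + 'k)^('k + 'k))"
      unfolding eigenvalues_def by (auto simp: vec_eq_iff)
  qed
  then show ?thesis using st_eig_char by blast
qed

text \<open>The condition on \<open>A * B\<close> says that the form has determinant 0, so it is a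
  perfect square up to the factor \<open>A\<close>. This is the situation of \<open>P_st\<close>
  shifted by one of its eigenvalues.\<close>

lemma weighted_inner_nonneg:
  fixes p q :: "'a::real_inner"
  assumes "A > 0" "A * B = 4 * \<epsilon>\<^sup>2"
  shows "A * (p \<bullet> p) + 4 * \<epsilon> * (p \<bullet> q) + B * (q \<bullet> q) \<ge> 0"
proof -
  have "A * (A * (p \<bullet> p) + 4 * \<epsilon> * (p \<bullet> q) + B * (q \<bullet> q)) =
      A * A * (p \<bullet> p) + 4 * A * \<epsilon> * (p \<bullet> q) + (A * B) * (q \<bullet> q)"
    by (simp add: algebra_simps)
  also have "\<dots> = (A *\<^sub>R p + (2 * \<epsilon>) *\<^sub>R q) \<bullet> (A *\<^sub>R p + (2 * \<epsilon>) *\<^sub>R q)"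
    unfolding assms(2) by (simp add: inner_simps inner_commute power2_eq_square algebra_simps)
  finally have "A * (A * (p \<bullet> p) + 4 * \<epsilon> * (p \<bullet> q) + B * (q \<bullet> q)) \<ge> 0" by simp
  with \<open>A > 0\<close> show ?thesis by (simp add: zero_le_mult_iff)
qed

text \<open>The Rayleigh bounds need no spectral theorem: subtracting an extreme eigenvalue from the
  2 x 2 matrix gives a singular form, so completing one square decides its sign.\<close>

lemma lambda_P_st:
  fixes Pst :: "real^('k::finite + 'k)^('k + 'k)"
  assumes "\<beta> > 0" "\<epsilon> > 0" and Pst: "Pst = P_st \<beta> \<epsilon>"
  shows "lambda_min Pst > 0" "lambda_max Pst > 0"
    and "\<And>p q :: 'a::real_inner. lambda_min Pst * (p \<bullet> p + q \<bullet> q) \<le> st_quad \<beta> \<epsilon> p q"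
    and "\<And>p q :: 'a::real_inner. st_quad \<beta> \<epsilon> p q \<le> lambda_max Pst * (p \<bullet> p + q \<bullet> q)"
proof -
  let ?a = "\<beta> + 4 * \<epsilon>\<^sup>2" and ?D = "st_disc \<beta> \<epsilon>"
  have D0: "?D \<ge> 0" by (simp add: st_disc_def)
  have "lambda_min Pst = min (st_eig \<beta> \<epsilon> (- 1)) (st_eig \<beta> \<epsilon> 1)"
    "lambda_max Pst = max (st_eig \<beta> \<epsilon> (- 1)) (st_eig \<beta> \<epsilon> 1)"
    unfolding lambda_min_def lambda_max_def Pst eigenvalues_P_st[OF \<open>\<epsilon> > 0\<close>] by simp_all
  with D0 have lm: "lambda_min Pst = st_eig \<beta> \<epsilon> (- 1)" and lM: "lambda_max Pst = st_eig \<beta> \<epsilon> 1"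
    by (auto simp: st_eig_def)
  \<comment> \<open>Positivity of the smaller eigenvalue. The two squares differ by 4\<beta>,
    because the summand 4\<epsilon>^2 in the corner of \<open>P_st\<close> makes the determinant of
    the 2 x 2 matrix equal to \<beta>.\<close>
  have "?D < ?a + 1"
  proof -
    have "(?a - 1)\<^sup>2 + 16 * \<epsilon>\<^sup>2 < (?a + 1)\<^sup>2"
      using assms by (simp add: power2_eq_square algebra_simps)
    then have "?D < sqrt ((?a + 1)\<^sup>2)" unfolding st_disc_def by (rule real_sqrt_less_mono)
    then show ?thesis using assms by (simp add: add_pos_nonneg)
  qed
  then show "lambda_min Pst > 0" by (simp add: lm st_eig_def)
  show "lambda_max Pst > 0" using \<open>\<beta> > 0\<close> D0 by (simp add: lM st_eig_def add_pos_nonneg)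
  have "\<bar>?a - 1\<bar> < ?D"
  proof -
    have "sqrt ((?a - 1)\<^sup>2) < ?D" unfolding st_disc_def using assms by (intro real_sqrt_less_mono) simp
    then show ?thesis by simp
  qed
  then have less: "lambda_min Pst < ?a" "lambda_max Pst > ?a"
    by (auto simp: lm lM st_eig_def)
  \<comment> \<open>The characteristic equation at both eigenvalues, in the form that
    \<open>weighted_inner_nonneg\<close> expects. The sign of \<epsilon> is reversed in the first
    because the mixed term of \<open>st_quad\<close> is negative, and only the second shift changes
    its sign.\<close>
  have eq: "(?a - lambda_min Pst) * (1 - lambda_min Pst) = 4 * (- \<epsilon>)\<^sup>2"
    "(lambda_max Pst - ?a) * (lambda_max Pst - 1) = 4 * \<epsilon>\<^sup>2"
    using st_eig_char[of "lambda_min Pst" \<beta> \<epsilon>] st_eig_char[of "lambda_max Pst" \<beta> \<epsilon>]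
    by (simp_all add: lm lM algebra_simps)
  fix p q :: 'a
  show "lambda_min Pst * (p \<bullet> p + q \<bullet> q) \<le> st_quad \<beta> \<epsilon> p q"
    using weighted_inner_nonneg[OF _ eq(1), of p q] less by (simp add: st_quad_def algebra_simps)
  show "st_quad \<beta> \<epsilon> p q \<le> lambda_max Pst * (p \<bullet> p + q \<bullet> q)"
    using weighted_inner_nonneg[OF _ eq(2), of p q] less by (simp add: st_quad_def algebra_simps)
qed

section \<open>The derivative of \<open>xi1\<close> and the dissipation inequality\<close>

text \<open>For nonzero w this symmetric operator has the eigenvalue 1 / (2 sqrt |w|) + k3 in the
  direction of w and 1 / sqrt |w| + k3 on its orthogonal complement.\<close>

definition xi1_deriv :: "real \<Rightarrow> 'a::real_inner \<Rightarrow> 'a \<Rightarrow> 'a"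
  where "xi1_deriv k3 w v = (1 / sqrt (norm w) + k3) *\<^sub>R v
    - ((w \<bullet> v) / (2 * (norm w)\<^sup>2 * sqrt (norm w))) *\<^sub>R w"

lemma has_derivative_xi1:
  assumes "w \<noteq> 0"
  shows "(xi1 k3 has_derivative xi1_deriv k3 w) (at w)"
proof -
  have n: "norm w > 0" using assms by simp
  have eq: "xi1 k3 = (\<lambda>w. (1 / sqrt (norm w) + k3) *\<^sub>R w)"
    by (simp add: fun_eq_iff xi1_def algebra_simps)
  have "((\<lambda>w. sqrt (norm w)) has_derivative (\<lambda>v. (v \<bullet> sgn w) * (inverse (sqrt (norm w)) / 2))) (at w)"
    using has_derivative_real_sqrt[OF n has_derivative_norm[OF assms]] by (simp add: mult.commute)
  from has_derivative_divide'[OF has_derivative_const this, of 1]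
  have "((\<lambda>w. 1 / sqrt (norm w)) has_derivative
      (\<lambda>v. - ((v \<bullet> sgn w) * (inverse (sqrt (norm w)) / 2)) / norm w)) (at w)"
    using n by simp
  from has_derivative_scaleR[OF has_derivative_add[OF this has_derivative_const[of k3]] has_derivative_ident]
  have "(xi1 k3 has_derivative (\<lambda>v. (1 / sqrt (norm w) + k3) *\<^sub>R v
      + (- ((v \<bullet> sgn w) * (inverse (sqrt (norm w)) / 2)) / norm w) *\<^sub>R w)) (at w)"
    by (simp add: eq)
  moreover have "(v \<bullet> sgn w) * (inverse (sqrt (norm w)) / 2) / norm w
      = (w \<bullet> v) / (2 * (norm w)\<^sup>2 * sqrt (norm w))" for v
    using n by (simp add: sgn_div_norm field_simps power2_eq_square inner_commute)
  ultimately show ?thesis by (simp add: xi1_deriv_def[abs_def])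
qed

lemma xi1_deriv_self_adjoint: "xi1_deriv k3 w u \<bullet> v = u \<bullet> xi1_deriv k3 w v"
  by (simp add: xi1_deriv_def inner_simps inner_commute)

lemma xi1_eq: "xi1 k3 w = (1 / sqrt (norm w) + k3) *\<^sub>R w"
  by (simp add: xi1_def algebra_simps)

lemma norm_xi1_ge:
  assumes "k3 \<ge> 0" "w \<noteq> 0"
  shows "sqrt (norm w) \<le> norm (xi1 k3 w)"
proof -
  have "norm (xi1 k3 w) = norm w / sqrt (norm w) + k3 * norm w"
    using assms unfolding xi1_eq norm_scaleR by (simp add: distrib_right)
  also have "norm w / sqrt (norm w) = sqrt (norm w)" by (simp add: real_div_sqrt)
  finally show ?thesis using assms by simp
qed

text \<open>\<open>xi1 k3 w\<close> is parallel to w, hence an eigenvector of the derivative. The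
  coefficients 1/2, 3 k3 / 2 and k3^2 of \<open>xi2\<close> arise by expanding (1 / (2s) + k3) (1 /
  s + k3) with s = sqrt |w|.\<close>

lemma xi1_deriv_xi1:
  assumes "w \<noteq> 0"
  shows "xi1_deriv k3 w (xi1 k3 w) = (1 / (2 * sqrt (norm w)) + k3) *\<^sub>R xi1 k3 w"
    and "xi2 k3 w = (1 / (2 * sqrt (norm w)) + k3) *\<^sub>R xi1 k3 w"
proof -
  define s where "s = sqrt (norm w)"
  have s: "s > 0" "norm w = s * s" "w \<bullet> w = (s * s)\<^sup>2"
    using assms by (simp_all add: s_def power2_norm_eq_inner[symmetric])
  show "xi1_deriv k3 w (xi1 k3 w) = (1 / (2 * sqrt (norm w)) + k3) *\<^sub>R xi1 k3 w"
  proof -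
    have "xi1_deriv k3 w (xi1 k3 w) = ((1 / s + k3) * (1 / s + k3)
        - (1 / s + k3) * (s * s)\<^sup>2 / (2 * (s * s)\<^sup>2 * s)) *\<^sub>R w"
      using s(1) unfolding xi1_deriv_def xi1_eq s_def[symmetric] s(2)
      by (simp add: s(3) scaleR_diff_left)
    also have "\<dots> = ((1 / (2 * s) + k3) * (1 / s + k3)) *\<^sub>R w"
      using s(1) by (intro arg_cong[where f="\<lambda>c. c *\<^sub>R w"]) (simp add: field_simps power2_eq_square)
    finally show ?thesis by (simp add: xi1_eq s_def)
  qed
  show "xi2 k3 w = (1 / (2 * sqrt (norm w)) + k3) *\<^sub>R xi1 k3 w"
  proof -
    have "xi2 k3 w = (1 / (2 * (s * s)) + 3 * k3 / 2 * (1 / s) + k3\<^sup>2) *\<^sub>R w"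
      unfolding xi2_def s_def[symmetric] s(2) using s(1) by (simp add: algebra_simps)
    also have "\<dots> = ((1 / (2 * s) + k3) * (1 / s + k3)) *\<^sub>R w"
      using s(1) by (intro arg_cong[where f="\<lambda>c. c *\<^sub>R w"]) (simp add: field_simps power2_eq_square)
    finally show ?thesis by (simp add: xi1_eq s_def)
  qed
qed

text \<open>These reflect the two eigenvalues of the derivative. The larger one is estimated by
  twice the smaller so that both bounds carry the same singular factor, which can then be taken out
  of V'.\<close>

lemma xi1_deriv_bounds:
  assumes "w \<noteq> 0" "k3 \<ge> 0"
  shows "(1 / (2 * sqrt (norm w)) + k3) * (z \<bullet> z) \<le> xi1_deriv k3 w z \<bullet> z"
    and "norm (xi1_deriv k3 w z) \<le> 2 * (1 / (2 * sqrt (norm w)) + k3) * norm z"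
proof -
  define s where "s = sqrt (norm w)"
  have s: "s > 0" "norm w = s * s" "w \<bullet> w = (s * s)\<^sup>2"
    using assms by (simp_all add: s_def power2_norm_eq_inner[symmetric])
  define \<mu> where "\<mu> = 1 / s + k3"
  define c where "c = 1 / (2 * (s * s)\<^sup>2 * s)"
  have J: "xi1_deriv k3 w z = \<mu> *\<^sub>R z - (c * (w \<bullet> z)) *\<^sub>R w"
    unfolding xi1_deriv_def s_def[symmetric] s(2) using s(1) by (simp add: \<mu>_def c_def abs_of_pos)
  have c0: "c \<ge> 0" using s(1) by (simp add: c_def)
  have cw: "c * (w \<bullet> w) = 1 / (2 * s)" using s(1) by (simp add: c_def s(3))
  have wz: "(w \<bullet> z)\<^sup>2 \<le> (w \<bullet> w) * (z \<bullet> z)" by (rule Cauchy_Schwarz_ineq)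
  have "c * (w \<bullet> z)\<^sup>2 \<le> c * (w \<bullet> w) * (z \<bullet> z)"
    using mult_left_mono[OF wz c0] by (simp add: mult.assoc)
  then have "xi1_deriv k3 w z \<bullet> z \<ge> \<mu> * (z \<bullet> z) - 1 / (2 * s) * (z \<bullet> z)"
    unfolding J cw by (simp add: inner_diff_left power2_eq_square)
  moreover have "\<mu> - 1 / (2 * s) = 1 / (2 * s) + k3" using s(1) by (simp add: \<mu>_def field_simps)
  ultimately show "(1 / (2 * sqrt (norm w)) + k3) * (z \<bullet> z) \<le> xi1_deriv k3 w z \<bullet> z"
    unfolding s_def[symmetric] by (metis left_diff_distrib)
  have "(norm (xi1_deriv k3 w z))\<^sup>2 = \<mu>\<^sup>2 * (z \<bullet> z) - c * (w \<bullet> z)\<^sup>2 * (2 * \<mu> - c * (w \<bullet> w))"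
    unfolding J power2_norm_eq_inner
    by (simp add: inner_simps inner_commute power2_eq_square algebra_simps)
  also have "\<dots> \<le> \<mu>\<^sup>2 * (z \<bullet> z)"
  proof -
    have "2 * \<mu> - c * (w \<bullet> w) \<ge> 0" unfolding cw using s(1) assms by (simp add: \<mu>_def field_simps)
    then show ?thesis using c0 by simp
  qed
  also have "\<dots> = (\<mu> * norm z)\<^sup>2" by (simp add: power_mult_distrib power2_norm_eq_inner)
  finally have "norm (xi1_deriv k3 w z) \<le> \<mu> * norm z"
    by (rule power2_le_imp_le) (use s(1) assms in \<open>auto simp: \<mu>_def\<close>)
  also have "\<mu> * norm z \<le> 2 * (1 / (2 * s) + k3) * norm z"
    using assms s(1) by (intro mult_right_mono) (auto simp: \<mu>_def field_simps)
  finally show "norm (xi1_deriv k3 w z) \<le> 2 * (1 / (2 * sqrt (norm w)) + k3) * norm z"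
    unfolding s_def[symmetric] .
qed

text \<open>Here the formula for k1 is explained, with X and Z standing for the norms of
  \<open>xi1\<close> and z. The mixed terms have the coefficient 2C with C = 4\<epsilon> r1 + r2,
  and Young's inequality splits them into 2\<epsilon> Z^2, half of the available damping, and C^2 /
  (2\<epsilon>) X^2. The product 2\<beta> g1 cancels this and all other positive multiples of X^2;
  its summand \<epsilon> leaves -2\<epsilon> X^2, and \<delta>0 only adds to the decrease.\<close>

lemma gain1_inequality:
  assumes "\<delta>0 > 0" "\<beta> > 0" "\<epsilon> > 0"
    and g1: "g1 = gain1 \<delta>0 \<beta> \<epsilon> r1 r2"
  shows "(- 2 * \<beta> * g1 + 4 * \<epsilon> * (\<beta> + 4 * \<epsilon>\<^sup>2)) * X\<^sup>2 + 2 * (\<beta> + 4 * \<epsilon>\<^sup>2) * r1 * X\<^sup>2 - 4 * \<epsilon> * Z\<^sup>2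
      + 8 * \<epsilon> * r1 * X * Z + 2 * r2 * X * Z + 4 * \<epsilon> * r2 * X\<^sup>2 \<le> - 2 * \<epsilon> * (X\<^sup>2 + Z\<^sup>2)"
proof -
  define C where "C = 4 * \<epsilon> * r1 + r2"
  have "\<beta> * g1 = \<beta> * \<delta>0 + (C\<^sup>2 / (4 * \<epsilon>) + 2 * \<epsilon> * r2 + \<epsilon> + (2 * \<epsilon> + r1) * (\<beta> + 4 * \<epsilon>\<^sup>2))"
    using assms unfolding g1 gain1_def C_def by (simp add: distrib_left[of \<beta> \<delta>0])
  then have "(- 2 * (\<beta> * g1)) * X\<^sup>2 = - 2 * (\<beta> * \<delta>0 + (C\<^sup>2 / (4 * \<epsilon>) + 2 * \<epsilon> * r2 + \<epsilon> + (2 * \<epsilon> + r1) * (\<beta> + 4 * \<epsilon>\<^sup>2))) * X\<^sup>2"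
    by (simp only:)
  moreover have "2 * C * X * Z \<le> 2 * \<epsilon> * Z\<^sup>2 + C\<^sup>2 / (2 * \<epsilon>) * X\<^sup>2"
  proof -
    have "0 \<le> (2 * \<epsilon> * Z - C * X)\<^sup>2 / (2 * \<epsilon>)" using assms by simp
    also have "\<dots> = 2 * \<epsilon> * Z\<^sup>2 + C\<^sup>2 / (2 * \<epsilon>) * X\<^sup>2 - 2 * C * X * Z"
      using assms by (simp add: field_simps power2_eq_square)
    finally show ?thesis by simp
  qed
  moreover have "\<beta> * \<delta>0 * X\<^sup>2 \<ge> 0" using assms by simp
  moreover have "2 * C * X * Z = 8 * \<epsilon> * r1 * X * Z + 2 * r2 * X * Z"
    by (simp add: C_def algebra_simps)
  moreover have "C\<^sup>2 / (2 * \<epsilon>) * X\<^sup>2 = 2 * (C\<^sup>2 / (4 * \<epsilon>)) * X\<^sup>2" by simp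
  ultimately show ?thesis by (simp add: algebra_simps)
qed

lemma st_quad_dissipation:
  fixes w z d1 d2 :: "real^'k"
  assumes "w \<noteq> 0" "\<delta>0 > 0" "\<beta> > 0" "\<epsilon> > 0" "k3 > 0"
    and d1: "norm d1 \<le> r1 * norm (xi1 k3 w)" and d2: "norm d2 \<le> r2 * norm (xi2 k3 w)"
    and g1: "g1 = gain1 \<delta>0 \<beta> \<epsilon> r1 r2" and g2: "g2 = gain2 \<beta> \<epsilon> g1"
  shows "xi1_deriv k3 w ((2 * (\<beta> + 4 * \<epsilon>\<^sup>2)) *\<^sub>R xi1 k3 w - (4 * \<epsilon>) *\<^sub>R z) \<bullet> (- g1 *\<^sub>R xi1 k3 w + z + d1)
      + (2 *\<^sub>R z - (4 * \<epsilon>) *\<^sub>R xi1 k3 w) \<bullet> (- g2 *\<^sub>R xi2 k3 w + d2)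
    \<le> - 2 * \<epsilon> * (1 / (2 * sqrt (norm w)) + k3) * ((norm (xi1 k3 w))\<^sup>2 + (norm z)\<^sup>2)"
    (is "?L \<le> _")
proof -
  define \<xi> la J a where "\<xi> = xi1 k3 w" and "la = 1 / (2 * sqrt (norm w)) + k3"
    and "J = xi1_deriv k3 w" and "a = \<beta> + 4 * \<epsilon>\<^sup>2"
  define X Z where "X = norm \<xi>" and "Z = norm z"
  have l0: "la > 0" using assms by (simp add: la_def add_pos_pos)
  have xi2: "xi2 k3 w = la *\<^sub>R \<xi>" and J\<xi>: "J \<xi> = la *\<^sub>R \<xi>"
    using xi1_deriv_xi1[OF \<open>w \<noteq> 0\<close>] by (simp_all add: \<xi>_def la_def J_def)
  have Jlin: "J ((2 * a) *\<^sub>R \<xi> - (4 * \<epsilon>) *\<^sub>R z) = (2 * a) *\<^sub>R J \<xi> - (4 * \<epsilon>) *\<^sub>R J z"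
    by (simp add: J_def xi1_deriv_def inner_diff_right diff_divide_distrib algebra_simps)
  have Jz\<xi>: "J z \<bullet> \<xi> = la * (\<xi> \<bullet> z)"
    using xi1_deriv_self_adjoint[of k3 w z \<xi>] J\<xi> by (simp add: J_def inner_commute)
  \<comment> \<open>With this \<open>g2\<close> the products of \<xi> and z multiplied by
    \<open>la\<close> cancel, and the terms with \<open>g1\<close> times the square of \<xi> collect
    the factor \<open>a - 4 * \<epsilon>\<^sup>2\<close>, which is \<beta>.\<close>
  have "g2 = a + 2 * \<epsilon> * g1" by (simp add: g2 gain2_def a_def)
  then have "?L = la * (- 2 * (a - 4 * \<epsilon>\<^sup>2) * g1 + 4 * \<epsilon> * a) * (\<xi> \<bullet> \<xi>) + 2 * a * la * (\<xi> \<bullet> d1)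
      - 4 * \<epsilon> * (J z \<bullet> z) - 4 * \<epsilon> * (J z \<bullet> d1) + 2 * (z \<bullet> d2) - 4 * \<epsilon> * (\<xi> \<bullet> d2)"
    unfolding \<xi>_def[symmetric] J_def[symmetric] a_def[symmetric] xi2 Jlin J\<xi>
    by (simp add: inner_add_right inner_diff_left Jz\<xi> inner_commute[of z \<xi>] power2_eq_square algebra_simps)
  also have "\<xi> \<bullet> \<xi> = X\<^sup>2" by (simp add: X_def power2_norm_eq_inner)
  also have "a - 4 * \<epsilon>\<^sup>2 = \<beta>" by (simp add: a_def)
  finally have L: "?L = la * (- 2 * \<beta> * g1 + 4 * \<epsilon> * a) * X\<^sup>2 + 2 * a * la * (\<xi> \<bullet> d1)
      - 4 * \<epsilon> * (J z \<bullet> z) - 4 * \<epsilon> * (J z \<bullet> d1) + 2 * (z \<bullet> d2) - 4 * \<epsilon> * (\<xi> \<bullet> d2)" .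
  have d1': "norm d1 \<le> r1 * X" and d2': "norm d2 \<le> r2 * (la * X)"
    using d1 d2 l0 by (simp_all add: xi2 X_def \<xi>_def)
  have a0: "a > 0" using assms by (simp add: a_def add_pos_nonneg)
  have 1: "\<xi> \<bullet> d1 \<le> r1 * X\<^sup>2"
    using order_trans[OF norm_cauchy_schwarz[of \<xi> d1] mult_left_mono[OF d1', of "norm \<xi>"]]
    by (simp add: X_def power2_eq_square algebra_simps)
  have 2: "la * Z\<^sup>2 \<le> J z \<bullet> z"
    using xi1_deriv_bounds(1)[OF \<open>w \<noteq> 0\<close>, of k3 z] assms by (simp add: la_def J_def Z_def power2_norm_eq_inner)
  have 3: "- (J z \<bullet> d1) \<le> 2 * la * Z * (r1 * X)"
  proof -
    have "- (J z \<bullet> d1) \<le> norm (J z) * norm d1" using Cauchy_Schwarz_ineq2[of "J z" d1] by linarith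
    also have "\<dots> \<le> (2 * la * Z) * (r1 * X)"
      using xi1_deriv_bounds(2)[OF \<open>w \<noteq> 0\<close>, of k3 z] assms l0
      by (intro mult_mono d1') (auto simp: la_def J_def Z_def)
    finally show ?thesis .
  qed
  have 4: "z \<bullet> d2 \<le> Z * (r2 * (la * X))"
    using order_trans[OF norm_cauchy_schwarz[of z d2] mult_left_mono[OF d2', of "norm z"]] by (simp add: Z_def)
  have 5: "- (\<xi> \<bullet> d2) \<le> X * (r2 * (la * X))"
    using order_trans[OF Cauchy_Schwarz_ineq2[of \<xi> d2] mult_left_mono[OF d2', of "norm \<xi>"]] by (simp add: X_def)
  have c: "2 * a * la \<ge> 0" "4 * \<epsilon> \<ge> 0" using a0 l0 assms by auto
  have "?L \<le> la * (- 2 * \<beta> * g1 + 4 * \<epsilon> * a) * X\<^sup>2 + 2 * a * la * (r1 * X\<^sup>2) - 4 * \<epsilon> * (la * Z\<^sup>2)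
      + 4 * \<epsilon> * (2 * la * Z * (r1 * X)) + 2 * (Z * (r2 * (la * X))) + 4 * \<epsilon> * (X * (r2 * (la * X)))"
    unfolding L
    using mult_left_mono[OF 1 c(1)] mult_left_mono[OF 2 c(2)]
      mult_left_mono[OF 3 c(2)] 4 mult_left_mono[OF 5 c(2)] by linarith
  also have "\<dots> = la * ((- 2 * \<beta> * g1 + 4 * \<epsilon> * a) * X\<^sup>2 + 2 * a * r1 * X\<^sup>2 - 4 * \<epsilon> * Z\<^sup>2
      + 8 * \<epsilon> * r1 * X * Z + 2 * r2 * X * Z + 4 * \<epsilon> * r2 * X\<^sup>2)"
    by (simp add: algebra_simps power2_eq_square)
  also have "\<dots> \<le> la * (- 2 * \<epsilon> * (X\<^sup>2 + Z\<^sup>2))"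
    using l0 gain1_inequality[OF assms(2-4) g1, of X Z] unfolding a_def by (intro mult_left_mono) auto
  finally show ?thesis by (simp add: la_def X_def Z_def \<xi>_def algebra_simps)
qed

section \<open>Finite-time reaching\<close>

lemma has_ac_derivativeD:
  assumes "has_ac_derivative f g" "0 \<le> u"
  shows "g absolutely_integrable_on {u..v}"
    and "\<And>t. u \<le> t \<Longrightarrow> t \<le> v \<Longrightarrow> f t = f u + integral {u..t} g"
proof -
  have g: "g absolutely_integrable_on {0..t}" if "0 \<le> t" for t
    using assms(1) that by (simp add: has_ac_derivative_def)
  show "g absolutely_integrable_on {u..v}"
    using absolutely_integrable_on_subinterval[OF g[of "max 0 v"]] assms(2) by simp
  fix t assume t: "u \<le> t" "t \<le> v"
  have "f t - f u = integral {u..t} g"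
  proof (rule ac_increment[OF g[of t]])
    show "f s = f 0 + integral {0..s} g" if "0 \<le> s" for s
      using assms(1) that unfolding has_ac_derivative_def by blast
  qed (use assms t in auto)
  then show "f t = f u + integral {u..t} g" by (simp add: algebra_simps)
qed

lemma has_ac_derivative_continuous_Icc:
  assumes "has_ac_derivative f g" "0 \<le> u"
  shows "continuous_on {u..v} f"
  by (rule ac_continuous_on[OF has_ac_derivativeD[OF assms]])

lemma has_ac_derivative_continuous:
  assumes "has_ac_derivative f g"
  shows "continuous_on {0..} f"
  unfolding continuous_on_eq_continuous_within
proof
  fix t :: real assume "t \<in> {0..}"
  then have "continuous (at t within {0..t + 1}) f"
    using has_ac_derivative_continuous_Icc[OF assms order_refl, of "t + 1"]
    by (simp add: continuous_on_eq_continuous_within)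
  moreover have "at t within {0..t + 1} = at t within {0..}"
    by (rule at_within_nhd[where S="{..<t + 1}"]) auto
  ultimately show "continuous (at t within {0..}) f" by simp
qed

lemma has_ac_derivative_linear:
  fixes f :: "real \<Rightarrow> 'a::euclidean_space" and T :: "'a \<Rightarrow> 'b::euclidean_space"
  assumes "has_ac_derivative f g" "bounded_linear T"
  shows "has_ac_derivative (\<lambda>t. T (f t)) (\<lambda>t. T (g t))"
  unfolding has_ac_derivative_def
proof (intro allI impI conjI)
  fix t :: real assume t: "t \<ge> 0"
  have g: "g absolutely_integrable_on {0..t}" and f: "f t = f 0 + integral {0..t} g"
    using assms(1) t unfolding has_ac_derivative_def by blast+
  show "(\<lambda>t. T (g t)) absolutely_integrable_on {0..t}"
    using absolutely_integrable_linear[OF g assms(2)] by (simp add: o_def)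
  have "integral {0..t} (\<lambda>t. T (g t)) = T (integral {0..t} g)"
    using integral_linear[OF set_lebesgue_integral_eq_integral(1)[OF g] assms(2)] by (simp add: o_def)
  then show "T (f t) = T (f 0) + integral {0..t} (\<lambda>t. T (g t))"
    using linear_add[OF bounded_linear.linear[OF assms(2)]] f by metis
qed

lemma has_ac_derivative_add:
  fixes f1 f2 :: "real \<Rightarrow> 'a::euclidean_space"
  assumes "has_ac_derivative f1 g1" "has_ac_derivative f2 g2"
  shows "has_ac_derivative (\<lambda>t. f1 t + f2 t) (\<lambda>t. g1 t + g2 t)"
  unfolding has_ac_derivative_def
proof (intro allI impI conjI)
  fix t :: real assume t: "t \<ge> 0"
  have g: "g1 absolutely_integrable_on {0..t}" "g2 absolutely_integrable_on {0..t}"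
    and f: "f1 t = f1 0 + integral {0..t} g1" "f2 t = f2 0 + integral {0..t} g2"
    using assms t unfolding has_ac_derivative_def by blast+
  show "(\<lambda>t. g1 t + g2 t) absolutely_integrable_on {0..t}" using g by (rule set_integral_add)
  have "integral {0..t} (\<lambda>t. g1 t + g2 t) = integral {0..t} g1 + integral {0..t} g2"
    using g set_lebesgue_integral_eq_integral(1) by (intro Henstock_Kurzweil_Integration.integral_add) blast+
  then show "f1 t + f2 t = f1 0 + f2 0 + integral {0..t} (\<lambda>t. g1 t + g2 t)"
    using f by simp
qed

lemma integral_le_negligible:
  fixes f g :: "real \<Rightarrow> real"
  assumes "negligible N" "f integrable_on S" "g integrable_on S" "\<And>t. t \<in> S - N \<Longrightarrow> f t \<le> g t"
  shows "integral S f \<le> integral S g"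
proof -
  define f' where "f' t = (if t \<in> N then g t else f t)" for t
  have "integral S f = integral S f'"
    by (rule integral_spike[OF assms(1)]) (simp add: f'_def)
  also have "\<dots> \<le> integral S g"
  proof (rule integral_le)
    show "f' integrable_on S"
      by (rule integrable_spike[OF assms(2,1)]) (simp add: f'_def)
  qed (use assms in \<open>auto simp: f'_def\<close>)
  finally show ?thesis .
qed

lemma continuous_on_xi1: "continuous_on UNIV (xi1 k3)"
proof (rule continuous_at_imp_continuous_on, rule ballI)
  fix w :: "real^'k"
  show "isCont (xi1 k3) w"
  proof (cases "w = 0")
    case False
    then show ?thesis using has_derivative_continuous[OF has_derivative_xi1] by blast
  next
    case True
    have bound: "norm ((1 / sqrt (norm y)) *\<^sub>R y) \<le> sqrt (norm y)" for y :: "real^'k"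
      by (simp add: real_div_sqrt)
    have "((\<lambda>y. sqrt (norm y)) \<longlongrightarrow> 0) (at (0 :: real^'k))"
      using tendsto_real_sqrt[OF tendsto_norm_zero[OF tendsto_ident_at]] by simp
    then have "((\<lambda>y. (1 / sqrt (norm y)) *\<^sub>R y) \<longlongrightarrow> 0) (at (0 :: real^'k))"
      by (rule Lim_null_comparison[OF always_eventually[OF allI[OF bound]]])
    then have "((\<lambda>y. (1 / sqrt (norm y)) *\<^sub>R y + k3 *\<^sub>R y) \<longlongrightarrow> 0 + k3 *\<^sub>R 0) (at (0 :: real^'k))"
      by (intro tendsto_intros)
    then show ?thesis unfolding True isCont_def xi1_def[abs_def] by simp
  qed
qed

text \<open>Along \<open>V' = - \<eta>1 sqrt V - \<eta>2 V\<close>, this is the time needed to reach \<open>0\<close> from the level \<open>V\<close>.\<close>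

definition settling :: "real \<Rightarrow> real \<Rightarrow> real \<Rightarrow> real"
  where "settling \<eta>1 \<eta>2 V = 2 / \<eta>2 * ln (1 + \<eta>2 / \<eta>1 * sqrt V)"

lemma settling_zero [simp]: "settling \<eta>1 \<eta>2 0 = 0"
  by (simp add: settling_def)

lemma settling_nonneg:
  assumes "\<eta>1 > 0" "\<eta>2 > 0" "V \<ge> 0"
  shows "settling \<eta>1 \<eta>2 V \<ge> 0"
  using assms by (simp add: settling_def)

lemma settling_pos:
  assumes "\<eta>1 > 0" "\<eta>2 > 0" "V > 0"
  shows "settling \<eta>1 \<eta>2 V > 0"
  using assms unfolding settling_def by (intro mult_pos_pos divide_pos_pos ln_gt_zero) auto

text \<open>At zeros of w the function V is the square of |z|, so the square root in the settling
  time disappears and the inequality ln y \<le> y - 1 makes it Lipschitz in z. This provides the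
  bound between two zeros of w that \<open>null_set_decrease\<close> requires.\<close>

lemma settling_norm_le:
  fixes p q :: "'a::real_inner"
  assumes "\<eta>1 > 0" "\<eta>2 > 0"
  shows "settling \<eta>1 \<eta>2 (p \<bullet> p) - settling \<eta>1 \<eta>2 (q \<bullet> q) \<le> 2 / \<eta>1 * norm (p - q)"
proof -
  define c where "c = \<eta>2 / \<eta>1"
  have c: "c > 0" using assms by (simp add: c_def)
  have pos: "1 + c * norm p > 0" "1 + c * norm q \<ge> 1" "1 + c * norm q > 0"
    using c by (auto intro: add_pos_nonneg)
  have "ln (1 + c * norm p) - ln (1 + c * norm q) = ln ((1 + c * norm p) / (1 + c * norm q))"
    using pos by (intro ln_divide_pos[symmetric]) auto
  also have "\<dots> \<le> (1 + c * norm p) / (1 + c * norm q) - 1"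
    using pos by (intro ln_le_minus_one divide_pos_pos) auto
  also have "\<dots> = c * (norm p - norm q) / (1 + c * norm q)"
    using pos by (simp add: field_simps)
  also have "\<dots> \<le> c * norm (p - q) / (1 + c * norm q)"
    using pos c by (intro divide_right_mono mult_left_mono norm_triangle_ineq2) auto
  also have "\<dots> \<le> c * norm (p - q) / 1"
    using pos c by (intro divide_left_mono) auto
  finally have "2 / \<eta>2 * (ln (1 + c * norm p) - ln (1 + c * norm q)) \<le> 2 / \<eta>2 * (c * norm (p - q))"
    using assms by (intro mult_left_mono) auto
  also have "\<dots> = 2 / \<eta>1 * norm (p - q)" using assms by (simp add: c_def)
  finally show ?thesis by (simp add: settling_def c_def[symmetric] norm_eq_sqrt_inner[symmetric] right_diff_distrib)
qed

text \<open>The derivative is the reciprocal of the decay rate \<eta>1 sqrt V + \<eta>2 V, so the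
  differential inequality for V becomes decrease of the settling time at unit rate.\<close>

lemma DERIV_settling:
  assumes "\<eta>1 > 0" "\<eta>2 > 0" "V > 0"
  shows "(settling \<eta>1 \<eta>2 has_real_derivative 1 / (sqrt V * (\<eta>1 + \<eta>2 * sqrt V))) (at V)"
proof -
  have pos: "1 + \<eta>2 / \<eta>1 * sqrt V > 0" "\<eta>1 + \<eta>2 * sqrt V > 0" using assms by (auto intro!: add_pos_nonneg)
  have "(settling \<eta>1 \<eta>2 has_real_derivative
      2 / \<eta>2 * (1 / (1 + \<eta>2 / \<eta>1 * sqrt V) * (\<eta>2 / \<eta>1 * (inverse (sqrt V) / 2)))) (at V)"
    unfolding settling_def[abs_def] using assms pos
    by (auto intro!: derivative_eq_intros)
  also have "2 / \<eta>2 * (1 / (1 + \<eta>2 / \<eta>1 * sqrt V) * (\<eta>2 / \<eta>1 * (inverse (sqrt V) / 2)))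
      = 1 / ((1 + \<eta>2 / \<eta>1 * sqrt V) * \<eta>1 * sqrt V)"
  proof -
    have "2 / \<eta>2 * (1 / A * (\<eta>2 / \<eta>1 * (inverse s / 2))) = 1 / (A * \<eta>1 * s)" if "A > 0" "s > 0" for A s
      using assms that by (simp add: field_simps)
    then show ?thesis using pos(1) assms by simp
  qed
  also have "(1 + \<eta>2 / \<eta>1 * sqrt V) * \<eta>1 * sqrt V = sqrt V * (\<eta>1 + \<eta>2 * sqrt V)"
    using assms by (simp add: field_simps)
  finally show ?thesis .
qed

text \<open>The gradient of V in the pair (w, z). Self-adjointness of the derivative of
  \<open>xi1\<close> permits writing it as applied to the partial gradient in
  \<open>xi1\<close>.\<close>

definition st_grad :: "real \<Rightarrow> real \<Rightarrow> real \<Rightarrow> (real^'k) \<times> (real^'k) \<Rightarrow> (real^'k) \<times> (real^'k)"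
  where "st_grad \<beta> \<epsilon> k3 y =
    (xi1_deriv k3 (fst y) ((2 * (\<beta> + 4 * \<epsilon>\<^sup>2)) *\<^sub>R xi1 k3 (fst y) - (4 * \<epsilon>) *\<^sub>R snd y),
     2 *\<^sub>R snd y - (4 * \<epsilon>) *\<^sub>R xi1 k3 (fst y))"

lemma has_derivative_st_quad_xi1:
  assumes "fst y \<noteq> 0"
  shows "((\<lambda>y. st_quad \<beta> \<epsilon> (xi1 k3 (fst y)) (snd y)) has_derivative (\<lambda>v. st_grad \<beta> \<epsilon> k3 y \<bullet> v)) (at y)"
proof -
  let ?w = "fst y" and ?z = "snd y"
  have d: "((\<lambda>y. xi1 k3 (fst y)) has_derivative (\<lambda>v. xi1_deriv k3 ?w (fst v))) (at y)"
    using has_derivative_compose[OF has_derivative_fst[OF has_derivative_ident] has_derivative_xi1[OF assms]]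
    by simp
  have "((\<lambda>y. st_quad \<beta> \<epsilon> (xi1 k3 (fst y)) (snd y)) has_derivative
     (\<lambda>v. (\<beta> + 4 * \<epsilon>\<^sup>2) * (xi1 k3 ?w \<bullet> xi1_deriv k3 ?w (fst v) + xi1_deriv k3 ?w (fst v) \<bullet> xi1 k3 ?w)
        - 4 * \<epsilon> * (xi1 k3 ?w \<bullet> snd v + xi1_deriv k3 ?w (fst v) \<bullet> ?z) + (?z \<bullet> snd v + snd v \<bullet> ?z))) (at y)"
    unfolding st_quad_def by (intro derivative_intros d)
  moreover have "(\<beta> + 4 * \<epsilon>\<^sup>2) * (xi1 k3 ?w \<bullet> xi1_deriv k3 ?w (fst v) + xi1_deriv k3 ?w (fst v) \<bullet> xi1 k3 ?w)
        - 4 * \<epsilon> * (xi1 k3 ?w \<bullet> snd v + xi1_deriv k3 ?w (fst v) \<bullet> ?z) + (?z \<bullet> snd v + snd v \<bullet> ?z)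
      = st_grad \<beta> \<epsilon> k3 y \<bullet> v" for v
  proof -
    have "st_grad \<beta> \<epsilon> k3 y \<bullet> v = 2 * (\<beta> + 4 * \<epsilon>\<^sup>2) * (xi1 k3 ?w \<bullet> xi1_deriv k3 ?w (fst v))
        - 4 * \<epsilon> * (?z \<bullet> xi1_deriv k3 ?w (fst v)) + (2 * (?z \<bullet> snd v) - 4 * \<epsilon> * (xi1 k3 ?w \<bullet> snd v))"
      by (cases v) (simp add: st_grad_def xi1_deriv_self_adjoint inner_diff_left)
    then show ?thesis
      by (simp add: inner_commute algebra_simps)
  qed
  ultimately show ?thesis by simp
qed

lemma continuous_on_st_grad: "continuous_on {y. fst y \<noteq> 0} (st_grad \<beta> \<epsilon> k3)"
proof -
  have "continuous_on {y. fst y \<noteq> 0} (\<lambda>y :: (real^'k) \<times> (real^'k). xi1 k3 (fst y))"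
    by (rule continuous_on_compose2[OF continuous_on_xi1]) (auto intro!: continuous_intros)
  then show ?thesis
    unfolding st_grad_def xi1_deriv_def by (intro continuous_intros) auto
qed

text \<open>The weight 1 / (2 sqrt |w|) + k3 of the dissipation is split. Its singular part yields
  \<eta>1, because sqrt |w| is at most the norm of \<open>xi1\<close>, which is at most the square
  root of V / \<open>lambda_min Pst\<close>; its constant part k3 yields \<eta>2. In both,
  \<open>lambda_max Pst\<close> enters when the squared norms are bounded below by V.\<close>

lemma st_quad_decay:
  fixes w z d1 d2 :: "real^'k"
  assumes "w \<noteq> 0" and pars: "\<delta>0 > 0" "\<beta> > 0" "\<epsilon> > 0" "k3 > 0"
    and Pst: "Pst = (P_st \<beta> \<epsilon> :: real^('k + 'k)^('k + 'k))"
    and V: "V = st_quad \<beta> \<epsilon> (xi1 k3 w) z"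
    and bounds: "norm d1 \<le> r1 * norm (xi1 k3 w)" "norm d2 \<le> r2 * norm (xi2 k3 w)"
    and gains: "g1 = gain1 \<delta>0 \<beta> \<epsilon> r1 r2" "g2 = gain2 \<beta> \<epsilon> g1"
  shows "V > 0"
    and "st_grad \<beta> \<epsilon> k3 (w, z) \<bullet> (- g1 *\<^sub>R xi1 k3 w + z + d1, - g2 *\<^sub>R xi2 k3 w + d2)
      \<le> - (\<epsilon> * sqrt (lambda_min Pst) / lambda_max Pst) * sqrt V - 2 * \<epsilon> * k3 / lambda_max Pst * V"
proof -
  let ?lm = "lambda_min Pst" and ?lM = "lambda_max Pst" and ?s = "sqrt (norm w)"
  note lam = lambda_P_st[OF pars(2,3) Pst]
  define Q where "Q = (norm (xi1 k3 w))\<^sup>2 + (norm z)\<^sup>2"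
  have VQ: "?lm * Q \<le> V" "V \<le> ?lM * Q"
    using lam(3,4)[of "xi1 k3 w" z] by (auto simp: V Q_def power2_norm_eq_inner)
  have s: "?s > 0" using \<open>w \<noteq> 0\<close> by simp
  have "?s \<le> norm (xi1 k3 w)" using norm_xi1_ge \<open>w \<noteq> 0\<close> pars by (metis less_imp_le)
  then have sQ: "?s\<^sup>2 \<le> Q" using power_mono[of ?s "norm (xi1 k3 w)" 2] s by (simp add: Q_def add_increasing2)
  have Q: "Q > 0" using sQ s by (meson less_le_trans zero_less_power)
  show V0: "V > 0" using VQ(1) Q lam(1) by (meson less_le_trans mult_pos_pos)
  have "st_grad \<beta> \<epsilon> k3 (w, z) \<bullet> (- g1 *\<^sub>R xi1 k3 w + z + d1, - g2 *\<^sub>R xi2 k3 w + d2)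
      \<le> - 2 * \<epsilon> * (1 / (2 * ?s) + k3) * Q"
    using st_quad_dissipation[OF \<open>w \<noteq> 0\<close> pars bounds gains, of z] by (simp add: st_grad_def Q_def)
  also have "\<dots> = - (\<epsilon> * (Q / ?s) + 2 * \<epsilon> * k3 * Q)" using s by (simp add: field_simps)
  also have "\<dots> \<le> - (\<epsilon> * (V / ?lM / (sqrt V / sqrt ?lm)) + 2 * \<epsilon> * k3 * (V / ?lM))"
  proof -
    have 1: "V / ?lM \<le> Q" using VQ(2) lam(2) by (simp add: field_simps)
    have "?s \<le> sqrt Q" using sQ by (simp add: real_le_rsqrt)
    also have "sqrt Q \<le> sqrt (V / ?lm)" using VQ(1) lam(1) by (intro real_sqrt_le_mono) (simp add: field_simps)
    finally have "?s \<le> sqrt V / sqrt ?lm" by (simp add: real_sqrt_divide)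
    then have "V / ?lM / (sqrt V / sqrt ?lm) \<le> Q / ?s" using 1 s Q by (intro frac_le) auto
    with 1 show ?thesis using pars by (intro le_imp_neg_le add_mono mult_left_mono) auto
  qed
  also have "V / ?lM / (sqrt V / sqrt ?lm) = sqrt ?lm / ?lM * sqrt V"
    using V0 lam(1,2) by (simp add: field_simps)
  finally show "st_grad \<beta> \<epsilon> k3 (w, z) \<bullet> (- g1 *\<^sub>R xi1 k3 w + z + d1, - g2 *\<^sub>R xi2 k3 w + d2)
      \<le> - (\<epsilon> * sqrt ?lm / ?lM) * sqrt V - 2 * \<epsilon> * k3 / ?lM * V"
    by (simp add: algebra_simps)
qed

lemma super_twisting_finite_time:
  fixes w z wd zd d1 d2 :: "real \<Rightarrow> real^'k" and r1 r2 g1 g2 :: "real \<Rightarrow> real"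
  assumes pars: "\<delta>0 > 0" "\<beta> > 0" "\<epsilon> > 0" "k3 > 0"
    and w_ac: "has_ac_derivative w wd" and z_ac: "has_ac_derivative z zd"
    and wd: "\<And>t. t \<ge> 0 \<Longrightarrow> wd t = - g1 t *\<^sub>R xi1 k3 (w t) + z t + d1 t"
    and zd: "\<And>t. t \<ge> 0 \<Longrightarrow> w t \<noteq> 0 \<Longrightarrow> zd t = - g2 t *\<^sub>R xi2 k3 (w t) + d2 t"
    and d1: "\<And>t. t \<ge> 0 \<Longrightarrow> norm (d1 t) \<le> r1 t * norm (xi1 k3 (w t))"
    and d2: "AE t in lebesgue. t \<ge> 0 \<longrightarrow> w t \<noteq> 0 \<longrightarrow> norm (d2 t) \<le> r2 t * norm (xi2 k3 (w t))"
    and gains: "\<And>t. g1 t = gain1 \<delta>0 \<beta> \<epsilon> (r1 t) (r2 t)" "\<And>t. g2 t = gain2 \<beta> \<epsilon> (g1 t)"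
    and Pst: "Pst = (P_st \<beta> \<epsilon> :: real^('k + 'k)^('k + 'k))"
    and \<eta>1: "\<eta>1 = \<epsilon> * sqrt (lambda_min Pst) / lambda_max Pst"
    and \<eta>2: "\<eta>2 = 2 * \<epsilon> * k3 / lambda_max Pst"
    and t: "t \<ge> settling \<eta>1 \<eta>2 (st_quad \<beta> \<epsilon> (xi1 k3 (w 0)) (z 0))"
  shows "w t = 0 \<and> z t = 0"
proof -
  note lam = lambda_P_st[OF pars(2,3) Pst]
  have eta: "\<eta>1 > 0" "\<eta>2 > 0" using lam pars by (simp_all add: \<eta>1 \<eta>2)
  define V where "V t = st_quad \<beta> \<epsilon> (xi1 k3 (w t)) (z t)" for t
  define L where "L t = settling \<eta>1 \<eta>2 (V t)" for t
  have cw: "continuous_on {u..v} w" and cz: "continuous_on {u..v} z" if "0 \<le> u" for u v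
    using that w_ac z_ac has_ac_derivative_continuous_Icc by blast+
  have cxi: "continuous_on {u..v} (\<lambda>t. xi1 k3 (w t))" if "0 \<le> u" for u v
    by (rule continuous_on_compose2[OF continuous_on_xi1 cw[OF that]]) auto
  have cV: "continuous_on {u..v} V" if "0 \<le> u" for u v
    unfolding V_def st_quad_def by (intro continuous_intros cxi cz that)
  have V_nonneg: "V t \<ge> 0" for t
    using order_trans[OF mult_nonneg_nonneg lam(3)[of "xi1 k3 (w t)" "z t"]] lam(1) by (simp add: V_def)
  have cL: "continuous_on {u..v} L" if "0 \<le> u" for u v
  proof -
    have "1 + \<eta>2 / \<eta>1 * sqrt (V t) \<noteq> 0" for t
      using eta V_nonneg[of t] by (metis add_pos_nonneg divide_pos_pos less_imp_le less_irrefl mult_nonneg_nonneg real_sqrt_ge_zero zero_less_one)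
    then show ?thesis unfolding L_def settling_def by (intro continuous_intros cV that) auto
  qed
  have V_zero: "w t = 0 \<and> z t = 0" if "V t = 0" for t
  proof -
    have "lambda_min Pst * (xi1 k3 (w t) \<bullet> xi1 k3 (w t) + z t \<bullet> z t) \<le> 0"
      using lam(3)[of "xi1 k3 (w t)" "z t"] that by (simp add: V_def)
    then have *: "xi1 k3 (w t) \<bullet> xi1 k3 (w t) + z t \<bullet> z t \<le> 0"
      using lam(1) by (simp add: mult_le_0_iff)
    then have z: "z t = 0" and x: "xi1 k3 (w t) = 0"
      using add_nonneg_eq_0_iff[OF inner_ge_zero[of "xi1 k3 (w t)"] inner_ge_zero[of "z t"]]
        add_nonneg_nonneg[OF inner_ge_zero[of "xi1 k3 (w t)"] inner_ge_zero[of "z t"]]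
      by (simp_all del: add_nonneg_nonneg)
    have "w t = 0"
    proof (rule ccontr)
      assume "w t \<noteq> 0"
      then show False using norm_xi1_ge[of k3 "w t"] pars x by simp
    qed
    with z show ?thesis by simp
  qed
  obtain N where N_null: "N \<in> null_sets lebesgue" and N_sub: "{t \<in> space lebesgue. \<not> (t \<ge> 0 \<longrightarrow> w t \<noteq> 0 \<longrightarrow>
      norm (d2 t) \<le> r2 t * norm (xi2 k3 (w t)))} \<subseteq> N"
    using d2 unfolding eventually_ae_filter by blast
  have N: "negligible N"
    "\<And>t. t \<notin> N \<Longrightarrow> t \<ge> 0 \<Longrightarrow> w t \<noteq> 0 \<Longrightarrow> norm (d2 t) \<le> r2 t * norm (xi2 k3 (w t))"
    using N_null N_sub by (auto simp: negligible_iff_null_sets)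
  \<comment> \<open>The exceptional set consists of the zeros of w. Between two of them
    \<open>L\<close> grows at most like the integral of (2 / \<eta>1) |z'|, and on intervals free of
    them the chain rule applies, since V is smooth for nonzero w.\<close>
  have decrease: "L v - L u \<le> - (v - u)" if uv: "0 \<le> u" "u \<le> v" and pos: "\<And>t. t \<in> {u..v} \<Longrightarrow> V t > 0" for u v
  proof (rule null_set_decrease[where E="{t \<in> {u..v}. w t = 0}" and b="\<lambda>t. 2 / \<eta>1 * norm (zd t)"])
    show "closed {t \<in> {u..v}. w t = 0}"
      using cw[OF uv(1)] by (intro continuous_closed_preimage_constant) auto
    have "negligible {t \<in> {u..v}. w t = 0 \<and> z t \<noteq> 0}"
    proof (rule negligible_zero_set[OF uv(2) has_ac_derivativeD(1)[OF w_ac uv(1)]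
          has_ac_derivativeD(1)[OF z_ac uv(1)] has_ac_derivativeD(2)[OF w_ac uv(1)]
          has_ac_derivativeD(2)[OF z_ac uv(1)]])
      \<comment> \<open>At a zero of w the vector \<open>xi1\<close> vanishes, and with it
        \<open>d1\<close>, by its bound.\<close>
      show "wd t = z t" if "u \<le> t" "w t = 0" for t
        using wd[of t] d1[of t] uv that by (simp add: xi1_eq)
    qed
    then show "negligible {t \<in> {u..v}. w t = 0}"
      by (rule negligible_subset) (use pos in \<open>force simp: V_def st_quad_def xi1_eq\<close>)
    show zdi: "(\<lambda>t. 2 / \<eta>1 * norm (zd t)) absolutely_integrable_on {u..v}"
      using has_ac_derivativeD(1)[OF z_ac uv(1)] by (intro set_integrable_mult_right absolutely_integrable_norm[unfolded o_def]) auto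
    show "2 / \<eta>1 * norm (zd t) \<ge> 0" for t using eta by simp
    show "continuous_on {u..v} L" using cL uv by blast
    show "u \<le> v" by fact
  next
    fix p q assume pq: "u \<le> p" "p \<le> q" "q \<le> v" "p \<in> {t \<in> {u..v}. w t = 0}" "q \<in> {t \<in> {u..v}. w t = 0}"
    have zi: "zd integrable_on {p..q}" "(\<lambda>t. norm (zd t)) integrable_on {p..q}"
      using has_ac_derivativeD(1)[OF z_ac, of p q] uv pq by (auto simp: absolutely_integrable_on_def)
    have "L q - L p \<le> 2 / \<eta>1 * norm (z q - z p)"
      using settling_norm_le[OF eta, of "z q" "z p"] pq by (simp add: L_def V_def st_quad_def xi1_eq)
    also have "z q - z p = integral {p..q} zd"
      using has_ac_derivativeD(2)[OF z_ac, of p q q] uv pq by simp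
    also have "2 / \<eta>1 * norm (integral {p..q} zd) \<le> 2 / \<eta>1 * integral {p..q} (\<lambda>t. norm (zd t))"
      using eta by (intro mult_left_mono integral_norm_bound_integral zi) auto
    finally show "L q - L p \<le> integral {p..q} (\<lambda>t. 2 / \<eta>1 * norm (zd t))" by simp
  next
    fix p q assume pq: "u \<le> p" "p < q" "q \<le> v" "{p..q} \<inter> {t \<in> {u..v}. w t = 0} = {}"
    then have p0: "0 \<le> p" and le: "p \<le> q" using uv by auto
    have wnz: "w t \<noteq> 0" if "p \<le> t" "t \<le> q" for t using pq that by fastforce
    define \<Phi> where "\<Phi> y = settling \<eta>1 \<eta>2 (st_quad \<beta> \<epsilon> (xi1 k3 (fst y)) (snd y))" for y :: "(real^'k) \<times> (real^'k)"
    define S where "S y = sqrt (st_quad \<beta> \<epsilon> (xi1 k3 (fst y)) (snd y))" for y :: "(real^'k) \<times> (real^'k)"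
    define grad where "grad y = (1 / (S y * (\<eta>1 + \<eta>2 * S y))) *\<^sub>R st_grad \<beta> \<epsilon> k3 y" for y
    define U where "U = {y :: (real^'k) \<times> (real^'k). fst y \<noteq> 0}"
    \<comment> \<open>Positivity is a statement about (w, z) alone; it is read off from the decay
      lemma with zero disturbances.\<close>
    have Vpos: "st_quad \<beta> \<epsilon> (xi1 k3 (fst y)) (snd y) > 0" if "y \<in> U" for y
      using st_quad_decay(1)[OF _ pars Pst refl, of "fst y" 0 0 0 0 _ _ "snd y"] that by (simp add: U_def)
    have oU: "open U" unfolding U_def by (intro open_Collect_neq continuous_intros)
    have der: "(\<Phi> has_derivative (\<lambda>v. grad y \<bullet> v)) (at y)" if "y \<in> U" for y
      using has_derivative_compose[OF has_derivative_st_quad_xi1[of y \<beta> \<epsilon> k3]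
        has_field_derivative_imp_has_derivative[OF DERIV_settling[OF eta Vpos[OF that]]]] that
      by (simp add: \<Phi>_def[abs_def] grad_def U_def S_def)
    have S0: "S y * (\<eta>1 + \<eta>2 * S y) \<noteq> 0" if "y \<in> U" for y
      using Vpos[OF that] eta by (auto simp: S_def intro!: add_pos_pos less_imp_neq[symmetric])
    have "continuous_on U (\<lambda>y. xi1 k3 (fst y))"
      by (rule continuous_on_compose2[OF continuous_on_xi1]) (auto intro!: continuous_intros)
    then have "continuous_on U S"
      unfolding S_def st_quad_def by (intro continuous_intros)
    moreover have "continuous_on U (st_grad \<beta> \<epsilon> k3)"
      unfolding U_def by (rule continuous_on_st_grad)
    ultimately have contg: "continuous_on U grad"
      unfolding grad_def by (intro continuous_intros ballI S0)
    note pair = ac_Pair[OF has_ac_derivativeD(1)[OF w_ac p0] has_ac_derivativeD(1)[OF z_ac p0]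
        has_ac_derivativeD(2)[OF w_ac p0] has_ac_derivativeD(2)[OF z_ac p0], where b=q]
    have inU: "(w t, z t) \<in> U" if "p \<le> t" "t \<le> q" for t using wnz that by (simp add: U_def)
    note ch = ac_chain_rule[where f="\<lambda>t. (w t, z t)" and g="\<lambda>t. (wd t, zd t)", OF le pair oU inU der contg]
    have "L q - L p = integral {p..q} (\<lambda>t. grad (w t, z t) \<bullet> (wd t, zd t))"
      using ch(2) unfolding \<Phi>_def L_def V_def fst_conv snd_conv .
    also have "\<dots> \<le> integral {p..q} (\<lambda>t. - 1)"
    proof (rule integral_le_negligible[OF N(1)])
      show "(\<lambda>t. grad (w t, z t) \<bullet> (wd t, zd t)) integrable_on {p..q}"
        by (rule set_lebesgue_integral_eq_integral(1)[OF ch(1)])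
      fix t assume t: "t \<in> {p..q} - N"
      then have t0: "t \<ge> 0" and wt: "w t \<noteq> 0" using p0 wnz by auto
      have "st_grad \<beta> \<epsilon> k3 (w t, z t) \<bullet> (wd t, zd t) \<le> - \<eta>1 * sqrt (V t) - \<eta>2 * V t"
        using st_quad_decay(2)[OF wt pars Pst V_def d1[OF t0] N(2)[OF _ t0 wt] gains] t
        unfolding wd[OF t0] zd[OF t0 wt] \<eta>1 \<eta>2 by blast
      also have "\<dots> = - (sqrt (V t) * (\<eta>1 + \<eta>2 * sqrt (V t)))"
        using V_nonneg[of t] by (simp add: algebra_simps)
      finally have *: "st_grad \<beta> \<epsilon> k3 (w t, z t) \<bullet> (wd t, zd t) \<le> - (S (w t, z t) * (\<eta>1 + \<eta>2 * S (w t, z t)))"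
        by (simp add: S_def V_def)
      have "S (w t, z t) * (\<eta>1 + \<eta>2 * S (w t, z t)) > 0"
        using Vpos[OF inU[of t]] t eta by (auto simp: S_def intro!: mult_pos_pos add_pos_pos)
      with * show "grad (w t, z t) \<bullet> (wd t, zd t) \<le> - 1"
        by (simp add: grad_def pos_divide_le_eq)
    qed auto
    finally show "L q - L p \<le> - (q - p)" using le by simp
  qed
  \<comment> \<open>After the last zero \<open>s\<close> of V the function \<open>L\<close> does not
    increase. As \<open>decrease\<close> asks for V > 0 on a closed interval, it is applied from
    points q > s, and continuity then gives L t1 \<le> L s = 0, against the positivity of
    \<open>L\<close>.\<close>
  have stay: "V t1 = 0" if "0 \<le> t0" "t0 \<le> t1" "V t0 = 0" for t0 t1
  proof (rule ccontr)
    assume "V t1 \<noteq> 0"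
    define Z where "Z = {t \<in> {t0..t1}. V t = 0}"
    have "closed Z" unfolding Z_def using cV[OF that(1)] by (intro continuous_closed_preimage_constant) auto
    moreover have "t0 \<in> Z" using that by (simp add: Z_def)
    moreover have bdd: "bdd_above Z" by (rule bdd_aboveI[of _ t1]) (simp add: Z_def)
    ultimately have sZ: "Sup Z \<in> Z" by (intro closed_contains_Sup) auto
    define s where "s = Sup Z"
    have s: "t0 \<le> s" "s < t1" "V s = 0" using sZ \<open>V t1 \<noteq> 0\<close> by (auto simp: Z_def s_def order_le_less)
    have pos: "V t > 0" if "t \<in> {s<..t1}" for t
    proof (rule ccontr)
      assume "\<not> V t > 0"
      then have "t \<in> Z" using V_nonneg[of t] that s by (auto simp: Z_def)
      then show False using cSup_upper[OF _ bdd, of t] that by (simp add: s_def)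
    qed
    have "L t1 \<le> L q" if "q \<in> {s<..t1}" for q
      using decrease[of q t1] that pos s \<open>0 \<le> t0\<close> by auto
    moreover have "closure {s<..t1} = {s..t1}" using s by simp
    ultimately have "L t1 \<le> L s"
      using continuous_ge_on_closure[of "{s<..t1}" L s "L t1"] cL[of s t1] s \<open>0 \<le> t0\<close> by auto
    moreover have "L t1 > 0" using settling_pos[OF eta pos[of t1]] s by (simp add: L_def)
    ultimately show False using s by (simp add: L_def)
  qed
  have T0: "L 0 \<ge> 0" unfolding L_def by (rule settling_nonneg[OF eta V_nonneg])
  \<comment> \<open>If V stayed positive up to the time \<open>L 0\<close>, decrease at unit rate
    would bring \<open>L\<close> to a value at most 0 at that time.\<close>
  have "\<exists>t0\<in>{0..L 0}. V t0 = 0"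
  proof (rule ccontr)
    assume "\<not> (\<exists>t0\<in>{0..L 0}. V t0 = 0)"
    then have pos: "V t > 0" if "t \<in> {0..L 0}" for t using that V_nonneg[of t] by force
    then have "L (L 0) - L 0 \<le> - (L 0 - 0)" using T0 by (intro decrease) auto
    then show False using settling_pos[OF eta pos[of "L 0"]] T0 by (simp add: L_def)
  qed
  moreover have "t \<ge> L 0" using t by (simp add: L_def V_def)
  ultimately have "V t = 0" using stay by force
  then show ?thesis by (rule V_zero)
qed

section \<open>Nominal solutions\<close>

lemma matrix_vector_mult_norm_le:
  fixes M :: "real^'n^'m"
  shows "norm (M *v x) \<le> onorm ((*v) M) * norm x"
  by (rule onorm[OF matrix_vector_mul_bounded_linear])

lemmas continuous_on_matrix_vector_mult =
  bounded_linear.continuous_on[OF matrix_vector_mul_bounded_linear]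

lemma norm_delay_sum_le:
  fixes G :: "'d::finite \<Rightarrow> real^'n^'n"
  assumes "\<And>j. norm (y j) \<le> b"
  shows "norm (\<Sum>j\<in>UNIV. G j *v y j) \<le> (\<Sum>j\<in>UNIV. onorm ((*v) (G j))) * b"
proof -
  have "norm (\<Sum>j\<in>UNIV. G j *v y j) \<le> (\<Sum>j\<in>UNIV. onorm ((*v) (G j)) * b)"
    by (rule sum_norm_le) (meson assms matrix_vector_mult_norm_le matrix_vector_mul_bounded_linear
        mult_left_mono onorm_pos_le order_trans)
  then show ?thesis by (simp add: sum_distrib_right)
qed

text \<open>
  The unknown of the fixed point equation is the deviation from the extended initial function,
  weighted by \<open>exp (- \<lambda> t)\<close> with \<open>\<lambda>\<close> large, which makes the Picard map a contraction on the
  whole half line.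
\<close>

lemma delay_integral_equation_solution:
  fixes G :: "'d::finite \<Rightarrow> real^'n^'n" and h :: "'d \<Rightarrow> real" and e :: "real \<Rightarrow> real^'n"
  assumes h: "\<And>j. h j \<ge> 0" and conte: "continuous_on UNIV e" and e: "\<And>t. norm (e t) \<le> M"
  obtains y where "continuous_on UNIV y" "\<And>t. t \<le> 0 \<Longrightarrow> y t = e t"
    "\<And>t. t \<ge> 0 \<Longrightarrow> y t = e t + integral {0..t} (\<lambda>s. \<Sum>j\<in>UNIV. G j *v y (s - h j))"
proof -
  define C where "C = (\<Sum>j\<in>UNIV. onorm ((*v) (G j)))"
  have C0: "C \<ge> 0" unfolding C_def
    by (intro sum_nonneg onorm_pos_le matrix_vector_mul_bounded_linear)
  \<comment> \<open>This makes the contraction constant \<open>C / l\<close> less than 1/2, and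
    keeps \<open>l\<close> positive even if all coefficients vanish.\<close>
  define l where "l = 2 * C + 1"
  have l: "l > 0" using C0 by (simp add: l_def)
  define Y where "Y v t = e t + exp (l * max t 0) *\<^sub>R v t" for v :: "real \<Rightarrow> real^'n" and t
  define q where "q v s = (\<Sum>j\<in>UNIV. G j *v Y v (s - h j))" for v s
  \<comment> \<open>The truncation \<open>max t 0\<close> makes the operator act on functions of the
    whole line. It returns 0 for t \<le> 0, so a fixed point reproduces \<open>e\<close>
    there.\<close>
  define \<Psi> where "\<Psi> v t = exp (- l * max t 0) *\<^sub>R integral {0..max t 0} (q v)" for v t
  have contY: "continuous_on UNIV (Y v)" if "continuous_on UNIV v" for v
    unfolding Y_def by (intro continuous_intros conte that)
  have contq: "continuous_on UNIV (q v)" if "continuous_on UNIV v" for v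
    unfolding q_def
    by (intro continuous_intros continuous_on_matrix_vector_mult
        continuous_on_compose2[OF contY[OF that]]) auto
  have qint: "q v integrable_on {0..t}" if "continuous_on UNIV v" for v t
    using contq[OF that] by (intro integrable_continuous_interval continuous_on_subset[OF contq[OF that]]) auto
  have expint: "integral {0..t} (\<lambda>s. exp (l * s)) = (exp (l * t) - 1) / l"
    "(\<lambda>s. exp (l * s)) integrable_on {0..t}" if "t \<ge> 0" for t
  proof -
    have "((\<lambda>s. exp (l * s)) has_integral (exp (l * t) / l - exp (l * 0) / l)) {0..t}"
      using l by (intro fundamental_theorem_of_calculus that)
        (auto intro!: derivative_eq_intros simp flip: has_real_derivative_iff_has_vector_derivative)
    then show "integral {0..t} (\<lambda>s. exp (l * s)) = (exp (l * t) - 1) / l"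
      "(\<lambda>s. exp (l * s)) integrable_on {0..t}"
      by (auto simp: integral_unique diff_divide_distrib)
  qed
  \<comment> \<open>Integrating exp (l s) gains the factor 1 / l. The same estimate shows that the
    operator maps into bounded functions and that it contracts.\<close>
  have bound: "norm (exp (- l * max t 0) *\<^sub>R integral {0..max t 0} k) \<le> C / l * b"
    if k: "k integrable_on {0..max t 0}" and b: "\<And>s. s \<ge> 0 \<Longrightarrow> norm (k s) \<le> C * (exp (l * s) * b)" "b \<ge> 0"
    for k :: "real \<Rightarrow> real^'n" and t b
  proof -
    let ?t = "max t 0"
    have "norm (integral {0..?t} k) \<le> integral {0..?t} (\<lambda>s. C * b * exp (l * s))"
      using b(1) k expint(2)[of ?t] by (intro integral_norm_bound_integral integrable_on_mult_right) (auto simp: mult_ac)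
    also have "\<dots> = C * b * ((exp (l * ?t) - 1) / l)" using expint(1)[of ?t] by simp
    also have "\<dots> \<le> C * b * (exp (l * ?t) / l)"
      using C0 b(2) l by (intro mult_left_mono divide_right_mono) auto
    finally have "exp (- l * ?t) * norm (integral {0..?t} k) \<le> exp (- l * ?t) * (C * b * (exp (l * ?t) / l))"
      by (intro mult_left_mono) auto
    also have "\<dots> = C / l * b * (exp (- l * ?t) * exp (l * ?t))" by (simp add: field_simps)
    also have "exp (- l * ?t) * exp (l * ?t) = 1" by (simp flip: exp_add)
    finally show ?thesis by simp
  qed
  have cont\<Psi>: "continuous_on UNIV (\<Psi> v)" if "continuous_on UNIV v" for v
  proof -
    have "isCont (\<Psi> v) t" for t
    proof -
      have "continuous_on {0..\<bar>t\<bar> + 1} (\<lambda>s. integral {0..s} (q v))"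
        by (intro indefinite_integral_continuous_1 qint that)
      then have "continuous_on {t - 1<..<\<bar>t\<bar> + 1} (\<lambda>s. integral {0..max s 0} (q v))"
        by (rule continuous_on_compose2) (auto intro!: continuous_intros)
      then have "continuous_on {t - 1<..<\<bar>t\<bar> + 1} (\<Psi> v)"
        unfolding \<Psi>_def by (intro continuous_intros)
      then show ?thesis by (auto simp: continuous_on_eq_continuous_at)
    qed
    then show ?thesis by (simp add: continuous_at_imp_continuous_on)
  qed
  have \<Psi>_bcontfun: "\<Psi> (apply_bcontfun v) \<in> bcontfun" for v
  proof (rule bcontfun_normI)
    show "continuous_on UNIV (\<Psi> (apply_bcontfun v))" by (rule cont\<Psi>) simp
    fix t
    show "norm (\<Psi> (apply_bcontfun v) t) \<le> C / l * (M + norm v)"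
      unfolding \<Psi>_def
    proof (rule bound[OF qint])
      have M: "M \<ge> 0" using e[of 0] norm_ge_zero order_trans by blast
      show "0 \<le> M + norm v" using M by simp
      show "norm (q (apply_bcontfun v) s) \<le> C * (exp (l * s) * (M + norm v))" if "s \<ge> 0" for s
        unfolding q_def C_def
      proof (rule norm_delay_sum_le)
        fix j
        have "norm (Y (apply_bcontfun v) (s - h j)) \<le> M + exp (l * max (s - h j) 0) * norm v"
          unfolding Y_def using e norm_bounded[of v]
          by (intro norm_triangle_le add_mono) (auto intro!: mult_left_mono)
        also have "exp (l * max (s - h j) 0) \<le> exp (l * s)" using l h[of j] that by simp
        also have "M \<le> exp (l * s) * M" using M l that by (simp add: mult_le_cancel_right1)
        finally show "norm (Y (apply_bcontfun v) (s - h j)) \<le> exp (l * s) * (M + norm v)"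
          by (simp add: distrib_left mult_right_mono)
      qed
    qed simp
  qed
  define T where "T v = Bcontfun (\<Psi> (apply_bcontfun v))" for v
  have T: "apply_bcontfun (T v) = \<Psi> (apply_bcontfun v)" for v
    unfolding T_def using \<Psi>_bcontfun by (rule Bcontfun_inverse)
  have "\<exists>!v. T v = v"
  proof (rule banach_fix_type)
    show "0 \<le> C / l" "C / l < 1" using C0 l by (auto simp: l_def)
    show "\<forall>v u. dist (T v) (T u) \<le> C / l * dist v u"
    proof (intro allI dist_bound)
      fix v u t
      have "\<Psi> (apply_bcontfun v) t - \<Psi> (apply_bcontfun u) t =
          exp (- l * max t 0) *\<^sub>R integral {0..max t 0} (\<lambda>s. q (apply_bcontfun v) s - q (apply_bcontfun u) s)"
        unfolding \<Psi>_def using qint[of "apply_bcontfun v"] qint[of "apply_bcontfun u"]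
        by (simp add: Henstock_Kurzweil_Integration.integral_diff scaleR_diff_right)
      also have "norm \<dots> \<le> C / l * dist v u"
      proof (rule bound)
        show "(\<lambda>s. q (apply_bcontfun v) s - q (apply_bcontfun u) s) integrable_on {0..max t 0}"
          by (intro integrable_diff qint) auto
        show "norm (q (apply_bcontfun v) s - q (apply_bcontfun u) s) \<le> C * (exp (l * s) * dist v u)"
          if "s \<ge> 0" for s
        proof -
          have "q (apply_bcontfun v) s - q (apply_bcontfun u) s =
             (\<Sum>j\<in>UNIV. G j *v (Y (apply_bcontfun v) (s - h j) - Y (apply_bcontfun u) (s - h j)))"
            by (simp add: q_def sum_subtractf matrix_vector_mult_diff_distrib)
          also have "norm \<dots> \<le> C * (exp (l * s) * dist v u)"
            unfolding C_def
          proof (rule norm_delay_sum_le)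
            fix j
            have "norm (Y (apply_bcontfun v) (s - h j) - Y (apply_bcontfun u) (s - h j))
               = exp (l * max (s - h j) 0) * dist (v (s - h j)) (u (s - h j))"
              by (simp add: Y_def dist_norm flip: scaleR_diff_right)
            also have "\<dots> \<le> exp (l * s) * dist v u"
              using l h[of j] that by (intro mult_mono dist_bounded) auto
            finally show "norm (Y (apply_bcontfun v) (s - h j) - Y (apply_bcontfun u) (s - h j))
               \<le> exp (l * s) * dist v u" .
          qed
          finally show ?thesis .
        qed
      qed simp
      finally show "dist (apply_bcontfun (T v) t) (apply_bcontfun (T u) t) \<le> C / l * dist v u"
        by (simp add: T dist_norm)
    qed
  qed
  then obtain v where v: "T v = v" by blast
  then have fix': "v t = \<Psi> v t" for t using T[of v] by simp
  have yt: "Y v t = e t + integral {0..max t 0} (q v)" for t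
  proof -
    have "exp (l * max t 0) *\<^sub>R v t = (exp (l * max t 0) * exp (- l * max t 0)) *\<^sub>R integral {0..max t 0} (q v)"
      by (subst fix') (simp add: \<Psi>_def)
    also have "exp (l * max t 0) * exp (- l * max t 0) = 1" by (simp flip: exp_add)
    finally show ?thesis by (simp add: Y_def)
  qed
  show thesis
  proof
    show "continuous_on UNIV (Y v)" by (rule contY) simp
    show "Y v t = e t" if "t \<le> 0" for t using yt[of t] that by (simp add: max_def)
    show "Y v t = e t + integral {0..t} (\<lambda>s. \<Sum>j\<in>UNIV. G j *v Y v (s - h j))" if "t \<ge> 0" for t
      using yt[of t] that by (simp add: max_def q_def[abs_def])
  qed
qed

lemma delays_range:
  fixes h :: "'d::{finite,linorder} \<Rightarrow> real"
  assumes "h (Min UNIV) = 0" "strict_mono h"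
  shows "0 \<le> h j" "h j \<le> max_delay h" "j \<noteq> Min UNIV \<Longrightarrow> 0 < h j"
proof -
  have m: "Min UNIV \<le> j" "j \<le> Max UNIV" by simp_all
  show "0 \<le> h j" "h j \<le> max_delay h"
    using monoD[OF strict_mono_mono[OF assms(2)] m(1)] monoD[OF strict_mono_mono[OF assms(2)] m(2)] assms(1)
    by (simp_all add: max_delay_def)
  assume "j \<noteq> Min UNIV"
  then have "Min UNIV < j" by (rule le_neq_trans[OF m(1) not_sym])
  from strict_monoD[OF assms(2) this] show "0 < h j" using assms(1) by simp
qed

lemma integral_has_vector_derivative_right:
  fixes q :: "real \<Rightarrow> 'a::banach"
  assumes "continuous_on {a..} q" "a \<le> t"
  shows "((\<lambda>u. integral {a..u} q) has_vector_derivative q t) (at t within {a..})"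
proof -
  have "((\<lambda>u. integral {a..u} q) has_vector_derivative q t) (at t within {a..t + 1})"
    using assms by (intro integral_has_vector_derivative continuous_on_subset[OF assms(1)]) auto
  moreover have "at t within {a..t + 1} = at t within {a..}"
    by (rule at_within_nhd[where S="{..<t + 1}"]) auto
  ultimately show ?thesis by simp
qed

text \<open>(A1) bounds the functional only along nominal solutions; to exploit it at a given
  history of another trajectory, that history must be continued by a nominal solution.\<close>

lemma nominal_solution_exists:
  fixes h :: "'d::{finite,linorder} \<Rightarrow> real" and \<phi> :: "real \<Rightarrow> real^'n"
  assumes delays: "h (Min UNIV) = 0" "strict_mono h"
    and \<phi>: "continuous_on {- max_delay h..0} \<phi>"
  obtains y where "nominal_solution h G y" "\<And>\<theta>. \<theta> \<in> {- max_delay h..0} \<Longrightarrow> y \<theta> = \<phi> \<theta>"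
proof -
  note hr = delays_range[OF delays]
  have H0: "max_delay h \<ge> 0" using hr(1,2) order_trans by blast
  \<comment> \<open>The initial function is continued by its end values, which makes it bounded and
    continuous on the whole line and equal to \<open>\<phi> 0\<close> for positive times.\<close>
  define e where "e t = \<phi> (max (- max_delay h) (min t 0))" for t
  have "continuous_on UNIV e"
    unfolding e_def by (rule continuous_on_compose2[OF \<phi>]) (use H0 in \<open>auto intro!: continuous_intros\<close>)
  moreover have "bounded (\<phi> ` {- max_delay h..0})"
    using \<phi> by (intro compact_imp_bounded compact_continuous_image) auto
  then obtain M where "\<And>\<theta>. \<theta> \<in> {- max_delay h..0} \<Longrightarrow> norm (\<phi> \<theta>) \<le> M" unfolding bounded_iff by blast
  then have "norm (e t) \<le> M" for t using H0 by (auto simp: e_def)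
  ultimately obtain y where y: "continuous_on UNIV y" "\<And>t. t \<le> 0 \<Longrightarrow> y t = e t"
    "\<And>t. t \<ge> 0 \<Longrightarrow> y t = e t + integral {0..t} (\<lambda>s. \<Sum>j\<in>UNIV. G j *v y (s - h j))"
    using delay_integral_equation_solution[of h e M G] hr(1) by blast
  show thesis
  proof
    show "y \<theta> = \<phi> \<theta>" if "\<theta> \<in> {- max_delay h..0}" for \<theta> using y(2)[of \<theta>] that by (simp add: e_def)
    show "nominal_solution h G y"
      unfolding nominal_solution_def
    proof (intro conjI allI impI)
      show "continuous_on {- max_delay h..} y" using y(1) continuous_on_subset by blast
      fix t :: real assume t: "t \<ge> 0"
      define q where "q s = (\<Sum>j\<in>UNIV. G j *v y (s - h j))" for s
      have "continuous_on {0..} q"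
        unfolding q_def by (intro continuous_intros continuous_on_matrix_vector_mult
            continuous_on_compose2[OF y(1)]) auto
      from integral_has_vector_derivative_right[OF this t]
      have "((\<lambda>t. \<phi> 0 + integral {0..t} q) has_vector_derivative q t) (at t within {0..})"
        by (auto intro!: derivative_eq_intros)
      then show "(y has_vector_derivative (\<Sum>j\<in>UNIV. G j *v y (t - h j))) (at t within {0..})"
        unfolding q_def[symmetric]
      proof (rule has_vector_derivative_transform[rotated 2])
        show "y s = \<phi> 0 + integral {0..s} q" if "s \<in> {0..}" for s
          using y(3)[of s] that H0 by (simp add: e_def q_def[abs_def] max_def)
      qed (use t in auto)
    qed
  qed
qed

section \<open>Sliding motion\<close>

text \<open>After a shift by \<open>s\<close> the two integrands differ only for \<theta> in
  \<open>{- s..0}\<close>, an interval of length \<open>s\<close>. There both arguments of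
  \<open>F\<close> are close to \<open>(0, x 0)\<close>, so continuity of \<open>F\<close> makes the
  difference o(s) although neither integral need be differentiable in \<open>s\<close>.\<close>

lemma LK_integral_difference_small:
  fixes x y :: "real \<Rightarrow> real^'n"
  assumes H: "0 < a" "a \<le> H" and F: "continuous_on ({- a..0} \<times> UNIV) (\<lambda>(\<theta>, v). F \<theta> v :: real)"
    and x: "continuous_on {- H..} x" and y: "continuous_on {- H..} y"
    and eq: "\<And>\<theta>. \<theta> \<in> {- H..0} \<Longrightarrow> x \<theta> = y \<theta>" and "e > 0"
  shows "\<forall>\<^sub>F s in at_right 0. integral {- a..0} (\<lambda>\<theta>. F \<theta> (x (s + \<theta>)))
    \<le> integral {- a..0} (\<lambda>\<theta>. F \<theta> (y (s + \<theta>))) + e * s"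
proof -
  have "(0, x 0) \<in> {- a..0} \<times> (UNIV :: (real^'n) set)" using H by auto
  from mp[OF spec[OF bspec[OF F[unfolded continuous_on_iff case_prod_beta] this], of "e / 2"] half_gt_zero[OF \<open>e > 0\<close>]]
 obtain d where d: "d > 0"
    "\<And>p. p \<in> {- a..0} \<times> UNIV \<Longrightarrow> dist p (0, x 0) < d \<Longrightarrow> dist (F (fst p) (snd p)) (F 0 (x 0)) < e / 2"
    unfolding fst_conv snd_conv by blast
  have "\<exists>r>0. \<forall>s\<in>{- H..}. dist s 0 < r \<longrightarrow> dist (x s) (x 0) < d / 2"
    using x d(1) H unfolding continuous_on_iff by (elim ballE[of _ _ 0] allE[of _ "d / 2"]) auto
  then obtain r1 where r1: "r1 > 0" "\<And>s. s \<ge> - H \<Longrightarrow> \<bar>s\<bar> < r1 \<Longrightarrow> dist (x s) (x 0) < d / 2"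
    by (auto simp: dist_real_def)
  have "\<exists>r>0. \<forall>s\<in>{- H..}. dist s 0 < r \<longrightarrow> dist (y s) (y 0) < d / 2"
    using y d(1) H unfolding continuous_on_iff by (elim ballE[of _ _ 0] allE[of _ "d / 2"]) auto
  then obtain r2 where r2: "r2 > 0" "\<And>s. s \<ge> - H \<Longrightarrow> \<bar>s\<bar> < r2 \<Longrightarrow> dist (y s) (x 0) < d / 2"
    using eq[of 0] H by (auto simp: dist_real_def)
  define r where "r = min (min r1 r2) (min (d / 2) a)"
  have near: "dist (F \<theta> v) (F 0 (x 0)) < e / 2" if "\<theta> \<in> {- a..0}" "- \<theta> < d / 2" "dist v (x 0) < d / 2" for \<theta> v
  proof -
    have "dist (\<theta>, v) (0, x 0) \<le> dist \<theta> 0 + dist v (x 0)"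
      unfolding dist_Pair_Pair by (rule sqrt_sum_squares_le_sum) auto
    also have "\<dots> < d" using that by (simp add: dist_real_def)
    finally show ?thesis using d(2)[of "(\<theta>, v)"] that by simp
  qed
  have "integral {- a..0} (\<lambda>\<theta>. F \<theta> (x (s + \<theta>))) \<le> integral {- a..0} (\<lambda>\<theta>. F \<theta> (y (s + \<theta>))) + e * s"
    if s: "0 < s" "s < r" for s
  proof -
    have int: "(\<lambda>\<theta>. F \<theta> (z (s + \<theta>))) integrable_on {- a..0}" if z: "continuous_on {- H..} z" for z :: "real \<Rightarrow> real^'n"
    proof (rule integrable_continuous_interval)
      have "continuous_on {- a..0} (\<lambda>\<theta>. (\<theta>, z (s + \<theta>)))"
        using s H by (intro continuous_intros continuous_on_compose2[OF z]) auto
      then show "continuous_on {- a..0} (\<lambda>\<theta>. F \<theta> (z (s + \<theta>)))"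
        using continuous_on_compose2[OF F, of "{- a..0}" "\<lambda>\<theta>. (\<theta>, z (s + \<theta>))"] by auto
    qed
    have "integral {- a..0} (\<lambda>\<theta>. F \<theta> (x (s + \<theta>))) \<le>
       integral {- a..0} (\<lambda>\<theta>. F \<theta> (y (s + \<theta>)) + (if \<theta> \<in> {- s..0} then e else 0))"
    proof (rule integral_le[OF int[OF x]])
      have sub: "{- s..0} \<subseteq> {- a..0}" using s by (auto simp: r_def)
      have ind: "(\<lambda>\<theta>. if \<theta> \<in> {- s..0} then e else 0) integrable_on {- a..0}"
        using has_integral_restrict_closed_subinterval[of "\<lambda>_. e" _ "- s" 0 "- a" 0] sub
          has_integral_const_real[of e "- s" 0] by (auto simp: box_real intro!: has_integral_integrable)
      show "(\<lambda>\<theta>. F \<theta> (y (s + \<theta>)) + (if \<theta> \<in> {- s..0} then e else 0)) integrable_on {- a..0}"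
        by (intro integrable_add int y ind)
      fix \<theta> assume t: "\<theta> \<in> {- a..0}"
      show "F \<theta> (x (s + \<theta>)) \<le> F \<theta> (y (s + \<theta>)) + (if \<theta> \<in> {- s..0} then e else 0)"
      proof (cases "\<theta> \<in> {- s..0}")
        case True
        then have "dist (x (s + \<theta>)) (x 0) < d / 2" "dist (y (s + \<theta>)) (x 0) < d / 2" "- \<theta> < d / 2"
          using s t H r1(2)[of "s + \<theta>"] r2(2)[of "s + \<theta>"] by (auto simp: r_def)
        with t have "dist (F \<theta> (x (s + \<theta>))) (F 0 (x 0)) < e / 2" "dist (F \<theta> (y (s + \<theta>))) (F 0 (x 0)) < e / 2"
          by (auto intro: near simp del: less_divide_eq_numeral1)
        then have "F \<theta> (x (s + \<theta>)) \<le> F \<theta> (y (s + \<theta>)) + e" unfolding dist_real_def by linarith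
        with True show ?thesis by simp
      next
        case False
        then have "s + \<theta> \<in> {- H..0}" using t s H by auto
        then have "x (s + \<theta>) = y (s + \<theta>)" by (rule eq)
        with False show ?thesis by auto
      qed
    qed
    also have "\<dots> = integral {- a..0} (\<lambda>\<theta>. F \<theta> (y (s + \<theta>))) + e * s"
    proof -
      have sub: "{- s..0} \<subseteq> {- a..0}" using s by (auto simp: r_def)
      have "((\<lambda>\<theta>. if \<theta> \<in> {- s..0} then e else 0) has_integral e * s) {- a..0}"
        using has_integral_restrict_closed_subinterval[of "\<lambda>_. e" "e * s" "- s" 0 "- a" 0] sub
          has_integral_const_real[of e "- s" 0] s by (auto simp: box_real mult.commute)
      from has_integral_add[OF integrable_integral[OF int[OF y]] this] show ?thesis
        by (rule integral_unique)
    qed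
    finally show ?thesis .
  qed
  moreover have "r > 0" using r1(1) r2(1) d(1) H by (simp add: r_def)
  ultimately show ?thesis unfolding eventually_at_right_field by blast
qed

text \<open>At time 0 the derivatives of the two quadratic terms differ by twice the inner product
  of \<open>P *v x 0\<close> and \<open>B *v p\<close>, which is the inner product of
  \<open>transpose B *v (P *v x 0)\<close> and \<open>p\<close>, hence 0.\<close>

lemma quadratic_difference_small:
  fixes x y :: "real \<Rightarrow> real^'n"
  assumes P: "transpose P = P"
    and x: "(x has_vector_derivative v + B *v p) (at 0 within {0..})"
    and y: "(y has_vector_derivative v) (at 0 within {0..})"
    and eq: "x 0 = y 0" and ortho: "transpose B *v (P *v x 0) = 0" and "e > 0"
  shows "\<forall>\<^sub>F s in at_right 0. x s \<bullet> (P *v x s) \<le> y s \<bullet> (P *v y s) + e * s"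
proof -
  have PB: "(P *v x 0) \<bullet> (B *v p) = 0"
    using ortho dot_lmul_matrix[of "P *v x 0" B p] by (simp add: inner_commute)
  have Psym: "a \<bullet> (P *v b) = (P *v a) \<bullet> b" for a b
    by (metis P dot_lmul_matrix transpose_matrix_vector)
  have d: "((\<lambda>s. z s \<bullet> (P *v z s)) has_vector_derivative 2 * ((P *v z 0) \<bullet> u)) (at 0 within {0..})"
    if "(z has_vector_derivative u) (at 0 within {0..})" for z :: "real \<Rightarrow> real^'n" and u
  proof -
    have "((\<lambda>s. P *v z s) has_vector_derivative P *v u) (at 0 within {0..})"
      using bounded_linear.has_vector_derivative[OF matrix_vector_mul_bounded_linear that] .
    from bounded_bilinear.has_vector_derivative[OF bounded_bilinear_inner that this]
    show ?thesis using Psym[of "z 0" u] inner_commute[of u "P *v z 0"] by simp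
  qed
  have "((\<lambda>s. x s \<bullet> (P *v x s) - y s \<bullet> (P *v y s)) has_vector_derivative 0) (at 0 within {0..})"
    using has_vector_derivative_diff[OF d[OF x] d[OF y]] PB eq by (simp add: inner_add_right)
  then have "((\<lambda>s. x s \<bullet> (P *v x s) - y s \<bullet> (P *v y s)) has_field_derivative 0) (at 0 within {0..})"
    by (simp add: has_real_derivative_iff_has_vector_derivative)
  then have "((\<lambda>s. (x s \<bullet> (P *v x s) - y s \<bullet> (P *v y s)) / s) \<longlongrightarrow> 0) (at 0 within {0..})"
    using eq by (simp add: has_field_derivative_iff)
  then have "((\<lambda>s. (x s \<bullet> (P *v x s) - y s \<bullet> (P *v y s)) / s) \<longlongrightarrow> 0) (at_right 0)"
    by (rule tendsto_within_subset) auto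
  then have "\<forall>\<^sub>F s in at_right 0. (x s \<bullet> (P *v x s) - y s \<bullet> (P *v y s)) / s < e"
    using \<open>e > 0\<close> by (rule order_tendstoD)
  moreover have "\<forall>\<^sub>F s::real in at_right 0. s > 0" by (simp add: eventually_at_right_less)
  ultimately show ?thesis
    by eventually_elim (simp add: field_simps)
qed

text \<open>The functionals along the trajectory and along the nominal continuation of its history
  agree at the start and afterwards satisfy a one-sided comparison up to an o(s) error. The result
  is phrased as an inequality with slack \<open>e * s\<close> for all small \<open>s\<close>, rather
  than as a bound on an upper derivative, because this is the local condition that real induction
  consumes.\<close>

lemma LK_derivative_on_manifold:
  fixes h :: "'d::{finite,linorder} \<Rightarrow> real" and x :: "real \<Rightarrow> real^'n"
  assumes delays: "h (Min UNIV) = 0" "strict_mono h"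
    and P: "transpose P = P"
    and F: "\<And>j. j \<noteq> Min UNIV \<Longrightarrow> continuous_on ({- h j..0} \<times> UNIV) (\<lambda>(\<theta>, y). F j \<theta> y)"
    and decay: "\<And>y. nominal_solution h G y \<Longrightarrow>
      derivative_along (LK_functional h P F) y 0 \<le> ereal (- \<alpha> * (norm (y 0))\<^sup>2)"
    and x: "continuous_on {- max_delay h..} x" and "t \<ge> 0"
    and dx: "(x has_vector_derivative (\<Sum>j\<in>UNIV. G j *v x (t - h j)) + B *v p) (at t within {t..})"
    and ortho: "transpose B *v (P *v x t) = 0" and "e > 0"
  shows "\<forall>\<^sub>F s in at_right 0. LK_functional h P F (segment x (t + s))
    \<le> LK_functional h P F (segment x t) + (- \<alpha> * (norm (x t))\<^sup>2 + e) * s"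
proof -
  note hr = delays_range[OF delays]
  let ?H = "max_delay h" and ?V = "LK_functional h P F"
  have H0: "?H \<ge> 0" using hr(1,2) order_trans by blast
  define X where "X = segment x t"
  have X: "continuous_on {- ?H..} X" unfolding X_def segment_def
    by (rule continuous_on_compose2[OF x]) (use \<open>t \<ge> 0\<close> in \<open>auto intro!: continuous_intros\<close>)
  obtain y where nom: "nominal_solution h G y" and yX: "\<And>\<theta>. \<theta> \<in> {- ?H..0} \<Longrightarrow> y \<theta> = X \<theta>"
    using nominal_solution_exists[OF delays, of X G] continuous_on_subset[OF X] by (metis Icc_subset_Ici_iff order_refl)
  have y: "continuous_on {- ?H..} y" using nom by (simp add: nominal_solution_def)
  have dy: "(y has_vector_derivative (\<Sum>j\<in>UNIV. G j *v x (t - h j))) (at 0 within {0..})"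
  proof -
    have "(y has_vector_derivative (\<Sum>j\<in>UNIV. G j *v y (0 - h j))) (at 0 within {0..})"
      using nom unfolding nominal_solution_def by blast
    moreover have "y (0 - h j) = x (t - h j)" for j
      using yX[of "- h j"] hr[of j] by (simp add: X_def segment_def)
    ultimately show ?thesis by simp
  qed
  have dX: "(X has_vector_derivative (\<Sum>j\<in>UNIV. G j *v x (t - h j)) + B *v p) (at 0 within {0..})"
  proof -
    have "(\<lambda>s. t + s) ` {0..} = {t..}"
      by (auto simp: image_iff intro!: bexI[of _ "_ - t"])
    then have "((x \<circ> (\<lambda>s. t + s)) has_vector_derivative 1 *\<^sub>R ((\<Sum>j\<in>UNIV. G j *v x (t - h j)) + B *v p))
        (at 0 within {0..})"
      using dx by (intro vector_diff_chain_within) (auto intro!: derivative_eq_intros)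
    then show ?thesis by (simp add: X_def segment_def o_def)
  qed
  have X0: "X 0 = y 0" "X 0 = x t" using yX[of 0] H0 by (simp_all add: X_def segment_def)
  \<comment> \<open>The slack is shared among at most \<open>card UNIV\<close> integral terms, the
    quadratic term, and the strict bound extracted from the upper limit.\<close>
  define m where "m = real (card (UNIV :: 'd set)) + 2"
  have m: "m > 0" by (simp add: m_def)
  define e' where "e' = e / m"
  have e': "e' > 0" using m \<open>e > 0\<close> by (simp add: e'_def)
  have 1: "\<forall>\<^sub>F s in at_right 0. X s \<bullet> (P *v X s) \<le> y s \<bullet> (P *v y s) + e' * s"
    using quadratic_difference_small[OF P dX dy X0(1) _ e'] ortho X0 by simp
  have 2: "\<forall>\<^sub>F s in at_right 0. \<forall>j\<in>UNIV - {Min UNIV}. integral {- h j..0} (\<lambda>\<theta>. F j \<theta> (X (s + \<theta>)))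
    \<le> integral {- h j..0} (\<lambda>\<theta>. F j \<theta> (y (s + \<theta>))) + e' * s"
    unfolding eventually_ball_finite_distrib[OF finite_Diff[OF finite]]
    using hr F yX e' by (intro ballI LK_integral_difference_small[OF _ _ _ X y]) auto
  have V0: "?V (segment y 0) = ?V X"
  proof -
    have "integral {- h j..0} (\<lambda>\<theta>. F j \<theta> (y \<theta>)) = integral {- h j..0} (\<lambda>\<theta>. F j \<theta> (X \<theta>))" for j
      using yX hr(2)[of j] by (intro Henstock_Kurzweil_Integration.integral_cong) auto
    then show ?thesis using X0 by (simp add: LK_functional_def segment_def)
  qed
  have "derivative_along ?V y 0 < ereal (- \<alpha> * (norm (x t))\<^sup>2 + e')"
    using decay[OF nom] X0 e' by (auto intro: le_less_trans)
  then have 3: "\<forall>\<^sub>F s in at_right 0. (?V (segment y s) - ?V X) / s < - \<alpha> * (norm (x t))\<^sup>2 + e'"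
    unfolding derivative_along_def using Limsup_lessD V0 by fastforce
  have "\<forall>\<^sub>F s::real in at_right 0. s > 0" by (simp add: eventually_at_right_less)
  with 1 2 3 show ?thesis
  proof eventually_elim
    case (elim s)
    have "?V (segment x (t + s)) = X s \<bullet> (P *v X s) +
        (\<Sum>j\<in>UNIV - {Min UNIV}. integral {- h j..0} (\<lambda>\<theta>. F j \<theta> (X (s + \<theta>))))"
      by (simp add: LK_functional_def segment_def X_def add.assoc)
    also have "\<dots> \<le> (y s \<bullet> (P *v y s) + e' * s) +
        (\<Sum>j\<in>UNIV - {Min UNIV}. integral {- h j..0} (\<lambda>\<theta>. F j \<theta> (y (s + \<theta>))) + e' * s)"
      using elim by (intro add_mono sum_mono) auto
    also have "\<dots> = ?V (segment y s) + e' * s + real (card (UNIV - {Min UNIV :: 'd})) * (e' * s)"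
      by (simp add: LK_functional_def segment_def sum.distrib)
    also have "\<dots> \<le> ?V (segment y s) + e' * s + (m - 2) * (e' * s)"
      using elim e' by (intro add_left_mono mult_right_mono) (auto simp: m_def intro!: card_mono)
    also have "?V (segment y s) \<le> ?V X + (- \<alpha> * (norm (x t))\<^sup>2 + e') * s"
      using elim by (simp add: field_simps)
    finally have "?V (segment x (t + s)) \<le> ?V X + (- \<alpha> * (norm (x t))\<^sup>2) * s + (e' * m) * s"
      by (simp add: algebra_simps)
    then show ?case using m by (simp add: X_def e'_def algebra_simps)
  qed
qed

lemma continuous_on_LK_functional:
  fixes h :: "'d::{finite,linorder} \<Rightarrow> real" and x :: "real \<Rightarrow> real^'n"
  assumes delays: "h (Min UNIV) = 0" "strict_mono h"
    and F: "\<And>j. j \<noteq> Min UNIV \<Longrightarrow> continuous_on ({- h j..0} \<times> UNIV) (\<lambda>(\<theta>, y). F j \<theta> y)"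
    and x: "continuous_on {- max_delay h..} x"
  shows "continuous_on {0..} (\<lambda>t. LK_functional h P F (segment x t))"
proof -
  note hr = delays_range[OF delays]
  have H0: "max_delay h \<ge> 0" using hr(1,2) order_trans by blast
  have "continuous_on {0..} (\<lambda>t. integral (cbox (- h j) 0) (\<lambda>\<theta>. F j \<theta> (x (t + \<theta>))))" if "j \<noteq> Min UNIV" for j
  proof (rule integral_continuous_on_param)
    have c: "continuous_on ({0..} \<times> cbox (- h j) 0) (\<lambda>p. (snd p, x (fst p + snd p)))"
      using hr(2)[of j] by (intro continuous_intros continuous_on_compose2[OF x]) auto
    have sub: "(\<lambda>p. (snd p, x (fst p + snd p))) ` ({0..} \<times> cbox (- h j) 0) \<subseteq> {- h j..0} \<times> UNIV" by auto
    show "continuous_on ({0..} \<times> cbox (- h j) 0) (\<lambda>(t, \<theta>). F j \<theta> (x (t + \<theta>)))"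
      using continuous_on_compose2[OF F[OF that] c sub] by (simp add: case_prod_beta)
  qed
  moreover have "continuous_on {0..} x" using continuous_on_subset[OF x] H0 by auto
  ultimately show ?thesis
    unfolding LK_functional_def segment_def
    by (intro continuous_intros continuous_on_matrix_vector_mult continuous_on_sum) auto
qed

text \<open>
  On the manifold the direction \<open>B *v p\<close> is \<open>P\<close>-orthogonal to the state, so the functional decays
  along the sliding motion exactly as it does along the nominal solution with the same history.
\<close>

lemma sliding_motion_converges:
  fixes h :: "'d::{finite,linorder} \<Rightarrow> real" and x :: "real \<Rightarrow> real^'n" and Q :: "real^'n^'k"
  assumes delays: "h (Min UNIV) = 0" "strict_mono h"
    and LK: "LK_assumption h G P F"
    and x: "continuous_on {- max_delay h..} x" and "T \<ge> 0"
    and q: "\<And>t. q t = (\<Sum>j\<in>UNIV. G j *v x (t - h j))"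
    and sol: "\<And>t. t \<ge> T \<Longrightarrow> x t = x T + integral {T..t} (\<lambda>s. q s + B *v (Q *v q s))"
    and man: "\<And>t. t \<ge> T \<Longrightarrow> transpose B *v (P *v x t) = 0"
  shows "(x \<longlongrightarrow> 0) at_top"
proof -
  note hr = delays_range[OF delays]
  let ?H = "max_delay h" and ?V = "LK_functional h P F"
  have H0: "?H \<ge> 0" using hr(1,2) order_trans by blast
  have P: "transpose P = P" using LK by (simp add: LK_assumption_def positive_definite_def)
  have F: "continuous_on ({- h j..0} \<times> UNIV) (\<lambda>(\<theta>, y). F j \<theta> y)" if "j \<noteq> Min UNIV" for j
    using LK that unfolding LK_assumption_def by blast
  obtain \<alpha>1 \<alpha>3 where \<alpha>: "\<alpha>1 > 0" "\<alpha>3 > 0"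
    "\<And>\<phi>. continuous_on {- ?H..0} \<phi> \<Longrightarrow> \<alpha>1 * (norm (\<phi> 0))\<^sup>2 \<le> ?V \<phi>"
    "\<And>y t. nominal_solution h G y \<Longrightarrow> t \<ge> 0 \<Longrightarrow> derivative_along ?V y t \<le> ereal (- \<alpha>3 * (norm (y t))\<^sup>2)"
    using LK unfolding LK_assumption_def by blast
  define W where "W t = ?V (segment x t)" for t
  define D where "D s = q s + B *v (Q *v q s)" for s
  have contx: "continuous_on {0..} x" using continuous_on_subset[OF x] H0 by auto
  have contW: "continuous_on {0..} W" unfolding W_def by (rule continuous_on_LK_functional[OF delays F x])
  have le: "- ?H \<le> s - h j" if "s \<ge> 0" for s j
    using hr(2)[of j] that by simp
  have contq: "continuous_on {0..} q"
    unfolding q by (intro continuous_intros continuous_on_matrix_vector_mult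
        continuous_on_compose2[OF x]) (auto simp: le)
  have contD: "continuous_on {0..} D"
    unfolding D_def by (intro continuous_intros contq continuous_on_matrix_vector_mult)
  have W_lower: "\<alpha>1 * (norm (x t))\<^sup>2 \<le> W t" if "t \<ge> 0" for t
  proof -
    have "continuous_on {- ?H..0} (segment x t)"
      unfolding segment_def by (rule continuous_on_compose2[OF x]) (use that in \<open>auto intro!: continuous_intros\<close>)
    from \<alpha>(3)[OF this] show ?thesis by (simp add: W_def segment_def)
  qed
  have deriv: "(x has_vector_derivative D t) (at t within {t..})" if "t \<ge> T" for t
  proof -
    have "((\<lambda>u. x T + integral {T..u} D) has_vector_derivative D t) (at t within {T..})"
      using that \<open>T \<ge> 0\<close> integral_has_vector_derivative_right[OF continuous_on_subset[OF contD], of T t]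
      by (auto intro!: derivative_eq_intros)
    then have "(x has_vector_derivative D t) (at t within {T..})"
    proof (rule has_vector_derivative_transform[rotated 2])
      show "x s = x T + integral {T..s} D" if "s \<in> {T..}" for s
        unfolding D_def[abs_def] using that by (intro sol) simp
    qed (use that in simp)
    then show ?thesis by (rule has_vector_derivative_within_subset) (use that in auto)
  qed
  have nint: "(\<lambda>s. (norm (x s))\<^sup>2) integrable_on {u..v}" if "u \<ge> 0" for u v
    using that by (intro integrable_continuous_interval continuous_intros continuous_on_subset[OF contx]) auto
  have decrease: "W v + \<alpha>3 * integral {u..v} (\<lambda>s. (norm (x s))\<^sup>2) \<le> W u" if uv: "T \<le> u" "u \<le> v" for u v
  proof -
    have u0: "u \<ge> 0" using uv \<open>T \<ge> 0\<close> by simp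
    have "W v + \<alpha>3 * integral {u..v} (\<lambda>s. (norm (x s))\<^sup>2) \<le> W u + e * (v - u)" if "e > 0" for e
    proof -
      define I where "I t = integral {u..t} (\<lambda>s. (norm (x s))\<^sup>2)" for t
      \<comment> \<open>Half of the rate \<open>e\<close> pays for the slack in the derivative of
        the functional, the other half for the variation of the squared norm of x on a short
        interval.\<close>
      define K where "K t = W t + \<alpha>3 * I t - e * (t - u)" for t
      have "K v \<le> K u"
      proof (rule continuous_le_of_locally_le[OF uv(2)])
        show "continuous_on {u..v} K"
          unfolding K_def I_def using u0
          by (intro continuous_intros continuous_on_subset[OF contW] indefinite_integral_continuous_1 nint) auto
        fix t assume t: "u \<le> t" "t < v"
        have "\<forall>\<^sub>F s in at_right 0. W (t + s) \<le> W t + (- \<alpha>3 * (norm (x t))\<^sup>2 + e / 2) * s"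
          unfolding W_def
        proof (rule LK_derivative_on_manifold[OF delays P F _ x])
          show "derivative_along ?V y 0 \<le> ereal (- \<alpha>3 * (norm (y 0))\<^sup>2)" if "nominal_solution h G y" for y
            using \<alpha>(4)[OF that] by simp
          show "(x has_vector_derivative (\<Sum>j\<in>UNIV. G j *v x (t - h j)) + B *v (Q *v q t)) (at t within {t..})"
            using deriv[of t] uv t by (simp add: D_def q)
        qed (use t uv u0 man \<open>e > 0\<close> in auto)
        then obtain r1 where r1: "r1 > 0" "\<And>s. 0 < s \<Longrightarrow> s < r1 \<Longrightarrow> W (t + s) \<le> W t + (- \<alpha>3 * (norm (x t))\<^sup>2 + e / 2) * s"
          unfolding eventually_at_right_field by blast
        have "continuous_on {u..v} (\<lambda>s. \<alpha>3 * (norm (x s))\<^sup>2)"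
          using u0 by (intro continuous_intros continuous_on_subset[OF contx]) auto
        moreover have "t \<in> {u..v}" "e / 2 > 0" using t \<open>e > 0\<close> by auto
        ultimately obtain r2 where r2: "r2 > 0"
          "\<And>s. s \<in> {u..v} \<Longrightarrow> dist s t < r2 \<Longrightarrow> dist (\<alpha>3 * (norm (x s))\<^sup>2) (\<alpha>3 * (norm (x t))\<^sup>2) < e / 2"
          unfolding continuous_on_iff by blast
        have "K s \<le> K t" if s: "t \<le> s" "s < t + min r1 r2" "s \<le> v" for s
        proof (cases "s = t")
          case False
          have "I s = I t + integral {t..s} (\<lambda>s. (norm (x s))\<^sup>2)"
            unfolding I_def using s t u0
            by (intro Henstock_Kurzweil_Integration.integral_combine[symmetric] nint) auto
          then have "\<alpha>3 * I s = \<alpha>3 * I t + \<alpha>3 * integral {t..s} (\<lambda>s. (norm (x s))\<^sup>2)"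
            by (simp add: distrib_left)
          moreover have "\<alpha>3 * integral {t..s} (\<lambda>s. (norm (x s))\<^sup>2) \<le> (\<alpha>3 * (norm (x t))\<^sup>2 + e / 2) * (s - t)"
          proof -
            have "integral {t..s} (\<lambda>q. \<alpha>3 * (norm (x q))\<^sup>2) \<le> integral {t..s} (\<lambda>_. \<alpha>3 * (norm (x t))\<^sup>2 + e / 2)"
            proof (rule integral_le)
              show "(\<lambda>q. \<alpha>3 * (norm (x q))\<^sup>2) integrable_on {t..s}" using t u0 by (intro integrable_on_mult_right nint) auto
              fix p assume p: "p \<in> {t..s}"
              then have "p \<in> {u..v}" "dist p t < r2" using s t by (auto simp: dist_real_def)
              from r2(2)[OF this] show "\<alpha>3 * (norm (x p))\<^sup>2 \<le> \<alpha>3 * (norm (x t))\<^sup>2 + e / 2"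
                unfolding dist_real_def by linarith
            qed auto
            then show ?thesis using s by (simp add: mult.commute)
          qed
          moreover have "W s \<le> W t + (- \<alpha>3 * (norm (x t))\<^sup>2 + e / 2) * (s - t)"
            using r1(2)[of "s - t"] s False by simp
          moreover have "(\<alpha>3 * (norm (x t))\<^sup>2 + e / 2) * (s - t) + (- \<alpha>3 * (norm (x t))\<^sup>2 + e / 2) * (s - t)
              = e * (s - u) - e * (t - u)"
            by (simp add: field_simps)
          ultimately show ?thesis unfolding K_def by linarith
        qed simp
        then show "\<exists>r>0. \<forall>s. t \<le> s \<and> s < t + r \<and> s \<le> v \<longrightarrow> K s \<le> K t"
          using r1(1) r2(1) by (intro exI[of _ "min r1 r2"]) auto
      qed
      then show ?thesis by (simp add: K_def I_def)
    qed
    note main = this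
    show ?thesis
    proof (rule field_le_epsilon)
      fix e :: real assume "e > 0"
      have "e / (v - u + 1) * (v - u) \<le> e" using \<open>e > 0\<close> uv by (simp add: field_simps)
      with main[of "e / (v - u + 1)"] \<open>e > 0\<close> uv
      show "W v + \<alpha>3 * integral {u..v} (\<lambda>s. (norm (x s))\<^sup>2) \<le> W u + e" by simp
    qed
  qed
  have int_nonneg: "integral {u..v} (\<lambda>s. (norm (x s))\<^sup>2) \<ge> 0" if "u \<ge> 0" for u v
    using that by (intro Henstock_Kurzweil_Integration.integral_nonneg nint) auto
  have anti: "W v \<le> W u" if "T \<le> u" "u \<le> v" for u v
  proof -
    have "\<alpha>3 * integral {u..v} (\<lambda>s. (norm (x s))\<^sup>2) \<ge> 0"
      using int_nonneg[of u v] \<alpha>(2) that \<open>T \<ge> 0\<close> by simp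
    with decrease[OF that] show ?thesis by linarith
  qed
  have W0: "W t \<ge> 0" if "t \<ge> 0" for t
    using order_trans[OF _ W_lower[OF that]] \<alpha>(1) by simp
  \<comment> \<open>The bound covers the history as well, since the delayed arguments reach back to
    the left end of the initial interval. After \<open>T\<close> it follows from the monotonicity of
    \<open>W\<close> and its lower bound in (A1).\<close>
  obtain M where M: "\<And>t. t \<ge> - ?H \<Longrightarrow> norm (x t) \<le> M"
  proof -
    have "bounded (x ` {- ?H..T})"
      using continuous_on_subset[OF x] by (intro compact_imp_bounded compact_continuous_image) auto
    then obtain M1 where M1: "\<And>t. t \<in> {- ?H..T} \<Longrightarrow> norm (x t) \<le> M1" unfolding bounded_iff by blast
    have "norm (x t) \<le> sqrt (W T / \<alpha>1)" if "t \<ge> T" for t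
      using W_lower[of t] anti[OF order_refl that] that \<open>T \<ge> 0\<close> \<alpha>(1)
      by (intro real_le_rsqrt) (simp add: field_simps)
    then have "norm (x t) \<le> max M1 (sqrt (W T / \<alpha>1))" if "t \<ge> - ?H" for t
      using M1[of t] that by (cases "t \<le> T") (auto simp: le_max_iff_disj)
    then show ?thesis by (rule that)
  qed
  \<comment> \<open>The velocity is a linear expression in bounded delayed states; its bound makes x
    Lipschitz after \<open>T\<close>, the uniform continuity that Barbalat's argument needs.\<close>
  obtain N where N: "\<And>t. t \<ge> 0 \<Longrightarrow> norm (D t) \<le> N" "N > 0"
  proof -
    define C where "C = (\<Sum>j\<in>UNIV. onorm ((*v) (G j))) * M"
    have qC: "norm (q t) \<le> C" if "t \<ge> 0" for t
    proof -
      have "norm (\<Sum>j\<in>UNIV. G j *v x (t - h j)) \<le> (\<Sum>j\<in>UNIV. onorm ((*v) (G j))) * M"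
        by (rule norm_delay_sum_le[OF M[OF le[OF that]]])
      then show ?thesis by (simp add: q C_def)
    qed
    have "norm (D t) \<le> C + onorm ((*v) B) * (onorm ((*v) Q) * C)" if "t \<ge> 0" for t
    proof -
      have pos: "onorm ((*v) B) \<ge> 0" "onorm ((*v) Q) \<ge> 0"
        by (rule onorm_pos_le[OF matrix_vector_mul_bounded_linear])+
      have "norm (B *v (Q *v q t)) \<le> onorm ((*v) B) * (onorm ((*v) Q) * norm (q t))"
        using matrix_vector_mult_norm_le[of B "Q *v q t"] mult_left_mono[OF matrix_vector_mult_norm_le[of Q "q t"] pos(1)]
        by linarith
      also have "\<dots> \<le> onorm ((*v) B) * (onorm ((*v) Q) * C)"
        using qC[OF that] pos by (intro mult_left_mono)
      finally show ?thesis unfolding D_def using qC[OF that] norm_triangle_ineq[of "q t" "B *v (Q *v q t)"] by linarith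
    qed
    then show ?thesis
      by (intro that[of "max 1 (C + onorm ((*v) B) * (onorm ((*v) Q) * C))"]) (auto simp: le_max_iff_disj)
  qed
  have lip: "norm (x v - x u) \<le> N * (v - u)" if "T \<le> u" "u \<le> v" for u v
  proof -
    have Dint: "D integrable_on {a..b}" if "a \<ge> 0" for a b
      using that by (intro integrable_continuous_interval continuous_on_subset[OF contD]) auto
    have "integral {T..u} D + integral {u..v} D = integral {T..v} D"
      using that \<open>T \<ge> 0\<close> by (intro Henstock_Kurzweil_Integration.integral_combine Dint) auto
    then have "x v - x u = integral {u..v} D"
      using sol[of u] sol[of v] that by (simp add: D_def[abs_def] algebra_simps)
    also have "norm \<dots> \<le> integral {u..v} (\<lambda>_. N)"
      using that \<open>T \<ge> 0\<close> N(1) by (intro integral_norm_bound_integral Dint) auto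
    finally show ?thesis using that by (simp add: mult.commute)
  qed
  show ?thesis
  proof (rule tendstoI)
    fix e :: real assume "e > 0"
    \<comment> \<open>By the Lipschitz bound, a value of norm at least \<open>e\<close> keeps the
      norm above \<open>e / 2\<close> for the time \<open>r\<close>, which costs \<open>W\<close> at
      least the amount \<eta>. This is impossible once \<open>W\<close> is within \<eta> of its
      infimum.\<close>
    define r where "r = e / (2 * N)"
    have r: "r > 0" "N * r = e / 2" using \<open>e > 0\<close> N(2) by (simp_all add: r_def)
    define \<eta> where "\<eta> = \<alpha>3 * (r * (e / 2)\<^sup>2)"
    have "\<eta> > 0" using \<alpha>(2) r(1) \<open>e > 0\<close> by (simp add: \<eta>_def)
    have bdd: "bdd_below (W ` {T..})"
    proof (rule bdd_belowI2[of _ 0])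
      show "0 \<le> W t" if "t \<in> {T..}" for t using W0[of t] that \<open>T \<ge> 0\<close> by simp
    qed
    have "Inf (W ` {T..}) < Inf (W ` {T..}) + \<eta>" using \<open>\<eta> > 0\<close> by simp
    moreover have "W ` {T..} \<noteq> {}" by simp
    ultimately have "\<exists>y\<in>W ` {T..}. y < Inf (W ` {T..}) + \<eta>" using cInf_lessD by metis
    then obtain t0 where t0: "t0 \<ge> T" "W t0 < Inf (W ` {T..}) + \<eta>" by auto
    have "norm (x t) < e" if t: "t \<ge> t0" for t
    proof (rule ccontr)
      assume "\<not> norm (x t) < e"
      have large: "e / 2 \<le> norm (x s)" if "s \<in> {t..t + r}" for s
      proof -
        have "norm (x s - x t) \<le> N * (s - t)" using lip that t t0 by auto
        also have "\<dots> \<le> N * r" using that N(2) by (intro mult_left_mono) auto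
        finally show ?thesis using r(2) \<open>\<not> norm (x t) < e\<close> norm_triangle_ineq3[of "x s" "x t"] by linarith
      qed
      have "integral {t..t + r} (\<lambda>_. (e / 2)\<^sup>2) \<le> integral {t..t + r} (\<lambda>s. (norm (x s))\<^sup>2)"
        using large \<open>e > 0\<close> t t0 \<open>T \<ge> 0\<close> by (intro integral_le nint power_mono) auto
      then have "r * (e / 2)\<^sup>2 \<le> integral {t..t + r} (\<lambda>s. (norm (x s))\<^sup>2)" using r(1) by simp
      then have "\<eta> \<le> \<alpha>3 * integral {t..t + r} (\<lambda>s. (norm (x s))\<^sup>2)"
        unfolding \<eta>_def using \<alpha>(2) by (intro mult_left_mono) auto
      then have "W (t + r) + \<eta> \<le> W t" using decrease[of t "t + r"] t t0 r(1) by auto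
      moreover have "W t \<le> W t0" using anti t t0 by auto
      moreover have "Inf (W ` {T..}) \<le> W (t + r)"
        using t t0 r(1) by (intro cInf_lower bdd) auto
      ultimately show False using t0(2) by linarith
    qed
    then show "\<forall>\<^sub>F t in at_top. dist (x t) 0 < e"
      by (auto simp: eventually_at_top_linorder)
  qed
qed

section \<open>Reduction of the closed loop to the super-twisting dynamics and the sliding
  motion\<close>

text \<open>If y is in the kernel, then \<open>B *v y\<close> has zero energy in the form given by
  P, so it is 0 by definiteness, and full column rank gives y = 0.\<close>

lemma input_matrix_invertible:
  fixes B :: "real^'k^'n"
  assumes "positive_definite P" "rank B = CARD('k)"
  shows "invertible (input_matrix B P)"
proof -
  have "inj ((*v) (input_matrix B P))"
    unfolding linear_injective_0[OF matrix_vector_mul_linear]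
  proof (intro allI impI)
    fix y :: "real^'k" assume y: "input_matrix B P *v y = 0"
    have "(B *v y) \<bullet> (P *v (B *v y)) = y \<bullet> (transpose B *v (P *v (B *v y)))"
      using dot_lmul_matrix[of "P *v (B *v y)" B y]
      by (simp only: transpose_matrix_vector inner_commute[of y] inner_commute[of "B *v y"])
    also have "transpose B *v (P *v (B *v y)) = 0"
      using y by (simp add: input_matrix_def matrix_vector_mul_assoc matrix_mul_assoc scaleR_matrix_vector_assoc[symmetric])
    finally have "B *v y = 0" using assms(1) unfolding positive_definite_def by force
    moreover have "inj ((*v) B)" using assms(2) full_rank_injective by blast
    ultimately show "y = 0" by (metis injD matrix_vector_mult_0_right)
  qed
  then show ?thesis by (metis invertible_left_inverse matrix_left_invertible_injective)
qed

theorem theorem1: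
  fixes h :: "'d::{finite,linorder} \<Rightarrow> real"
    and A G :: "'d \<Rightarrow> real^'n^'n"
    and B :: "real^'k^'n"
    and K :: "'d \<Rightarrow> real^'n^'k"
    and P :: "real^'n^'n"
    and F :: "'d \<Rightarrow> real \<Rightarrow> real^'n \<Rightarrow> real"
    and \<phi> x :: "real \<Rightarrow> real^'n"
    and \<delta> \<delta>z :: "real \<Rightarrow> real^'n^'d::{finite,linorder} \<Rightarrow> real^'k"
    and d1 :: "real \<Rightarrow> real^'n \<Rightarrow> real^'k"
    and \<rho>1 :: "real \<Rightarrow> real^'n \<Rightarrow> real"
    and \<rho>2 :: "real \<Rightarrow> real^'n^'d::{finite,linorder} \<Rightarrow> real^'k \<Rightarrow> real"
    and \<delta>0 \<beta> \<epsilon> k3 :: real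
    and xb :: "real \<Rightarrow> real^'n^'d::{finite,linorder}"
    and xbb d2 u v_nom v u_sta \<rho> \<zeta> w z :: "real \<Rightarrow> real^'k"
    and k1 k2 :: "real \<Rightarrow> real"
  assumes delays: "h (Min UNIV) = 0" "strict_mono h"
    and initial_function: "continuous_on {- max_delay h..0} \<phi>"
    and uncertainty_continuous: "\<And>t. t \<ge> 0 \<Longrightarrow> continuous_on UNIV (\<delta> t)"
    and uncertainty_measurable: "\<And>X. (\<lambda>t. \<delta> t X) \<in> borel_measurable (lebesgue_on {0..})"
    \<comment> \<open>nominal closed loop\<close>
    and G_eq: "\<And>j. G j = A j + B ** K j"
    and nominal_stable: "nominal_asymptotically_stable h G"
    \<comment> \<open>(A1), (A2)\<close>
    and A1: "LK_assumption h G P F"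
    and A2: "rank B = CARD('k)"
    \<comment> \<open>(A3) with the regularity of the vanishing and non-vanishing terms\<close>
    and A3_split: "\<And>t X. t \<ge> 0 \<Longrightarrow>
      input_matrix B P *v \<delta> t X = d1 t (X $ Min UNIV) + \<delta>z t X"
    and A3_vanishing: "\<And>t y. t \<ge> 0 \<Longrightarrow> y \<in> sliding_manifold B P \<Longrightarrow> d1 t y = 0"
    and A3_differentiable: "\<And>t X. t \<ge> 0 \<Longrightarrow> \<delta>z t differentiable (at X)"
    and A3_matched: "\<And>t X j. t \<ge> 0 \<Longrightarrow> block_jacobian (\<delta>z t) X j ** B = 0"
    and nonvanishing_C1: "\<And>X. (\<forall>t\<ge>0. (\<lambda>s. \<delta>z s X) differentiable (at t within {0..})) \<and>
      continuous_on {0..} (\<lambda>t. time_partial \<delta>z t X)"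
    and integrable_bounds: "\<And>R. \<exists>b. (\<forall>\<tau>\<ge>0. b absolutely_integrable_on {0..\<tau>}) \<and>
      (\<forall>t\<ge>0. \<forall>X. norm X \<le> R \<longrightarrow>
        norm (time_partial \<delta>z t X) \<le> b t \<and> norm (d1 t (X $ Min UNIV)) \<le> b t)"
    \<comment> \<open>closed-loop system and trajectory\<close>
    and parameters: "\<delta>0 > 0" "\<beta> > 0" "\<epsilon> > 0" "k3 > 0"
    and xb_eq: "\<And>t. xb t = stacked h x t"
    and w_eq: "\<And>t. w t = switching B P (x t)"
    and xbb_eq: "\<And>t. xbb t =
      (\<Sum>j\<in>UNIV. block_jacobian (\<delta>z t) (xb t) j *v vector_derivative x (at (t - h j)))"
    and k1_eq: "\<And>t. k1 t = gain1 \<delta>0 \<beta> \<epsilon> (\<rho>1 t (x t)) (\<rho>2 t (xb t) (xbb t))"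
    and k2_eq: "\<And>t. k2 t = gain2 \<beta> \<epsilon> (k1 t)"
    and u_eq: "\<And>t. u t = v_nom t + v t"
    and v_nom_eq: "\<And>t. v_nom t = (\<Sum>j\<in>UNIV. K j *v x (t - h j))"
    and v_eq: "\<And>t. v t = - (matrix_inv (input_matrix B P) *v
      ((2 *\<^sub>R (transpose B ** P)) *v (\<Sum>j\<in>UNIV. G j *v x (t - h j)) - u_sta t))"
    and u_sta_eq: "\<And>t. u_sta t = - k1 t *\<^sub>R xi1 k3 (w t) + \<rho> t"
    and \<rho>_dynamics: "has_ac_derivative \<rho> (\<lambda>t. - k2 t *\<^sub>R \<zeta> t)"
      "\<And>t. t \<ge> 0 \<Longrightarrow> \<zeta> t \<in> Xi2 k3 (w t)"
    and x_initial: "\<And>t. t \<in> {- max_delay h..0} \<Longrightarrow> x t = \<phi> t"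
    and x_dynamics: "has_ac_derivative x
      (\<lambda>t. (\<Sum>j\<in>UNIV. A j *v x (t - h j)) + B *v (u t + \<delta> t (xb t)))"
    and z_eq: "\<And>t. z t = \<rho> t + \<delta>z t (xb t)"
    \<comment> \<open>(A4); \<open>d2\<close> is the total time derivative of \<open>\<delta>z\<close> along the trajectory\<close>
    and d2_eq: "\<And>t. d2 t = time_partial \<delta>z t (xb t) + xbb t"
    and d2_derivative: "has_ac_derivative (\<lambda>t. \<delta>z t (xb t)) d2"
    and A4_positive: "\<And>t y. t \<ge> 0 \<Longrightarrow> \<rho>1 t y > 0" "\<And>t X Y. t \<ge> 0 \<Longrightarrow> \<rho>2 t X Y > 0"
    and A4_d1: "\<And>t y. t \<ge> 0 \<Longrightarrow> norm (d1 t y) \<le> \<rho>1 t y * norm (xi1 k3 (switching B P y))"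
    and A4_d2: "AE t in lebesgue. t \<ge> 0 \<longrightarrow> w t \<noteq> 0 \<longrightarrow>
      norm (d2 t) \<le> \<rho>2 t (xb t) (xbb t) * norm (xi2 k3 (w t))"
  shows "let Pst = P_st \<beta> \<epsilon> :: real^('k + 'k)^('k + 'k);
             \<eta>1 = \<epsilon> * sqrt (lambda_min Pst) / lambda_max Pst;
             \<eta>2 = 2 * \<epsilon> * k3 / lambda_max Pst;
             T = 2 / \<eta>2 * ln (1 + \<eta>2 / \<eta>1 * sqrt (V_st \<beta> \<epsilon> k3 (w 0) (z 0)))
         in (\<forall>t\<ge>T. x t \<in> sliding_manifold B P) \<and> (x \<longlongrightarrow> 0) at_top"
proof -
  define Pst where "Pst = (P_st \<beta> \<epsilon> :: real^('k + 'k)^('k + 'k))"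
  define \<eta>1 where "\<eta>1 = \<epsilon> * sqrt (lambda_min Pst) / lambda_max Pst"
  define \<eta>2 where "\<eta>2 = 2 * \<epsilon> * k3 / lambda_max Pst"
  define T where "T = settling \<eta>1 \<eta>2 (V_st \<beta> \<epsilon> k3 (w 0) (z 0))"
  define S where "S = 2 *\<^sub>R (transpose B ** P)"
  define M where "M = input_matrix B P"
  define q where "q t = (\<Sum>j\<in>UNIV. G j *v x (t - h j))" for t
  define f where "f t = (\<Sum>j\<in>UNIV. A j *v x (t - h j)) + B *v (u t + \<delta> t (xb t))" for t
  have PD: "positive_definite P" using A1 by (simp add: LK_assumption_def)
  have Minv: "invertible M" unfolding M_def using PD A2 by (rule input_matrix_invertible)
  have SB: "S ** B = M" by (simp add: S_def M_def input_matrix_def scalar_matrix_assoc)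
  have sw: "switching B P y = S *v y" for y by (simp add: switching_def S_def)
  have Minv2: "M ** matrix_inv M = mat 1 \<and> matrix_inv M ** M = mat 1"
    unfolding matrix_inv_def by (rule someI_ex) (use Minv in \<open>simp add: invertible_def\<close>)
  have Mi: "M *v (matrix_inv M *v y) = y" for y
    by (simp add: matrix_vector_mul_assoc Minv2)
  have iM: "matrix_inv M *v (M *v y) = y" for y
    by (simp add: matrix_vector_mul_assoc Minv2)
  have xb0: "xb t $ Min UNIV = x t" for t using delays(1) by (simp add: xb_eq stacked_def)
  have x_ac: "has_ac_derivative x f" using x_dynamics by (simp add: f_def[abs_def])
  \<comment> \<open>The nominal feedback turns each \<open>A j\<close> into \<open>G j\<close>; what
    remains enters through \<open>B\<close>.\<close>
  have f_eq: "f t = q t + B *v (v t + \<delta> t (xb t))" for t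
  proof -
    have "B *v v_nom t = (\<Sum>j\<in>UNIV. (B ** K j) *v x (t - h j))"
      by (simp add: v_nom_eq linear_sum[OF matrix_vector_mul_linear] matrix_vector_mul_assoc)
    then show ?thesis
      by (simp add: f_def q_def u_eq G_eq matrix_vector_right_distrib matrix_vector_mult_add_rdistrib sum.distrib)
  qed
  \<comment> \<open>\<open>M\<close> is \<open>S ** B\<close>, the matrix through which the input
    acts on w. Multiplied by it, the first part of \<open>v\<close> becomes the negative of the
    nominal drift \<open>S *v q t\<close>, so only the super-twisting terms survive in w'.\<close>
  have Mvd: "M *v (v t + \<delta> t (xb t)) = - (S *v q t) + (- k1 t *\<^sub>R xi1 k3 (w t) + z t + d1 t (x t))"
    if "t \<ge> 0" for t
  proof -
    have "M *v v t = - (S *v q t) + u_sta t"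
      unfolding v_eq M_def[symmetric] S_def[symmetric] q_def[symmetric]
      by (simp add: linear_neg[OF matrix_vector_mul_linear] Mi)
    moreover have "M *v \<delta> t (xb t) = d1 t (x t) + \<delta>z t (xb t)"
      using A3_split[OF that, of "xb t"] by (simp add: M_def xb0)
    ultimately show ?thesis
      by (simp add: matrix_vector_right_distrib u_sta_eq z_eq)
  qed
  define wd where "wd t = S *v f t" for t
  have w_ac: "has_ac_derivative w wd"
    using has_ac_derivative_linear[OF x_ac matrix_vector_mul_bounded_linear[of S]]
    by (simp add: wd_def[abs_def] w_eq[abs_def] sw)
  have wd: "wd t = - k1 t *\<^sub>R xi1 k3 (w t) + z t + d1 t (x t)" if "t \<ge> 0" for t
  proof -
    have "wd t = S *v q t + M *v (v t + \<delta> t (xb t))"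
      by (simp add: wd_def f_eq matrix_vector_right_distrib matrix_vector_mul_assoc SB[symmetric])
    then show ?thesis using Mvd[OF that] by simp
  qed
  have z_ac: "has_ac_derivative z (\<lambda>t. - k2 t *\<^sub>R \<zeta> t + d2 t)"
    using has_ac_derivative_add[OF \<rho>_dynamics(1) d2_derivative] by (simp add: z_eq[abs_def])
  have reach: "w t = 0 \<and> z t = 0" if "t \<ge> T" for t
  proof (rule super_twisting_finite_time[OF parameters w_ac z_ac])
    show "wd t = - k1 t *\<^sub>R xi1 k3 (w t) + z t + d1 t (x t)" if "t \<ge> 0" for t using wd[OF that] .
    \<comment> \<open>The Filippov inclusion is an equation only where w does not vanish, which is
      why the super-twisting lemma asks for the equation of z' only there.\<close>
    show "- k2 t *\<^sub>R \<zeta> t + d2 t = - k2 t *\<^sub>R xi2 k3 (w t) + d2 t" if "t \<ge> 0" "w t \<noteq> 0" for t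
      using \<rho>_dynamics(2)[OF that(1)] that(2) by (simp add: Xi2_def)
    show "norm (d1 t (x t)) \<le> \<rho>1 t (x t) * norm (xi1 k3 (w t))" if "t \<ge> 0" for t
      using A4_d1[OF that] by (simp add: w_eq)
    show "AE t in lebesgue. t \<ge> 0 \<longrightarrow> w t \<noteq> 0 \<longrightarrow>
      norm (d2 t) \<le> \<rho>2 t (xb t) (xbb t) * norm (xi2 k3 (w t))" by (rule A4_d2)
    show "settling \<eta>1 \<eta>2 (st_quad \<beta> \<epsilon> (xi1 k3 (w 0)) (z 0)) \<le> t"
      using that by (simp add: T_def V_st_eq)
  qed (fact k1_eq k2_eq Pst_def \<eta>1_def \<eta>2_def)+
  have T0: "T \<ge> 0"
  proof -
    note lam = lambda_P_st[OF parameters(2,3) Pst_def]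
    have "\<eta>1 > 0" "\<eta>2 > 0" using lam parameters by (simp_all add: \<eta>1_def \<eta>2_def)
    moreover have "V_st \<beta> \<epsilon> k3 (w 0) (z 0) \<ge> 0"
      unfolding V_st_eq using lam(1) by (intro order_trans[OF _ lam(3)]) simp
    ultimately show ?thesis unfolding T_def by (rule settling_nonneg)
  qed
  have "(x \<longlongrightarrow> 0) at_top"
  proof (rule sliding_motion_converges[OF delays A1 _ T0 q_def])
    have "max_delay h \<ge> 0" using delays_range(1,2)[OF delays] order_trans by blast
    then have "{- max_delay h..} = {- max_delay h..0} \<union> {0..}" by auto
    moreover have "continuous_on {- max_delay h..0} x"
      using initial_function by (rule continuous_on_eq) (simp add: x_initial)
    ultimately show "continuous_on {- max_delay h..} x"
      using has_ac_derivative_continuous[OF x_ac] by (simp add: continuous_on_closed_Un)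
    fix t assume t: "t \<ge> T"
    have "0 = S *v x t" using reach[OF t] by (simp add: w_eq sw)
    then show "transpose B *v (P *v x t) = 0"
      by (simp add: S_def matrix_vector_mul_assoc scaleR_matrix_vector_assoc[symmetric])
    \<comment> \<open>The equivalent control: with w = z = 0 and \<open>d1\<close> vanishing on the
      manifold, \<open>Mvd\<close> determines the sum of \<open>v\<close> and the disturbance as a
      fixed linear function of the nominal drift. After \<open>T\<close> the motion therefore obeys
      a linear delay equation free of uncertainty.\<close>
    have f: "f s = q s + B *v ((- (matrix_inv M ** S)) *v q s)" if "s \<ge> T" for s
    proof -
      have s0: "s \<ge> 0" using that T0 by simp
      have "x s \<in> sliding_manifold B P" using reach[OF that] by (simp add: sliding_manifold_def w_eq)
      then have "M *v (v s + \<delta> s (xb s)) = - (S *v q s)"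
        using Mvd[OF s0] reach[OF that] A3_vanishing[OF s0] by (simp add: xi1_eq)
      then have "v s + \<delta> s (xb s) = matrix_inv M *v (- (S *v q s))" using iM by metis
      also have "\<dots> = - ((matrix_inv M ** S) *v q s)"
        by (simp add: linear_neg[OF matrix_vector_mul_linear] matrix_vector_mul_assoc)
      also have "\<dots> = (- (matrix_inv M ** S)) *v q s"
        by (simp add: matrix_vector_mult_def vec_eq_iff sum_negf)
      finally show ?thesis by (simp only: f_eq)
    qed
    have "x t = x T + integral {T..t} f"
      using has_ac_derivativeD(2)[OF x_ac T0] t by blast
    also have "integral {T..t} f = integral {T..t} (\<lambda>s. q s + B *v ((- (matrix_inv M ** S)) *v q s))"
      by (rule Henstock_Kurzweil_Integration.integral_cong) (use f in auto)
    finally show "x t = x T + integral {T..t} (\<lambda>s. q s + B *v ((- (matrix_inv M ** S)) *v q s))" .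
  qed
  moreover have "x t \<in> sliding_manifold B P" if "t \<ge> T" for t
    using reach[OF that] by (simp add: sliding_manifold_def w_eq)
  ultimately show ?thesis
    unfolding Let_def T_def settling_def \<eta>1_def \<eta>2_def Pst_def by blast
qed

end
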